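(* For every $d \ge 2$ there is a constant $K = K(d) > 0$ such that for every positive integer $n$ and every $\varepsilon > 0$ there exists a set $\widetilde G \subset \mathbb{R}^d$ in general position which is the image of an $\varepsilon$-perturbation of $G = \{1,\dots,n\}^d$, such that every convex independent subset $\widetilde C \subseteq \widetilde G$ satisfies $|\widetilde C| \le K\, n^{\frac{d(d-1)}{d+1}}$.
   Context: A bijection $\tau:G\to\widetilde G$ is an $\varepsilon$-perturbation if $\|\tau(g)-g\|\le\varepsilon$ for all $g\in G$. A set is in general position if no $d+1$ of its points lie on a common hyperplane; a set is convex independent if it is in general position and its points are the vertices of a convex polytope. *)

theory Defs
  imports "HOL-Analysis.Analysis"
begin

definition grid :: "nat \<Rightarrow> (real ^ 'd) set" where
  "grid n = {x. \<forall>i. x $ i \<in> real ` {1..n}}"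

definition perturbation ::
  "real \<Rightarrow> (real ^ 'd) set \<Rightarrow> (real ^ 'd) set \<Rightarrow> (real ^ 'd \<Rightarrow> real ^ 'd) \<Rightarrow> bool" where
  "perturbation \<epsilon> G G' \<tau> \<longleftrightarrow> bij_betw \<tau> G G' \<and> (\<forall>g\<in>G. norm (\<tau> g - g) \<le> \<epsilon>)"

definition hyperplane :: "(real ^ 'd) set \<Rightarrow> bool" where
  "hyperplane H \<longleftrightarrow> (\<exists>a b. a \<noteq> 0 \<and> H = {x. a \<bullet> x = b})"

definition general_position :: "(real ^ 'd) set \<Rightarrow> bool" where
  "general_position X \<longleftrightarrow>
     \<not> (\<exists>S H. S \<subseteq> X \<and> finite S \<and> card S = CARD('d) + 1 \<and> hyperplane H \<and> S \<subseteq> H)"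

text \<open>Polytopes are convex hulls of finite sets of any dimension, the empty set included; their
  vertices are their extreme points.\<close>

definition convex_independent :: "(real ^ 'd) set \<Rightarrow> bool" where
  "convex_independent C \<longleftrightarrow>
     general_position C \<and> (\<exists>P. polytope P \<and> C = {v. v extreme_point_of P})"

end

theory Submission
  imports Defs
begin

text \<open>The grid point x is moved by a sum of terms of rapidly decreasing size, the k-th of which is a
  multiple of a vector w k that depends only on the k-th digits of the coordinates of x; the w k are
  generic, and a last, much smaller term creates general position. If a set C is convex independent
  after the perturbation, then each point of C has a supporting normal, and among collinear points of
  C whose normals have the same signs against the w k the digits leave only logarithmically many. As
  there are few sign patterns, a lattice segment of length m carries at most O(m powr (1/(2d - 1)))
  points of C.

  Before the perturbation all points of C lie on the boundary of their hull. A facet with primitive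
  outer normal u and N points of C contains a lattice segment of length m of order at least
  N powr (1/(d - 1)) by the pigeonhole principle, so the N points lie on many parallel lines, and a
  packing argument bounds its projected area from below by a multiple of
  N powr (1 + 2/(2d - 1)) times the largest coordinate of u. The projected areas add up to
  O(n powr (d - 1)), distinct facets have distinct integral normals, and optimizing over the sizes of
  the normals gives the bound. The exponent of N matters only through 2/(2d - 1) > 1/d.\<close>

subsection \<open>General position\<close>

text \<open>The exponent is the one that the theorem of Andrews on vertices of lattice polytopes,
  O(V powr ((d - 1)/(d + 1))) for volume V, gives for V = n^d. That theorem does not apply here:
  before the perturbation a facet of the hull of C may contain many points of C that are not its
  vertices. For N lattice points on a facet the area is in general only of order N times the size of
  the normal, which is too weak: a facet of the cube itself carries n^(d - 1) grid points. The
  missing gain has to come from the perturbation, which must thin out every lattice line.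

  If a segment of length m keeps O(m powr b) points, N enters the area with the exponent 1 + (1 -
  b)/(d - 1). About k^(d - 1) normals have largest coordinate k, so the sum over the normals has no
  logarithmic loss once this exponent exceeds 1 + 1/d, that is, once b < 1/d. The choice b = 1/(2d -
  1) is a convenient one: it makes the base of the digits an integer and the exponent equal to 1 +
  1/(d - 1/2).\<close>

lemma negligible_affine_hull_card_le:
  fixes S :: "'a::euclidean_space set"
  assumes "finite S" "card S \<le> DIM('a)"
  shows "negligible (affine hull S)"
  using empty_interior_affine_hull[OF assms]
  by (simp add: affine_imp_convex negligible_convex_interior)

text \<open>The images are chosen one at a time, each in its ball but off the affine hulls of all
  sets of at most \<open>DIM('a)\<close> earlier images; these are finitely many null sets. All
  sizes up to \<open>DIM('a) + 1\<close> are included because the induction step removes the new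
  point and needs the remaining ones to be independent.\<close>

lemma general_position_perturbation:
  fixes f :: "'b \<Rightarrow> 'a::euclidean_space"
  assumes "finite A" "e > 0"
  shows "\<exists>g. inj_on g A \<and> (\<forall>x\<in>A. norm (g x - f x) < e) \<and>
    (\<forall>S\<subseteq>g ` A. card S \<le> DIM('a) + 1 \<longrightarrow> \<not> affine_dependent S)"
  using assms(1)
proof induction
  case empty
  then show ?case by (auto simp: affine_dependent_def)
next
  case (insert x A)
  then obtain g where g: "inj_on g A" "\<forall>x\<in>A. norm (g x - f x) < e"
    "\<And>S. S \<subseteq> g ` A \<Longrightarrow> card S \<le> DIM('a) + 1 \<Longrightarrow> \<not> affine_dependent S"
    by blast
  let ?\<S> = "{S. S \<subseteq> g ` A \<and> card S \<le> DIM('a)}"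
  have "negligible (\<Union> ((hull) affine ` ?\<S>))"
    using insert.hyps(1)
    by (intro negligible_Union)
       (auto intro!: negligible_affine_hull_card_le intro: finite_subset)
  then have "\<not> ball (f x) e \<subseteq> \<Union> ((hull) affine ` ?\<S>)"
    using open_not_negligible[of "ball (f x) e"] assms(2) negligible_subset by (metis ball_eq_empty not_le open_ball)
  then obtain y where "y \<in> ball (f x) e" "y \<notin> \<Union> ((hull) affine ` ?\<S>)"
    by blast
  then have y: "y \<in> ball (f x) e" "\<And>S. S \<subseteq> g ` A \<Longrightarrow> card S \<le> DIM('a) \<Longrightarrow> y \<notin> affine hull S"
    by auto
  have y_new: "y \<notin> g ` A"
    using y(2)[of "{y}"] by (auto simp: Suc_le_eq)
  let ?g = "g(x := y)"
  have im: "?g ` insert x A = insert y (g ` A)"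
    using insert.hyps(2) by auto
  have ind: "\<not> affine_dependent S" if S: "S \<subseteq> insert y (g ` A)" "card S \<le> DIM('a) + 1" for S
  proof (cases "y \<in> S")
    case False
    with S g(3) show ?thesis by blast
  next
    case True
    have fin: "finite S" using S(1) insert.hyps(1) by (meson finite_imageI finite_insert finite_subset)
    have sub: "S - {y} \<subseteq> g ` A" using S by auto
    have c: "card (S - {y}) \<le> DIM('a)" using S True fin by simp
    have "\<not> affine_dependent (insert y (S - {y}))"
      by (rule affine_independent_insert) (use g(3)[OF sub] c y(2)[OF sub c] in auto)
    with True show ?thesis by (simp add: insert_absorb)
  qed
  have "inj_on ?g (insert x A)"
    using g(1) insert.hyps(2) y_new by (auto simp: inj_on_def)
  moreover have "\<forall>z\<in>insert x A. norm (?g z - f z) < e"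
    using g(2) y(1) by (auto simp: dist_norm norm_minus_commute)
  ultimately show ?case
    using ind unfolding im[symmetric] by blast
qed

lemma general_positionI:
  fixes X :: "(real ^ 'd) set"
  assumes "\<And>S. S \<subseteq> X \<Longrightarrow> card S \<le> CARD('d) + 1 \<Longrightarrow> \<not> affine_dependent S"
  shows "general_position X"
  unfolding general_position_def hyperplane_def
proof clarsimp
  fix S and a :: "real ^ 'd" and b
  assume S: "S \<subseteq> X" "finite S" "card S = Suc CARD('d)" and a: "a \<noteq> 0" "S \<subseteq> {x. a \<bullet> x = b}"
  have "aff_dim S = int CARD('d)"
    using assms[of S] S by (simp add: affine_independent_iff_card)
  moreover have "aff_dim S \<le> int CARD('d) - 1"
    using aff_dim_subset[OF a(2)] a(1) by (simp add: aff_dim_hyperplane)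
  ultimately show False by simp
qed

text \<open>Any d of the vectors are linearly independent; compactness turns this into a uniform bound.\<close>

lemma generic_directions:
  "\<exists>(w :: nat \<Rightarrow> real ^ 'd) \<kappa>. \<kappa> > 0 \<and>
    (\<forall>\<nu>. norm \<nu> = 1 \<longrightarrow> card {k\<in>{..<r}. \<bar>\<nu> \<bullet> w k\<bar> < \<kappa>} < CARD('d))"
proof -
  obtain g :: "nat \<Rightarrow> real ^ 'd" where g: "inj_on g {..r}"
    "\<And>S. S \<subseteq> g ` {..r} \<Longrightarrow> card S \<le> DIM(real ^ 'd) + 1 \<Longrightarrow> \<not> affine_dependent S"
    using general_position_perturbation[of "{..r}" 1 "\<lambda>_. 0 :: real ^ 'd"] by auto
  \<comment> \<open>A nonzero normal orthogonal to \<open>w k\<close> for \<open>CARD('d)\<close>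
    indices \<open>k\<close> would put these \<open>g k\<close> and the base point
    \<open>g r\<close> on one hyperplane, against the independence of any
    \<open>CARD('d) + 1\<close> of the points.\<close>
  define w where "w k = g k - g r" for k
  let ?\<K> = "{K. K \<subseteq> {..<r} \<and> card K = CARD('d)}"
  define \<phi> where "\<phi> K \<nu> = (\<Sum>k\<in>K. \<bar>\<nu> \<bullet> w k\<bar>)" for K and \<nu> :: "real ^ 'd"
  have pos: "\<phi> K \<nu> > 0" if K: "K \<in> ?\<K>" and \<nu>: "norm \<nu> = 1" for K \<nu>
  proof (rule ccontr)
    assume "\<not> \<phi> K \<nu> > 0"
    moreover have finK: "finite K" using K finite_subset by auto
    ultimately have 0: "\<forall>k\<in>K. \<nu> \<bullet> w k = 0"
      unfolding \<phi>_def by (meson abs_ge_zero abs_le_zero_iff linorder_not_less sum_pos2)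
    have rK: "r \<notin> K" using K by auto
    have injK: "inj_on g (insert r K)"
      using g(1) by (rule inj_on_subset) (use K in auto)
    let ?S = "g ` insert r K"
    have cS: "card ?S = CARD('d) + 1"
      using card_image[OF injK] finK rK K by simp
    have "\<not> affine_dependent ?S"
      by (rule g(2)) (use K cS in \<open>auto intro!: imageI\<close>)
    then have "aff_dim ?S = int (CARD('d))"
      using cS by (simp add: affine_independent_iff_card)
    moreover have "?S \<subseteq> {x. \<nu> \<bullet> x = \<nu> \<bullet> g r}"
      using 0 by (auto simp: w_def inner_diff_right)
    then have "aff_dim ?S \<le> aff_dim {x. \<nu> \<bullet> x = \<nu> \<bullet> g r}"
      by (rule aff_dim_subset)
    moreover have "\<nu> \<noteq> 0" using \<nu> by auto
    ultimately show False by (simp add: aff_dim_hyperplane)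
  qed
  have "\<exists>c>0. \<forall>\<nu>. norm \<nu> = 1 \<longrightarrow> c \<le> \<phi> K \<nu>" if K: "K \<in> ?\<K>" for K
  proof -
    have "continuous_on (sphere 0 1) (\<phi> K)"
      unfolding \<phi>_def by (intro continuous_intros)
    then obtain x where "x \<in> sphere 0 1" "\<forall>y\<in>sphere 0 1. \<phi> K x \<le> \<phi> K y"
      using continuous_attains_inf[of "sphere 0 1 :: (real^'d) set" "\<phi> K"] by auto
    then show ?thesis
      using pos[OF K, of x] by (intro exI[of _ "\<phi> K x"]) auto
  qed
  then obtain c where c: "\<And>K. K \<in> ?\<K> \<Longrightarrow> c K > 0 \<and> (\<forall>\<nu>. norm \<nu> = 1 \<longrightarrow> c K \<le> \<phi> K \<nu>)"
    by metis
  have fin: "finite ?\<K>" by simp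
  \<comment> \<open>The 1 keeps the minimum defined when \<open>r < CARD('d)\<close> and there is no
    index set at all.\<close>
  define c0 where "c0 = Min (insert 1 (c ` ?\<K>))"
  have c0: "c0 > 0" "\<And>K. K \<in> ?\<K> \<Longrightarrow> c0 \<le> c K"
    unfolding c0_def using fin c by (auto intro: Min_le)
  define \<kappa> where "\<kappa> = c0 / CARD('d)"
  have "card {k\<in>{..<r}. \<bar>\<nu> \<bullet> w k\<bar> < \<kappa>} < CARD('d)" if \<nu>: "norm \<nu> = 1" for \<nu>
  proof (rule ccontr)
    assume "\<not> ?thesis"
    then obtain K where K: "K \<subseteq> {k\<in>{..<r}. \<bar>\<nu> \<bullet> w k\<bar> < \<kappa>}" "card K = CARD('d)"
      by (meson not_less obtain_subset_with_card_n)
    then have K': "K \<in> ?\<K>" by auto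
    have "\<phi> K \<nu> < (\<Sum>k\<in>K. \<kappa>)"
      unfolding \<phi>_def by (rule sum_strict_mono) (use K in \<open>auto intro: finite_subset\<close>)
    also have "\<dots> = c0" using K by (simp add: \<kappa>_def)
    finally show False using c[OF K'] c0(2)[OF K'] \<nu> by fastforce
  qed
  moreover have "\<kappa> > 0" using c0 by (simp add: \<kappa>_def)
  ultimately show ?thesis by blast
qed

subsection \<open>Layered points on a line\<close>

text \<open>Points x, y, z with y between x and z and with x, y in the same class, below that of z, cannot
  all be present, so each lower class has at most one point on either side of a point of the top class.\<close>

lemma card_layered_chain_le:
  fixes s :: "nat \<Rightarrow> 'b \<Rightarrow> nat" and t :: "'b \<Rightarrow> real" and \<sigma> :: "nat \<Rightarrow> int"
  assumes "finite S" and t: "inj_on t S" and sD: "\<And>k x. s k x < D"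
    and sep: "\<And>x y. x \<in> S \<Longrightarrow> y \<in> S \<Longrightarrow> (\<And>j. j < r \<Longrightarrow> s j x = s j y) \<Longrightarrow> x = y"
    and P: "\<And>k x y z. \<lbrakk>k < r; \<sigma> k \<noteq> 0; x \<in> S; y \<in> S; z \<in> S; \<And>j. j < k \<Longrightarrow> s j x = s j y \<and> s j z = s j y;
        s k x = s k y; t x < t y \<and> t y < t z \<or> t z < t y \<and> t y < t x;
        \<sigma> k * int (s k y) < \<sigma> k * int (s k z)\<rbrakk> \<Longrightarrow> False"
  shows "card S \<le> D ^ card {k. k < r \<and> \<sigma> k = 0} * (1 + 2 * D * r)"
proof -
  have D: "D \<ge> 1" using sD[of 0 undefined] by simp
  \<comment> \<open>The induction runs over sets that already agree on the first \<open>k\<close>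
    levels. A level with \<open>\<sigma> k = 0\<close> gives no information and costs a factor
    \<open>D\<close>. Any other level costs only \<open>2 * D\<close> further points, up to the
    factor already present, so these levels enter linearly.\<close>
  have "card X \<le> D ^ card {j. k \<le> j \<and> j < r \<and> \<sigma> j = 0} * (1 + 2 * D * (r - k))"
    if "k \<le> r" "X \<subseteq> S" "\<And>x y j. x \<in> X \<Longrightarrow> y \<in> X \<Longrightarrow> j < k \<Longrightarrow> s j x = s j y" for k X
    using that
  proof (induction "r - k" arbitrary: k X)
    case 0
    then have "k = r" by simp
    have "x = y" if "x \<in> X" "y \<in> X" for x y
      using 0 that sep[of x y] \<open>k = r\<close> by blast
    moreover have "finite X" using 0 assms(1) finite_subset by blast
    ultimately have "card X \<le> 1"
      using card_le_Suc0_iff_eq[of X] by auto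
    moreover have "{j. k \<le> j \<and> j < r \<and> \<sigma> j = 0} = {}" using \<open>k = r\<close> by auto
    ultimately show ?case using \<open>k = r\<close> by (simp only: card.empty) simp
  next
    case (Suc n)
    have kr: "k < r" and n: "n = r - Suc k" using Suc by auto
    have finX: "finite X" using Suc.prems assms(1) finite_subset by blast
    let ?z = "\<lambda>k. card {j. k \<le> j \<and> j < r \<and> \<sigma> j = 0}"
    have IH: "card Y \<le> D ^ ?z (Suc k) * (1 + 2 * D * (r - Suc k))"
      if Y: "Y \<subseteq> X" "\<And>x y. x \<in> Y \<Longrightarrow> y \<in> Y \<Longrightarrow> s k x = s k y" for Y
    proof (rule Suc.hyps(1)[OF n])
      show "s j x = s j y" if "x \<in> Y" "y \<in> Y" "j < Suc k" for x y j
      proof (cases "j = k")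
        case True
        show ?thesis unfolding True by (rule Y(2)) (rule that)+
      next
        case False
        show ?thesis by (rule Suc.prems(3)) (use that Y(1) False in auto)
      qed
    qed (use kr Y(1) Suc.prems(2) in auto)
    show ?case
    proof (cases "\<sigma> k = 0")
      case True
      have "X = (\<Union>v<D. {x \<in> X. s k x = v})" using sD by auto
      then have "card X \<le> (\<Sum>v<D. card {x \<in> X. s k x = v})"
        using card_UN_le[of "{..<D}" "\<lambda>v. {x \<in> X. s k x = v}"] by simp
      also have "\<dots> \<le> (\<Sum>v<D. D ^ ?z (Suc k) * (1 + 2 * D * (r - Suc k)))"
        by (intro sum_mono IH) simp_all
      also have "\<dots> = D ^ Suc (?z (Suc k)) * (1 + 2 * D * (r - Suc k))"
        by (simp add: algebra_simps)
      also have "\<dots> \<le> D ^ Suc (?z (Suc k)) * (1 + 2 * D * (r - k))"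
        by (intro mult_left_mono add_left_mono diff_le_mono2) auto
      also have "{j. k \<le> j \<and> j < r \<and> \<sigma> j = 0} = insert k {j. Suc k \<le> j \<and> j < r \<and> \<sigma> j = 0}"
        using True kr by auto
      then have "Suc (?z (Suc k)) = ?z k" by simp
      finally show ?thesis .
    next
      case False
      have zk: "?z (Suc k) = ?z k"
        using False by (intro arg_cong[where f = card]) (auto simp: Suc_le_eq order_le_less)
      show ?thesis
      proof (cases "X = {}")
        case True then show ?thesis by simp
      next
        case ne: False
        obtain z where z: "z \<in> X" "\<And>x. x \<in> X \<Longrightarrow> \<sigma> k * int (s k x) \<le> \<sigma> k * int (s k z)"
        proof -
          let ?M = "(\<lambda>x. \<sigma> k * int (s k x)) ` X"
          have "Max ?M \<in> ?M" using finX ne by (intro Max_in) auto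
          then obtain z where "z \<in> X" "Max ?M = \<sigma> k * int (s k z)" by auto
          then show ?thesis using that[of z] finX by (metis (no_types, lifting) Max_ge finite_imageI imageI)
        qed
        \<comment> \<open>Only the top class \<open>T\<close> is passed on to the next level; all
          lower classes together contribute at most \<open>D\<close> points on each side of
          \<open>z\<close>.\<close>
        define T where "T = {x \<in> X. s k x = s k z}"
        define L where "L = {x \<in> X - T. t x < t z}"
        define R where "R = {x \<in> X - T. t z < t x}"
        have less: "\<sigma> k * int (s k x) < \<sigma> k * int (s k z)" if "x \<in> X - T" for x
          using z(2)[of x] that False by (auto simp: T_def order_le_less)
        have crossing: False
          if xy: "x \<in> X - T" "y \<in> X - T" "s k x = s k y" "t x < t y \<and> t y < t z \<or> t z < t y \<and> t y < t x" for x y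
        proof (rule P[OF kr False _ _ _ _ xy(3,4) less[OF xy(2)]])
          show "x \<in> S" "y \<in> S" "z \<in> S" using xy z(1) Suc.prems(2) by auto
          show "s j x = s j y \<and> s j z = s j y" if "j < k" for j
            using Suc.prems(3)[of x y j] Suc.prems(3)[of z y j] that xy(1,2) z(1) by auto
        qed
        have t_ne: "t x \<noteq> t y" if "x \<in> X" "y \<in> X" "x \<noteq> y" for x y
          using that t Suc.prems(2) by (auto simp: inj_on_def)
        have injL: "inj_on (s k) L"
        proof (rule inj_onI, rule ccontr)
          fix x y assume xy: "x \<in> L" "y \<in> L" "s k x = s k y" "x \<noteq> y"
          then show False
            using t_ne[of x y] crossing[of x y] crossing[of y x]
            by (cases "t x" "t y" rule: linorder_cases) (auto simp: L_def)
        qed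
        have injR: "inj_on (s k) R"
        proof (rule inj_onI, rule ccontr)
          fix x y assume xy: "x \<in> R" "y \<in> R" "s k x = s k y" "x \<noteq> y"
          then show False
            using t_ne[of x y] crossing[of x y] crossing[of y x]
            by (cases "t x" "t y" rule: linorder_cases) (auto simp: R_def)
        qed
        have cL: "card L \<le> D" "card R \<le> D"
          using card_inj_on_le[OF injL, of "{..<D}"] card_inj_on_le[OF injR, of "{..<D}"] sD by auto
        have "X \<subseteq> T \<union> (L \<union> R)"
        proof
          fix x assume x: "x \<in> X"
          show "x \<in> T \<union> (L \<union> R)"
          proof (cases "x = z")
            case False
            then have "t x \<noteq> t z" by (rule t_ne[OF x z(1)])
            then show ?thesis using x by (auto simp: L_def R_def)
          qed (use z in \<open>auto simp: T_def\<close>)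
        qed
        then have "card X \<le> card (T \<union> (L \<union> R))"
          using finX by (intro card_mono) (auto simp: T_def L_def R_def)
        also have "\<dots> \<le> card T + (card L + card R)"
          by (meson add_left_mono card_Un_le order_trans)
        also have "\<dots> \<le> D ^ ?z k * (1 + 2 * D * (r - Suc k)) + 2 * D"
        proof -
          have "card T \<le> D ^ ?z (Suc k) * (1 + 2 * D * (r - Suc k))"
            by (rule IH) (auto simp: T_def)
          then show ?thesis using cL by (simp add: zk)
        qed
        also have "\<dots> \<le> D ^ ?z k * (1 + 2 * D * (r - Suc k)) + D ^ ?z k * (2 * D)"
          using D by simp
        also have "\<dots> = D ^ ?z k * (1 + 2 * D * (r - k))"
        proof -
          have "r - k = Suc (r - Suc k)" using kr by simp
          then show ?thesis by (simp only:) (simp add: algebra_simps)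
        qed
        finally show ?thesis .
      qed
    qed
  qed
  from this[of 0 S] show ?thesis by simp
qed

text \<open>The displacement of a point is dominated by its first term that distinguishes it from others.\<close>

lemma displaced_between_not_exposed:
  fixes w :: "nat \<Rightarrow> 'a::real_inner" and s :: "nat \<Rightarrow> 'a \<Rightarrow> nat" and \<tau> :: "'a \<Rightarrow> 'a"
    and \<delta> \<rho> W \<kappa> a :: real
  assumes pos: "\<delta> > 0" "\<rho> > 0" "\<rho> \<le> 1" "W \<ge> 0"
    and w: "\<And>j. j < r \<Longrightarrow> norm (w j) \<le> W" and sD: "\<And>k x. s k x < D"
    and \<tau>: "\<And>u. u \<in> {x, y, z} \<Longrightarrow> norm (\<tau> u - (u + (\<Sum>j<r. (\<delta> * \<rho> ^ j * s j u) *\<^sub>R w j))) \<le> \<delta> * \<rho> ^ r"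
    and \<rho>: "2 * \<rho> * (r * D * W + 1) < a * \<kappa>" and a: "0 < a" "a \<le> 1" "y = (1 - a) *\<^sub>R x + a *\<^sub>R z"
    and k: "k < r" "\<And>j. j < k \<Longrightarrow> s j x = s j y \<and> s j z = s j y" "s k x = s k y"
    and \<nu>: "norm \<nu> = 1" "\<nu> \<bullet> \<tau> x < \<nu> \<bullet> \<tau> y" "\<nu> \<bullet> \<tau> z < \<nu> \<bullet> \<tau> y"
    and sgn: "\<kappa> \<le> (real (s k z) - real (s k y)) * (\<nu> \<bullet> w k)"
  shows False
proof -
  \<comment> \<open>The displacement in direction \<open>\<nu>\<close> is split by levels:
    \<open>H\<close> below level \<open>k\<close>, common to the three points; \<open>h k\<close> at
    level \<open>k\<close>; and the tail \<open>T\<close>, which includes the final correction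
    \<open>c\<close> and is bounded by a multiple of \<open>\<rho> ^ Suc k\<close>.\<close>
  define h where "h j u = \<delta> * \<rho> ^ j * s j u * (\<nu> \<bullet> w j)" for j u
  define c where "c u = \<nu> \<bullet> (\<tau> u - (u + (\<Sum>j<r. (\<delta> * \<rho> ^ j * s j u) *\<^sub>R w j)))" for u
  define T where "T u = (\<Sum>j\<in>{Suc k..<r}. h j u) + c u" for u
  define H where "H = (\<Sum>j<k. h j y)"
  let ?E = "\<delta> * \<rho> ^ Suc k * (r * D * W + 1)"
  have dec: "\<nu> \<bullet> \<tau> u = \<nu> \<bullet> u + H + h k u + T u" if u: "u \<in> {x, y, z}" for u
  proof -
    have eq: "{..<r} = {..<k} \<union> {k} \<union> {Suc k..<r}" using k(1) by auto
    have "(\<Sum>j<r. h j u) = (\<Sum>j<k. h j u) + h k u + (\<Sum>j\<in>{Suc k..<r}. h j u)"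
      unfolding eq by (subst sum.union_disjoint; auto)+
    moreover have "(\<Sum>j<k. h j u) = H"
      unfolding H_def using k(2) u by (intro sum.cong) (auto simp: h_def)
    moreover have "\<nu> \<bullet> \<tau> u = \<nu> \<bullet> u + (\<Sum>j<r. h j u) + c u"
      by (simp add: c_def h_def inner_sum_right inner_diff_right inner_add_right)
    ultimately show ?thesis by (simp add: T_def)
  qed
  have T: "\<bar>T u\<bar> \<le> ?E" if u: "u \<in> {x, y, z}" for u
  proof -
    have hb: "\<bar>h j u\<bar> \<le> \<delta> * \<rho> ^ Suc k * (D * W)" if j: "j \<in> {Suc k..<r}" for j
    proof -
      have "\<bar>\<nu> \<bullet> w j\<bar> \<le> W"
        using Cauchy_Schwarz_ineq2[of \<nu> "w j"] \<nu>(1) w[of j] j by simp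
      moreover have "\<rho> ^ j \<le> \<rho> ^ Suc k"
        using j pos by (intro power_decreasing) auto
      moreover have "real (s j u) \<le> real D" using sD[of j u] by simp
      ultimately have "(\<delta> * \<rho> ^ j * real (s j u)) * \<bar>\<nu> \<bullet> w j\<bar> \<le> (\<delta> * \<rho> ^ Suc k * D) * W"
        using pos by (intro mult_mono mult_left_mono) simp_all
      then show ?thesis using pos by (simp add: h_def abs_mult mult_ac)
    qed
    have "\<bar>\<Sum>j\<in>{Suc k..<r}. h j u\<bar> \<le> (\<Sum>j\<in>{Suc k..<r}. \<bar>h j u\<bar>)" by (rule sum_abs)
    also have "\<dots> \<le> (\<Sum>j\<in>{Suc k..<r}. \<delta> * \<rho> ^ Suc k * (D * W))" by (intro sum_mono hb)
    also have "\<dots> \<le> r * (\<delta> * \<rho> ^ Suc k * (D * W))"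
      using pos by (auto intro!: mult_right_mono)
    finally have 1: "\<bar>\<Sum>j\<in>{Suc k..<r}. h j u\<bar> \<le> r * (\<delta> * \<rho> ^ Suc k * (D * W))" .
    have "\<bar>c u\<bar> \<le> \<delta> * \<rho> ^ r"
      using Cauchy_Schwarz_ineq2[of \<nu>] \<nu>(1) \<tau>[OF u] unfolding c_def
      by (metis (no_types, lifting) mult_1 order_trans)
    also have "\<dots> \<le> \<delta> * \<rho> ^ Suc k"
      using k(1) pos by (intro mult_left_mono power_decreasing) auto
    finally have 2: "\<bar>c u\<bar> \<le> \<delta> * \<rho> ^ Suc k" .
    show ?thesis using 1 2 unfolding T_def by (simp add: algebra_simps)
  qed
  have y: "\<nu> \<bullet> y = (1 - a) * (\<nu> \<bullet> x) + a * (\<nu> \<bullet> z)"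
    by (subst a(3)) (simp add: inner_add_right)
  have hxy: "h k x = h k y" using k(3) by (simp add: h_def)
  \<comment> \<open>Here \<open>y\<close> is a convex combination of \<open>x\<close> and
    \<open>z\<close> and yet exceeds both after the displacement. The undisplaced terms cancel, and
    so do \<open>H\<close> and \<open>h k x = h k y\<close>; hence the tails would have to outweigh
    the gain of \<open>z\<close> over \<open>y\<close> at level \<open>k\<close>, which is larger by
    a factor of order \<open>1 / \<rho>\<close>.\<close>
  have "(1 - a) * (\<nu> \<bullet> \<tau> x) + a * (\<nu> \<bullet> \<tau> z) < \<nu> \<bullet> \<tau> y"
  proof -
    have "(1 - a) * (\<nu> \<bullet> \<tau> x) \<le> (1 - a) * (\<nu> \<bullet> \<tau> y)"
      using a \<nu> by (intro mult_left_mono) auto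
    moreover have "a * (\<nu> \<bullet> \<tau> z) < a * (\<nu> \<bullet> \<tau> y)"
      using a \<nu> by (intro mult_strict_left_mono) auto
    ultimately show ?thesis by (simp add: algebra_simps)
  qed
  then have "a * (h k z - h k y) < T y - (1 - a) * T x - a * T z"
    unfolding dec[of x, simplified] dec[of y, simplified] dec[of z, simplified] y hxy
    by (simp add: algebra_simps)
  also have "\<dots> \<le> ?E + (1 - a) * ?E + a * ?E"
  proof -
    have "- ((1 - a) * T x) \<le> (1 - a) * ?E"
      using T[of x] a mult_left_mono[of "- T x" ?E "1 - a"] by (auto simp: abs_le_iff)
    moreover have "- (a * T z) \<le> a * ?E"
      using T[of z] a mult_left_mono[of "- T z" ?E "a"] by (auto simp: abs_le_iff)
    moreover have "T y \<le> ?E" using T[of y] by auto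
    ultimately show ?thesis by linarith
  qed
  also have "\<dots> = \<delta> * \<rho> ^ k * (2 * \<rho> * (r * D * W + 1))"
    by (simp add: algebra_simps)
  also have "\<dots> < \<delta> * \<rho> ^ k * (a * \<kappa>)"
    using \<rho> pos by (intro mult_strict_left_mono) auto
  also have "\<dots> \<le> \<delta> * \<rho> ^ k * (a * ((real (s k z) - real (s k y)) * (\<nu> \<bullet> w k)))"
    using sgn a pos by (intro mult_left_mono) auto
  also have "\<dots> = a * (h k z - h k y)"
    by (simp add: h_def algebra_simps)
  finally show False by simp
qed

subsection \<open>Integral normals and packing\<close>

definition integer_vectors :: "(real ^ 'd) set" where
  "integer_vectors = {x. \<forall>i. x $ i \<in> \<int>}"

lemma integer_vectors_closed:
  "0 \<in> integer_vectors" "axis i 1 \<in> integer_vectors"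
  "x \<in> integer_vectors \<Longrightarrow> y \<in> integer_vectors \<Longrightarrow> x + y \<in> integer_vectors"
  "x \<in> integer_vectors \<Longrightarrow> y \<in> integer_vectors \<Longrightarrow> x - y \<in> integer_vectors"
  "x \<in> integer_vectors \<Longrightarrow> - x \<in> integer_vectors"
  "x \<in> integer_vectors \<Longrightarrow> r \<in> \<int> \<Longrightarrow> r *\<^sub>R x \<in> integer_vectors"
  by (auto simp: integer_vectors_def axis_def)

lemma inner_integer_vectors:
  "x \<in> integer_vectors \<Longrightarrow> y \<in> integer_vectors \<Longrightarrow> x \<bullet> y \<in> \<int>"
  by (auto simp: integer_vectors_def inner_vec_def intro!: Ints_sum Ints_mult)

lemma grid_subset_integer_vectors: "grid n \<subseteq> integer_vectors"
  by (auto simp: grid_def integer_vectors_def) (metis Ints_of_nat imageE)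

lemma finite_grid: "finite (grid n)"
proof -
  have "grid n \<subseteq> vec_lambda ` (PiE UNIV (\<lambda>_. real ` {1..n}))"
  proof
    fix x :: "real ^ 'd" assume "x \<in> grid n"
    then have "vec_nth x \<in> PiE UNIV (\<lambda>_. real ` {1..n})" by (auto simp: grid_def)
    then show "x \<in> vec_lambda ` (PiE UNIV (\<lambda>_. real ` {1..n}))"
      by (metis image_iff vec_lambda_eta)
  qed
  then show ?thesis by (rule finite_subset) (intro finite_imageI finite_PiE; simp)
qed

text \<open>A generalized cross product: the determinant with one free row and the vectors of
  \<open>B\<close> as the other rows is a linear form that vanishes on \<open>B\<close>, and its
  coefficients are determinants of integral matrices. It is not zero because a vector outside
  \<open>span B\<close> completes \<open>B\<close> to a basis.\<close>

lemma integer_normal_of_independent: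
  fixes B :: "(real ^ 'd) set"
  assumes B: "independent B" "card B = CARD('d) - 1" "B \<subseteq> integer_vectors"
  obtains u where "u \<in> integer_vectors" "u \<noteq> 0" "\<And>b. b \<in> B \<Longrightarrow> u \<bullet> b = 0"
proof -
  have finB: "finite B" using B(1) independent_imp_finite by blast
  obtain i0 :: 'd where True by simp
  have "card (UNIV - {i0}) = card B" using B(2) by (simp add: card_Diff_singleton)
  then obtain \<beta> where \<beta>: "bij_betw \<beta> (UNIV - {i0}) B"
    using finite_same_card_bij finB by (metis finite)
  have "dim B < DIM(real ^ 'd)"
    using B(1,2) by (simp add: dim_eq_card_independent)
  then have "span B \<noteq> UNIV" by (metis dim_UNIV dim_span less_irrefl)
  then obtain x0 where x0: "x0 \<notin> span B" by blast
  define M where "M x = (\<chi> k. if k = i0 then x else \<beta> k)" for x :: "real ^ 'd"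
  define \<phi> where "\<phi> x = det (M x)" for x
  define u where "u = (\<chi> j. \<phi> (axis j 1))"
  have "linear \<phi>"
  proof (rule linearI)
    show "\<phi> (x + y) = \<phi> x + \<phi> y" for x y
      unfolding \<phi>_def M_def by (rule det_row_add)
    show "\<phi> (c *\<^sub>R x) = c *\<^sub>R \<phi> x" for c x
    proof -
      have *: "c *\<^sub>R x = c *s x" by (simp add: vec_eq_iff)
      show ?thesis unfolding \<phi>_def M_def by (simp only: * det_row_mul real_scaleR_def)
    qed
  qed
  have u: "\<phi> x = u \<bullet> x" for x
  proof -
    have "x = (\<Sum>j\<in>UNIV. (x $ j) *\<^sub>R axis j 1)"
    proof -
      have "(x $ j) *\<^sub>R axis j 1 = (x $ j) *s (axis j 1 :: real ^ 'd)" for j by (simp add: vec_eq_iff)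
      then show ?thesis using basis_expansion[of x] by simp
    qed
    then have "\<phi> x = \<phi> (\<Sum>j\<in>UNIV. (x $ j) *\<^sub>R axis j 1)" by simp
    also have "\<dots> = (\<Sum>j\<in>UNIV. (x $ j) * \<phi> (axis j 1))"
      using \<open>linear \<phi>\<close> by (simp add: linear_sum linear_cmul)
    also have "\<dots> = u \<bullet> x" by (simp add: u_def inner_vec_def mult.commute)
    finally show ?thesis .
  qed
  have "rows (M x0) = insert x0 B"
  proof -
    have "rows (M x0) = (\<lambda>i. M x0 $ i) ` UNIV" by (auto simp: rows_def row_def vec_lambda_eta)
    also have "\<dots> = insert x0 (\<beta> ` (UNIV - {i0}))" by (auto simp: M_def image_iff)
    finally show ?thesis using \<beta> by (simp add: bij_betw_def)
  qed
  moreover have "dim (insert x0 B) = CARD('d)"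
  proof -
    have "independent (insert x0 B)" using B(1) x0 by (simp add: independent_insert)
    moreover have "x0 \<notin> B" using x0 span_base by blast
    moreover have "CARD('d) > 0" by simp
    ultimately show ?thesis using finB B(2) by (simp add: dim_eq_card_independent)
  qed
  ultimately have "rank (M x0) = CARD('d)" by (simp add: row_rank_def)
  then have "\<phi> x0 \<noteq> 0" by (simp add: \<phi>_def det_eq_0_rank)
  then have "u \<noteq> 0" using u by auto
  moreover have "u \<bullet> b = 0" if "b \<in> B" for b
  proof -
    have "b \<in> \<beta> ` (UNIV - {i0})" using \<beta> that by (simp add: bij_betw_def)
    then obtain k where k: "k \<noteq> i0" "\<beta> k = b" by blast
    have "det (M b) = 0"
      by (rule det_identical_rows[OF k(1)[symmetric]]) (use k in \<open>auto simp: M_def row_def\<close>)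
    then show ?thesis using u[of b] by (simp add: \<phi>_def)
  qed
  moreover have "u \<in> integer_vectors"
  proof -
    have "M (axis j 1) $ i $ k \<in> \<int>" for i j k
    proof (cases "i = i0")
      case True then show ?thesis by (simp add: M_def axis_def)
    next
      case False
      then have "\<beta> i \<in> B" using \<beta> by (auto simp: bij_betw_def)
      then show ?thesis using False B(3) by (auto simp: M_def integer_vectors_def)
    qed
    then show ?thesis
      unfolding integer_vectors_def u_def \<phi>_def det_def
      by (auto intro!: Ints_sum Ints_mult Ints_prod)
  qed
  ultimately show ?thesis using that by blast
qed

text \<open>The divisor \<open>g\<close> is the least positive value of \<open>u\<close> on integral
  vectors, that is, the gcd of the coordinates. Primitivity is recorded by a Bezout witness
  \<open>z\<close> instead of a gcd, because the witness itself is used later: as the step to the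
  next parallel lattice layer, as a parity certificate, and to compare parallel normals.\<close>

lemma primitive_multiple:
  fixes u :: "real ^ 'd"
  assumes u: "u \<in> integer_vectors" "u \<noteq> 0"
  obtains g :: real and z where "g > 0" "u /\<^sub>R g \<in> integer_vectors" "z \<in> integer_vectors" "(u /\<^sub>R g) \<bullet> z = 1"
proof -
  define G where "G = {n::nat. n > 0 \<and> (\<exists>z\<in>integer_vectors. u \<bullet> z = real n)}"
  obtain j where j: "u $ j \<noteq> 0" using u(2) by (auto simp: vec_eq_iff)
  then obtain k :: int where k: "u $ j = of_int k" using u(1) by (auto simp: integer_vectors_def Ints_def)
  have "u \<bullet> (of_int (sgn k) *\<^sub>R axis j 1) = of_int (k * sgn k)"
    using k by (simp add: inner_axis)
  also have "k * sgn k = \<bar>k\<bar>" by (simp add: abs_sgn)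
  also have "real_of_int \<bar>k\<bar> = real (nat \<bar>k\<bar>)" by simp
  finally have "u \<bullet> (of_int (sgn k) *\<^sub>R axis j 1) = real (nat \<bar>k\<bar>)" .
  moreover have "nat \<bar>k\<bar> > 0" using j k by auto
  ultimately have "nat \<bar>k\<bar> \<in> G" unfolding G_def mem_Collect_eq
    by (intro conjI bexI[of _ "of_int (sgn k) *\<^sub>R axis j 1"] integer_vectors_closed) auto
  define g where "g = (LEAST n. n \<in> G)"
  have gG: "g \<in> G" unfolding g_def by (rule LeastI[of "\<lambda>n. n \<in> G", OF \<open>nat \<bar>k\<bar> \<in> G\<close>])
  then obtain z where g: "g > 0" and z: "z \<in> integer_vectors" "u \<bullet> z = real g" by (auto simp: G_def)
  have "u $ i / real g \<in> \<int>" for i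
  proof -
    obtain c :: int where c: "u $ i = of_int c" using u(1) by (auto simp: integer_vectors_def Ints_def)
    \<comment> \<open>Euclidean division: \<open>u \<bullet> y\<close> is the remainder of
      coordinate \<open>i\<close> modulo \<open>g\<close>, so it vanishes by minimality of
      \<open>g\<close>.\<close>
    define y where "y = axis i 1 - of_int (c div int g) *\<^sub>R z"
    have y: "y \<in> integer_vectors" unfolding y_def
      by (intro integer_vectors_closed z) auto
    have "u \<bullet> y = of_int c - of_int (c div int g) * real g"
      by (simp add: y_def inner_diff_right inner_axis c z)
    also have "\<dots> = of_int (c - c div int g * int g)" by simp
    also have "c - c div int g * int g = c mod int g" by (simp add: minus_div_mult_eq_mod)
    also have "real_of_int (c mod int g) = real (nat (c mod int g))" using g by simp
    finally have uy: "u \<bullet> y = real (nat (c mod int g))" .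
    have "nat (c mod int g) < g" using g by (simp add: nat_less_iff)
    then have "nat (c mod int g) \<notin> G" using not_less_Least g_def by blast
    then have "c mod int g = 0"
      using uy y g unfolding G_def by (metis (mono_tags, lifting) mem_Collect_eq gr0I nat_0_iff order_antisym
        Euclidean_Rings.pos_mod_sign of_nat_0_less_iff)
    then have "c = (c div int g) * int g" by (metis add.right_neutral mult.commute mult_div_mod_eq)
    then have "u $ i / real g = of_int (c div int g)"
    proof -
      have "u $ i = of_int (c div int g) * real g"
        using c \<open>c = (c div int g) * int g\<close> by (metis of_int_mult of_int_of_nat_eq)
      then show ?thesis using g by simp
    qed
    then show ?thesis by simp
  qed
  then have "u /\<^sub>R real g \<in> integer_vectors" by (simp add: integer_vectors_def divide_inverse mult.commute)
  moreover have "(u /\<^sub>R real g) \<bullet> z = 1" using z g by simp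
  ultimately show ?thesis using that[of "real g" z] g z by simp
qed

lemma primitive_normal:
  fixes V :: "(real ^ 'd) set"
  assumes V: "V \<subseteq> integer_vectors" "\<not> affine_dependent V" "card V = CARD('d)"
  obtains u z c where "u \<in> integer_vectors" "z \<in> integer_vectors" "u \<bullet> z = 1" "\<And>v. v \<in> V \<Longrightarrow> u \<bullet> v = c"
proof -
  have "V \<noteq> {}" using V(3) by (metis card.empty zero_less_card_finite less_irrefl)
  then obtain a where a: "a \<in> V" by blast
  have finV: "finite V" using V(2) aff_independent_finite by blast
  let ?B = "(\<lambda>x. - a + x) ` (V - {a})"
  have "card ?B = CARD('d) - 1"
    using finV a V(3) by (subst card_image) (auto simp: inj_on_def)
  moreover have "independent ?B" using affine_dependent_iff_dependent2[OF a] V(2) by blast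
  moreover have "?B \<subseteq> integer_vectors"
    using V(1) a by (auto intro!: integer_vectors_closed)
  ultimately obtain u0 where u0: "u0 \<in> integer_vectors" "u0 \<noteq> 0" "\<And>b. b \<in> ?B \<Longrightarrow> u0 \<bullet> b = 0"
    using integer_normal_of_independent by blast
  obtain g z where g: "g > 0" "u0 /\<^sub>R g \<in> integer_vectors" "z \<in> integer_vectors" "(u0 /\<^sub>R g) \<bullet> z = 1"
    using primitive_multiple[OF u0(1,2)] by blast
  have "(u0 /\<^sub>R g) \<bullet> v = (u0 /\<^sub>R g) \<bullet> a" if "v \<in> V" for v
  proof (cases "v = a")
    case False
    then have "u0 \<bullet> (- a + v) = 0" using that by (intro u0(3)) auto
    then show ?thesis by (simp add: inner_diff_right)
  qed simp
  with g that show ?thesis by blast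
qed

section \<open>Counting lattice points by volume\<close>

lemma card_grid: "card (grid n :: (real ^ 'd) set) = n ^ CARD('d)"
proof -
  have "grid n = vec_lambda ` (PiE UNIV (\<lambda>_::'d. real ` {1..n}))"
  proof (rule set_eqI)
    fix x :: "real ^ 'd"
    show "x \<in> grid n \<longleftrightarrow> x \<in> vec_lambda ` (PiE UNIV (\<lambda>_::'d. real ` {1..n}))"
    proof
      assume "x \<in> grid n"
      then have "vec_nth x \<in> PiE UNIV (\<lambda>_. real ` {1..n})" by (auto simp: grid_def)
      then have "vec_lambda (vec_nth x) \<in> vec_lambda ` (PiE UNIV (\<lambda>_::'d. real ` {1..n}))" by (rule imageI)
      then show "x \<in> vec_lambda ` (PiE UNIV (\<lambda>_::'d. real ` {1..n}))" by simp
    next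
      assume "x \<in> vec_lambda ` (PiE UNIV (\<lambda>_::'d. real ` {1..n}))"
      then obtain f where f: "f \<in> PiE UNIV (\<lambda>_::'d. real ` {1..n})" "x = vec_lambda f" by blast
      then show "x \<in> grid n" using PiE_mem[OF f(1)] by (auto simp: grid_def)
    qed
  qed
  moreover have "inj_on vec_lambda (PiE UNIV (\<lambda>_::'d. real ` {1..n}))"
    by (auto simp: inj_on_def vec_lambda_inject)
  ultimately show ?thesis by (simp add: card_image card_PiE inj_on_def)
qed

text \<open>Compare the volume of the unit cubes at the points r + f z with z in a large box.\<close>

lemma card_incongruent_le_measure:
  fixes f :: "real ^ 'd \<Rightarrow> real ^ 'd"
  assumes f: "linear f" "inj f" "f ` integer_vectors \<subseteq> integer_vectors"
    and R: "finite R" "R \<subseteq> integer_vectors"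
    and incong: "\<And>r r'. r \<in> R \<Longrightarrow> r' \<in> R \<Longrightarrow> r - r' \<in> f ` integer_vectors \<Longrightarrow> r = r'"
  shows "real (card R) \<le> measure lebesgue (f ` cbox 0 1)"
proof -
  let ?\<mu> = "measure lebesgue (f ` cbox 0 1)"
  have blf: "bounded_linear f" using f(1) by (simp add: linear_conv_bounded_linear)
  obtain h where h: "linear h" "h \<circ> f = id" "f \<circ> h = id"
    using linear_injective_isomorphism[OF f(1,2)] by (metis comp_apply eq_id_iff)
  have hf: "h (f x) = x" "f (h x) = x" for x using h by (auto simp: fun_eq_iff)
  have "bounded (\<Union>r\<in>R. h ` ((+) r ` cbox 0 1))"
    using R(1) h(1) by (intro bounded_UN ballI bounded_linear_image bounded_translation)
      (auto simp: linear_conv_bounded_linear)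
  then obtain c0 where c0: "\<And>x. x \<in> (\<Union>r\<in>R. h ` ((+) r ` cbox 0 1)) \<Longrightarrow> norm x \<le> c0"
    by (auto simp: bounded_iff)
  \<comment> \<open>In the coordinates given by \<open>f\<close>, the cubes at the points of
    \<open>R\<close> stay within \<open>c\<close> of the origin, so their translates by
    \<open>f z\<close> stay within \<open>c\<close> of the box that contains the
    \<open>z\<close>.\<close>
  define c where "c = max c0 0"
  have c: "c \<ge> 0" and hc: "\<bar>h (r + p) $ i\<bar> \<le> c" if "r \<in> R" "p \<in> cbox 0 1" for r p i
    using c0[of "h (r + p)"] that component_le_norm_cart[of "h (r + p)" i] by (force simp: c_def)+
  have c: "c \<ge> 0" by (simp add: c_def)
  have main: "real (card R) * real B ^ CARD('d) \<le> (real B + 2 * c) ^ CARD('d) * ?\<mu>" for B :: nat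
  proof -
    let ?I = "R \<times> (grid B :: (real ^ 'd) set)"
    define P where "P rz = fst rz + f (snd rz)" for rz
    let ?Q = "\<lambda>rz. cbox (P rz) (P rz + 1)"
    let ?K = "f ` cbox (- (c *\<^sub>R 1)) ((real B + c) *\<^sub>R 1)"
    have inZ: "P rz \<in> integer_vectors" if "rz \<in> ?I" for rz
      using that R(2) f(3) grid_subset_integer_vectors unfolding P_def
      by (force intro!: integer_vectors_closed)
    have inj: "rz = rz'" if "rz \<in> ?I" "rz' \<in> ?I" "P rz = P rz'" for rz rz'
    proof -
      obtain r z r' z' where [simp]: "rz = (r, z)" "rz' = (r', z')" by (metis surj_pair)
      have "r - r' = f (z' - z)" using that f(1) by (simp add: P_def linear_diff algebra_simps)
      moreover have "z' - z \<in> integer_vectors"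
        using that grid_subset_integer_vectors by (auto intro!: integer_vectors_closed)
      ultimately have "r = r'" using that by (intro incong) auto
      moreover have "z = z'" using that \<open>r = r'\<close> f(2) by (auto simp: P_def dest: injD)
      ultimately show ?thesis by simp
    qed
    have "real (card ?I) = (\<Sum>rz\<in>?I. measure lebesgue (?Q rz))"
    proof -
      have "measure lebesgue (?Q rz) = 1" for rz
        by (simp add: measure_completion content_cbox_cart interval_ne_empty_cart)
      then show ?thesis by simp
    qed
    also have "\<dots> = measure lebesgue (\<Union> (?Q ` ?I))"
    proof (rule measure_negligible_finite_Union_image[symmetric])
      show "finite ?I" using R(1) finite_grid by blast
      show "pairwise (\<lambda>x y. negligible (?Q x \<inter> ?Q y)) ?I"
      proof (rule pairwiseI)
        fix x y assume xy: "x \<in> ?I" "y \<in> ?I" "x \<noteq> y"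
        then obtain i where i: "P x $ i \<noteq> P y $ i" using inj by (metis vec_eq_iff)
        obtain k l :: int where kl: "P x $ i = of_int k" "P y $ i = of_int l"
          using inZ xy by (metis (no_types, lifting) Ints_cases integer_vectors_def mem_Collect_eq)
        have "?Q x \<inter> ?Q y \<subseteq> {v. v $ i = of_int (max k l)}"
        proof
          fix v assume "v \<in> ?Q x \<inter> ?Q y"
          then have v: "of_int k \<le> v $ i" "v $ i \<le> of_int k + 1" "of_int l \<le> v $ i" "v $ i \<le> of_int l + 1"
            unfolding kl[symmetric] by (auto simp: mem_box_cart)
          have "k \<noteq> l" using i kl by auto
          then consider "k + 1 \<le> l" | "l + 1 \<le> k" by linarith
          then show "v \<in> {v. v $ i = of_int (max k l)}"
          proof cases
            case 1
            then have "real_of_int k + 1 \<le> of_int l" by linarith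
            with v 1 show ?thesis by (simp add: max_def)
          next
            case 2
            then have "real_of_int l + 1 \<le> of_int k" by linarith
            with v 2 show ?thesis by (simp add: max_def)
          qed
        qed
        moreover have "negligible {v :: real ^ 'd. v $ i = real_of_int (max k l)}"
          using negligible_hyperplane[of "axis i 1 :: real ^ 'd" "real_of_int (max k l)"]
          by (simp add: inner_axis' axis_eq_0_iff)
        ultimately show "negligible (?Q x \<inter> ?Q y)" by (rule negligible_subset[rotated])
      qed
    qed auto
    also have "\<dots> \<le> measure lebesgue ?K"
    proof (rule measure_mono_fmeasurable)
      show "\<Union> (?Q ` ?I) \<subseteq> ?K"
      proof clarify
        fix r z v assume r: "r \<in> R" and z: "z \<in> grid B" and "v \<in> cbox (P (r, z)) (P (r, z) + 1)"
        then have v: "v \<in> cbox (r + f z) (r + f z + 1)" by (simp add: P_def)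
        define p where "p = v - (r + f z)"
        have p: "p \<in> cbox 0 1" using v by (auto simp: p_def mem_box_cart algebra_simps)
        have hv: "h v = h (r + p) + z"
        proof -
          have "v = (r + p) + f z" by (simp add: p_def)
          then show ?thesis using hf(1)[of z] linear_add[OF h(1), of "r + p" "f z"] by simp
        qed
        have "- c \<le> h v $ i \<and> h v $ i \<le> real B + c" for i
        proof -
          have "0 \<le> z $ i" "z $ i \<le> real B"
            using z by (auto simp: grid_def dest!: spec[of _ i])
          with hc[OF r p, of i] show ?thesis by (simp add: hv abs_le_iff)
        qed
        then have "h v \<in> cbox (- (c *\<^sub>R 1)) ((real B + c) *\<^sub>R 1)"
          by (simp add: mem_box_cart)
        then show "v \<in> ?K" by (metis hf(2) imageI)
      qed
      show "\<Union> (?Q ` ?I) \<in> sets lebesgue"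
      proof (rule sets.finite_UN)
        show "finite ?I" using R(1) finite_grid by blast
      qed simp
      have "compact ?K" by (intro compact_continuous_image linear_continuous_on blf compact_cbox)
      then show "?K \<in> lmeasurable" by (rule lmeasurable_compact)
    qed
    also have "?K = (\<lambda>x. (real B + 2 * c) *\<^sub>R x + f (- (c *\<^sub>R 1))) ` (f ` cbox 0 1)"
    proof -
      have "cbox (- (c *\<^sub>R 1)) ((real B + c) *\<^sub>R 1) = (\<lambda>x. (real B + 2 * c) *\<^sub>R x + - (c *\<^sub>R 1)) ` cbox 0 (1::real^'d)"
      proof -
        have "cbox 0 (1::real^'d) \<noteq> {}" by (simp add: interval_ne_empty_cart)
        moreover have "(real B + 2 * c) *\<^sub>R 1 + - (c *\<^sub>R 1) = (real B + c) *\<^sub>R (1::real^'d)"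
          by (simp add: vec_eq_iff)
        ultimately show ?thesis
          using c by (subst image_affinity_cbox) (simp del: add_uminus_conv_diff)
      qed
      then show ?thesis
        using f(1) by (simp only: image_image) (simp add: linear_add linear_cmul linear_diff linear_neg)
    qed
    also have "measure lebesgue \<dots> = (real B + 2 * c) ^ CARD('d) * ?\<mu>"
      using c by (subst measure_lebesgue_affine) simp
    finally show ?thesis by (simp add: card_cartesian_product card_grid)
  qed
  \<comment> \<open>Relative to the number of translates the boundary layer of width
    \<open>c\<close> disappears as the box grows.\<close>
  have "real (card R) \<le> (1 + 2 * c * inverse (real (Suc B))) ^ CARD('d) * ?\<mu>" for B
  proof -
    have "real (card R) * real (Suc B) ^ CARD('d) \<le> (1 + 2 * c * inverse (real (Suc B))) ^ CARD('d) * ?\<mu> * real (Suc B) ^ CARD('d)"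
    proof -
      have "real (Suc B) + 2 * c = (1 + 2 * c * inverse (real (Suc B))) * real (Suc B)"
        by (simp add: field_simps)
      then have "(real (Suc B) + 2 * c) ^ CARD('d) = (1 + 2 * c * inverse (real (Suc B))) ^ CARD('d) * real (Suc B) ^ CARD('d)"
        by (simp only: power_mult_distrib)
      then show ?thesis using main[of "Suc B"] by (simp only: mult_ac)
    qed
    then show ?thesis by (rule mult_right_le_imp_le) simp
  qed
  moreover have "(\<lambda>B. (1 + 2 * c * inverse (real (Suc B))) ^ CARD('d) * ?\<mu>) \<longlonglongrightarrow> (1 + 2 * c * 0) ^ CARD('d) * ?\<mu>"
    by (intro tendsto_intros LIMSEQ_inverse_real_of_nat)
  ultimately have "real (card R) \<le> (1 + 2 * c * 0) ^ CARD('d) * ?\<mu>"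
    by (intro LIMSEQ_le_const) auto
  then show ?thesis by simp
qed

subsection \<open>The perturbation\<close>

text \<open>This form of convex position passes to subsets of \<open>C\<close>. It speaks of
  preimages because collinearity and divisibility are read off before the perturbation, while the
  normals belong to the perturbed points.\<close>

definition strictly_exposed :: "('b \<Rightarrow> 'a::real_inner) \<Rightarrow> 'b set \<Rightarrow> bool" where
  "strictly_exposed \<tau> C \<longleftrightarrow>
     (\<forall>x\<in>C. \<exists>\<nu>. norm \<nu> = 1 \<and> (\<forall>y\<in>C. y \<noteq> x \<longrightarrow> \<nu> \<bullet> \<tau> y < \<nu> \<bullet> \<tau> x))"

text \<open>The length m of a collinear set is measured by the largest integer dividing a difference of
  two of its points; g = 0 satisfies the premise by x / 0 = 0, and the conclusion trivially.\<close>

definition line_sparse :: "real \<Rightarrow> (real ^ 'd) set \<Rightarrow> bool" where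
  "line_sparse K C \<longleftrightarrow> (\<forall>X m. X \<subseteq> C \<longrightarrow> collinear X \<longrightarrow> 1 \<le> m \<longrightarrow>
     (\<forall>x\<in>X. \<forall>y\<in>X. \<forall>g::nat. x \<noteq> y \<longrightarrow> (x - y) /\<^sub>R real g \<in> integer_vectors \<longrightarrow> g \<le> m) \<longrightarrow>
     real (card X) \<le> K * real m powr (1 / (2 * real CARD('d) - 1)))"

section \<open>Digits of grid coordinates\<close>

lemma grid_coord:
  assumes "x \<in> grid n"
  shows "x $ i = real (nat \<lfloor>x $ i\<rfloor>)" "1 \<le> nat \<lfloor>x $ i\<rfloor>" "nat \<lfloor>x $ i\<rfloor> \<le> n"
  using assms by (auto simp: grid_def dest: spec[of _ i])

lemma mod_power_eqI:
  fixes x y b :: nat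
  assumes "\<And>j. j < r \<Longrightarrow> x div b ^ j mod b = y div b ^ j mod b"
  shows "x mod b ^ r = y mod b ^ r"
  using assms
proof (induction r)
  case (Suc r)
  then have "x mod b ^ r = y mod b ^ r" "x div b ^ r mod b = y div b ^ r mod b" by auto
  then show ?case by (simp add: mod_mult2_eq power_Suc2 del: power_Suc)
qed simp

text \<open>Digits are read from the least significant end, so agreement in \<open>q\<close> of them
  makes the difference of two points divisible by \<open>b ^ q\<close>, which exceeds the largest
  admissible divisor \<open>m\<close>. If \<open>n \<le> q\<close>, the \<open>n\<close> available
  digits already determine every coordinate, since \<open>n < b ^ n\<close>.\<close>

lemma grid_eqI_digits:
  fixes x y :: "real ^ 'd"
  assumes xy: "x \<in> grid n" "y \<in> grid n" and b: "b \<ge> 2"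
    and dig: "\<And>i j. j < min n q \<Longrightarrow> nat \<lfloor>x $ i\<rfloor> div b ^ j mod b = nat \<lfloor>y $ i\<rfloor> div b ^ j mod b"
    and m: "\<And>g::nat. x \<noteq> y \<Longrightarrow> (x - y) /\<^sub>R real g \<in> integer_vectors \<Longrightarrow> g \<le> m" "m < b ^ q"
  shows "x = y"
proof (rule ccontr)
  assume ne: "x \<noteq> y"
  have md: "nat \<lfloor>x $ i\<rfloor> mod b ^ min n q = nat \<lfloor>y $ i\<rfloor> mod b ^ min n q" for i
    by (rule mod_power_eqI) (rule dig)
  show False
  proof (cases "n \<le> q")
    case True
    have "n < b ^ n" by (rule order_less_le_trans[OF less_exp]) (use b in \<open>auto intro: power_mono\<close>)
    then have "nat \<lfloor>x $ i\<rfloor> = nat \<lfloor>y $ i\<rfloor>" for i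
      using md[of i] True grid_coord(3)[OF xy(1), of i] grid_coord(3)[OF xy(2), of i]
      by (metis min.absorb1 mod_less order_le_less_trans)
    then have "x $ i = y $ i" for i
      using grid_coord(1)[OF xy(1), of i] grid_coord(1)[OF xy(2), of i] by metis
    then show False using ne by (simp add: vec_eq_iff)
  next
    case False
    have "(x - y) /\<^sub>R real (b ^ q) \<in> integer_vectors"
      unfolding integer_vectors_def
    proof safe
      fix i
      have "int (b ^ q) dvd int (nat \<lfloor>x $ i\<rfloor>) - int (nat \<lfloor>y $ i\<rfloor>)"
        using md[of i] False by (metis min.absorb2 mod_eq_dvd_iff nat_le_linear zmod_int)
      then obtain c where c: "int (nat \<lfloor>x $ i\<rfloor>) - int (nat \<lfloor>y $ i\<rfloor>) = int (b ^ q) * c" by (auto elim: dvdE)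
      have "x $ i - y $ i = of_int (int (nat \<lfloor>x $ i\<rfloor>) - int (nat \<lfloor>y $ i\<rfloor>))"
        using grid_coord(1)[OF xy(1), of i] grid_coord(1)[OF xy(2), of i]
        by (metis of_int_diff of_int_of_nat_eq)
      also have "\<dots> = real (b ^ q) * of_int c" unfolding c by simp
      finally have "((x - y) /\<^sub>R real (b ^ q)) $ i = of_int c"
        using b by (simp add: field_simps)
      then show "((x - y) /\<^sub>R real (b ^ q)) $ i \<in> \<int>" by simp
    qed
    from m(1)[OF ne this] m(2) show False by simp
  qed
qed

text \<open>Some coordinate of \<open>y - x\<close> is a nonzero integer, and the same coordinate of
  \<open>z - x\<close> is at most \<open>n\<close> in absolute value. The bound is needed because
  the gain of \<open>z\<close> over \<open>y\<close> at a level enters only with the weight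
  \<open>a\<close>.\<close>

lemma grid_between_ratio:
  fixes x y z :: "real ^ 'd"
  assumes xyz: "x \<in> grid n" "y \<in> grid n" "z \<in> grid n" and "x \<noteq> y"
    and y: "y = (1 - a) *\<^sub>R x + a *\<^sub>R z" and a: "a > 0"
  shows "1 / (real n + 1) \<le> a"
proof -
  obtain i where i: "x $ i \<noteq> y $ i" using assms(4) by (auto simp: vec_eq_iff)
  define X Y Z where "X = nat \<lfloor>x $ i\<rfloor>" "Y = nat \<lfloor>y $ i\<rfloor>" "Z = nat \<lfloor>z $ i\<rfloor>"
  have c: "x $ i = X" "y $ i = Y" "z $ i = Z" "1 \<le> X" "X \<le> n" "1 \<le> Z" "Z \<le> n"
    unfolding X_Y_Z_def by (rule grid_coord[OF xyz(1)] grid_coord[OF xyz(2)] grid_coord[OF xyz(3)])+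
  have "y $ i - x $ i = a * (z $ i - x $ i)"
    by (subst y) (simp add: algebra_simps)
  then have "\<bar>real Y - real X\<bar> = a * \<bar>real Z - real X\<bar>"
    using a by (simp add: c abs_mult)
  moreover have "1 \<le> \<bar>real Y - real X\<bar>" using i c(1,2) by (cases X Y rule: linorder_cases) auto
  moreover have "\<bar>real Z - real X\<bar> \<le> real n + 1" using c by linarith
  ultimately have "1 \<le> a * (real n + 1)"
    using a by (metis mult_left_mono order_less_imp_le order_trans)
  then show ?thesis by (simp add: divide_le_eq mult.commute)
qed

text \<open>The constant is built from the number \<open>D\<close> of digit vectors, which depends
  on the dimension only. The directions \<open>w\<close> and the scales \<open>\<rho>\<close> and
  \<open>\<delta>\<close> may depend on \<open>n\<close>, since they do not enter the
  counts.\<close>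

theorem sparse_perturbation_exists:
  "\<exists>K>0. \<forall>n \<epsilon>. \<epsilon> > 0 \<longrightarrow> (\<exists>\<tau> :: real ^ 'd \<Rightarrow> real ^ 'd.
     inj_on \<tau> (grid n) \<and> (\<forall>x\<in>grid n. norm (\<tau> x - x) \<le> \<epsilon>) \<and> general_position (\<tau> ` grid n) \<and>
     (\<forall>C\<subseteq>grid n. strictly_exposed \<tau> C \<longrightarrow> line_sparse K C))"
proof -
  define d where "d = CARD('d)"
  have d: "d \<ge> 1" by (simp add: d_def Suc_le_eq)
  \<comment> \<open>Each digit will cost a factor 3 for the signs and a factor 2 that generously
    covers the linear term of the chain bound. About log m / log b digits are needed, and this base
    turns \<open>6 ^ q\<close> into a multiple of m powr (1/(2d - 1)).\<close>
  define b :: nat where "b = 6 ^ (2 * d - 1)"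
  have b: "b \<ge> 2"
  proof -
    have "(6::nat) ^ 1 \<le> b" unfolding b_def using d by (intro power_increasing) auto
    then show ?thesis by simp
  qed
  define Dg where "Dg = {f :: 'd \<Rightarrow> nat. \<forall>i. f i < b}"
  have "Dg = PiE UNIV (\<lambda>_. {..<b})" by (auto simp: Dg_def)
  then have "finite Dg" by (simp add: finite_PiE)
  then obtain enc where enc: "bij_betw enc Dg {0..<card Dg}"
    using ex_bij_betw_finite_nat by blast
  define D where "D = card Dg"
  \<comment> \<open>The numbering of the digit vectors is arbitrary: only that different vectors get
    different integers matters, so that the multiples of \<open>w k\<close> differ by at least one
    \<open>w k\<close>.\<close>
  define s where "s k x = enc (\<lambda>i. nat \<lfloor>x $ i\<rfloor> div b ^ k mod b)" for k and x :: "real ^ 'd"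
  have inDg: "(\<lambda>i. nat \<lfloor>x $ i\<rfloor> div b ^ k mod b) \<in> Dg" for k and x :: "real ^ 'd"
    using b by (simp add: Dg_def)
  have sD: "s k x < D" for k x
    using enc inDg[where k = k and x = x] unfolding s_def D_def bij_betw_def by auto
  have D: "D \<ge> 1" using sD[of 0 undefined] by simp
  have s_eq: "nat \<lfloor>x $ i\<rfloor> div b ^ k mod b = nat \<lfloor>y $ i\<rfloor> div b ^ k mod b" if "s k x = s k y" for k x y i
    using enc that inDg[where k = k and x = x] inDg[where k = k and x = y]
    unfolding s_def bij_betw_def inj_on_def by (metis (no_types, lifting))
  \<comment> \<open>One factor \<open>D\<close> and the 2 come from
    \<open>1 + 2 * D * r \<le> 2 * D * (1 + q)\<close>, the other \<open>D ^ (d - 1)\<close> from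
    the levels without information, and the remaining 6 from
    \<open>6 ^ q = 6 * 6 ^ (q - 1)\<close>.\<close>
  define K where "K = 12 * real D ^ d"
  have "\<exists>\<tau> :: real ^ 'd \<Rightarrow> real ^ 'd.
     inj_on \<tau> (grid n) \<and> (\<forall>x\<in>grid n. norm (\<tau> x - x) \<le> \<epsilon>) \<and> general_position (\<tau> ` grid n) \<and>
     (\<forall>C\<subseteq>grid n. strictly_exposed \<tau> C \<longrightarrow> line_sparse K C)" if \<epsilon>: "\<epsilon> > 0" for n and \<epsilon> :: real
  proof -
    obtain w :: "nat \<Rightarrow> real ^ 'd" and \<kappa> where \<kappa>: "\<kappa> > 0"
      and w: "\<And>\<nu>. norm \<nu> = 1 \<Longrightarrow> card {k\<in>{..<n}. \<bar>\<nu> \<bullet> w k\<bar> < \<kappa>} < CARD('d)"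
      using generic_directions[of n] by blast
    define W where "W = (\<Sum>j<n. norm (w j))"
    have W: "W \<ge> 0" "norm (w j) \<le> W" if "j < n" for j
      using that unfolding W_def by (auto intro!: sum_nonneg member_le_sum)
    have W0: "W \<ge> 0" unfolding W_def by (auto intro!: sum_nonneg)
    define E where "E = real n * real D * W + 1"
    have E: "E \<ge> 1" using W0 by (simp add: E_def)
    \<comment> \<open>The factor \<open>n + 1\<close> answers the smallest possible weight
      \<open>a\<close> of an end point, and the 4 leaves room for a strict inequality.\<close>
    define \<rho> where "\<rho> = min 1 (\<kappa> / (4 * (real n + 1) * E))"
    have \<rho>: "\<rho> > 0" "\<rho> \<le> 1" using \<kappa> E by (auto simp: \<rho>_def)
    have \<rho>E: "2 * \<rho> * E < a * \<kappa>" if "1 / (real n + 1) \<le> a" for a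
    proof -
      have "2 * \<rho> * E \<le> 2 * (\<kappa> / (4 * (real n + 1) * E)) * E"
        using E by (intro mult_right_mono) (auto simp: \<rho>_def)
      also have "\<dots> = (1 / (real n + 1)) * \<kappa> / 2"
      proof -
        have *: "2 * (\<kappa> / (4 * N * E)) * E = (1 / N) * \<kappa> / 2" if "N > 0" for N
          using that E by (simp add: field_simps)
        show ?thesis by (rule *) simp
      qed
      also have "\<dots> < (1 / (real n + 1)) * \<kappa>"
      proof -
        have *: "x / 2 < x" if "x > 0" for x :: real using that by simp
        show ?thesis by (rule *) (use \<kappa> in simp)
      qed
      also have "\<dots> \<le> a * \<kappa>" using that \<kappa> by (intro mult_right_mono) auto
      finally show ?thesis .
    qed
    define \<delta> where "\<delta> = \<epsilon> / E"
    have \<delta>: "\<delta> > 0" using \<epsilon> E by (simp add: \<delta>_def)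
    define base where "base x = x + (\<Sum>j<n. (\<delta> * \<rho> ^ j * s j x) *\<^sub>R w j)" for x
    \<comment> \<open>The correction into general position has the size of a further level
      \<open>n\<close>, so the tail estimates of the earlier levels absorb it.\<close>
    obtain \<tau> where \<tau>: "inj_on \<tau> (grid n)" "\<And>x. x \<in> grid n \<Longrightarrow> norm (\<tau> x - base x) < \<delta> * \<rho> ^ n"
      and gp: "\<And>S. S \<subseteq> \<tau> ` grid n \<Longrightarrow> card S \<le> DIM(real ^ 'd) + 1 \<Longrightarrow> \<not> affine_dependent S"
      using general_position_perturbation[OF finite_grid[of n], of "\<delta> * \<rho> ^ n" base] \<delta> \<rho> by auto
    have close: "norm (\<tau> x - x) \<le> \<epsilon>" if x: "x \<in> grid n" for x
    proof -
      have "norm (base x - x) \<le> (\<Sum>j<n. norm ((\<delta> * \<rho> ^ j * s j x) *\<^sub>R w j))"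
        unfolding base_def by (simp only: add_diff_cancel_left') (rule norm_sum)
      also have "\<dots> \<le> (\<Sum>j<n. \<delta> * D * W)"
      proof (rule sum_mono)
        fix j assume j: "j \<in> {..<n}"
        have "\<delta> * \<rho> ^ j * s j x \<le> \<delta> * 1 * D"
          using \<delta> \<rho> sD[of j x] by (intro mult_mono power_le_one) auto
        then have "(\<delta> * \<rho> ^ j * s j x) * norm (w j) \<le> (\<delta> * 1 * D) * W"
          by (rule mult_mono) (use W j \<delta> in auto)
        then show "norm ((\<delta> * \<rho> ^ j * s j x) *\<^sub>R w j) \<le> \<delta> * D * W"
          using \<delta> \<rho> by (simp add: abs_mult)
      qed
      finally have "norm (base x - x) \<le> n * (\<delta> * D * W)" by simp
      moreover have "norm (\<tau> x - base x) \<le> \<delta>"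
      proof -
        have "\<delta> * \<rho> ^ n \<le> \<delta> * 1" using \<delta> \<rho> by (intro mult_left_mono power_le_one) auto
        then show ?thesis using \<tau>(2)[OF x] by simp
      qed
      moreover have "norm (\<tau> x - x) \<le> norm (\<tau> x - base x) + norm (base x - x)"
        by (metis diff_add_cancel add_diff_eq norm_triangle_ineq)
      moreover have "\<delta> + n * (\<delta> * D * W) = \<epsilon>"
      proof -
        have "\<delta> + n * (\<delta> * D * W) = \<delta> * E" by (simp add: E_def algebra_simps)
        then show ?thesis using E by (simp add: \<delta>_def)
      qed
      ultimately show ?thesis by linarith
    qed
    have "line_sparse K C" if C: "C \<subseteq> grid n" and ex: "strictly_exposed \<tau> C" for C
      unfolding line_sparse_def
    proof (intro allI impI)
      fix X m assume X: "X \<subseteq> C" "collinear X" and m: "1 \<le> m"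
        and gm: "\<forall>x\<in>X. \<forall>y\<in>X. \<forall>g::nat. x \<noteq> y \<longrightarrow> (x - y) /\<^sub>R real g \<in> integer_vectors \<longrightarrow> g \<le> m"
      have Xg: "X \<subseteq> grid n" using X(1) C by (rule order_trans)
      have finX: "finite X" by (rule finite_subset[OF Xg finite_grid])
      obtain \<nu> where \<nu>: "\<And>x. x \<in> C \<Longrightarrow> norm (\<nu> x) = 1"
        "\<And>x y. x \<in> C \<Longrightarrow> y \<in> C \<Longrightarrow> y \<noteq> x \<Longrightarrow> \<nu> x \<bullet> \<tau> y < \<nu> x \<bullet> \<tau> x"
        using ex unfolding strictly_exposed_def by metis
      obtain p u where "\<forall>x\<in>X. \<exists>c. x = p + c *\<^sub>R u"
        using X(2) unfolding collinear_alt by blast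
      then obtain t where t: "\<And>x. x \<in> X \<Longrightarrow> x = p + t x *\<^sub>R u" by metis
      have inj_t: "inj_on t X" by (metis inj_onI t)
      \<comment> \<open>This many digits separate the points of the line, and minimality gives
        \<open>b ^ (q - 1) \<le> m\<close>. Only \<open>n\<close> levels exist, whence
        \<open>r\<close> below is a minimum.\<close>
      define q where "q = (LEAST q. m < b ^ q)"
      have exq: "m < b ^ m" by (rule order_less_le_trans[OF less_exp]) (use b in \<open>auto intro: power_mono\<close>)
      have q: "m < b ^ q" unfolding q_def by (rule LeastI[of "\<lambda>q. m < b ^ q" m, OF exq])
      have "q \<noteq> 0" using q m by (cases q) auto
      then have q1: "b ^ (q - 1) \<le> m"
        using not_less_Least[of "q - 1" "\<lambda>q. m < b ^ q"] by (simp add: q_def)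
      define r where "r = min n q"
      \<comment> \<open>The normals vary from point to point; grouping the points by these signs
        gives one \<open>\<sigma>\<close> for a whole group. The sign 0 marks products too small to
        dominate the later levels.\<close>
      define sg :: "real ^ 'd \<Rightarrow> nat \<Rightarrow> int" where
        "sg x k = (if \<kappa> \<le> \<nu> x \<bullet> w k then 1 else if \<nu> x \<bullet> w k \<le> - \<kappa> then - 1 else 0)" for x k
      define Y where "Y \<sigma> = {x \<in> X. restrict (sg x) {..<r} = \<sigma>}" for \<sigma>
      let ?P = "PiE {..<r} (\<lambda>_. {-1, 0, 1::int})"
      have cardY: "card (Y \<sigma>) \<le> D ^ (d - 1) * (1 + 2 * D * r)" for \<sigma>
      proof (cases "Y \<sigma> = {}")
        case True then show ?thesis by simp
      next
        case False
        then obtain x0 where x0: "x0 \<in> Y \<sigma>" by blast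
        have \<sigma>: "\<sigma> k = sg x k" if "x \<in> Y \<sigma>" "k < r" for x k
          using that by (auto simp: Y_def)
        have "card (Y \<sigma>) \<le> D ^ card {k. k < r \<and> \<sigma> k = 0} * (1 + 2 * D * r)"
        proof (rule card_layered_chain_le[where s = s and t = t])
          show "finite (Y \<sigma>)" using finX by (simp add: Y_def)
          show "inj_on t (Y \<sigma>)" using inj_t by (rule inj_on_subset) (auto simp: Y_def)
          show "s k x < D" for k x by (rule sD)
        next
          fix x y assume xy: "x \<in> Y \<sigma>" "y \<in> Y \<sigma>" and agree: "\<And>j. j < r \<Longrightarrow> s j x = s j y"
          show "x = y"
          proof (rule grid_eqI_digits[where n = n and b = b and q = q and m = m])
            show "x \<in> grid n" "y \<in> grid n" using xy Xg by (auto simp: Y_def)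
            show "nat \<lfloor>x $ i\<rfloor> div b ^ j mod b = nat \<lfloor>y $ i\<rfloor> div b ^ j mod b" if "j < min n q" for i j
              by (rule s_eq, rule agree) (use that in \<open>simp add: r_def\<close>)
            show "g \<le> m" if "x \<noteq> y" "(x - y) /\<^sub>R real g \<in> integer_vectors" for g :: nat
              using gm xy that by (auto simp: Y_def)
          qed (use b q in auto)
        next
          fix k x y z
          assume k: "k < r" "\<sigma> k \<noteq> 0" and xyz: "x \<in> Y \<sigma>" "y \<in> Y \<sigma>" "z \<in> Y \<sigma>"
            and agree: "\<And>j. j < k \<Longrightarrow> s j x = s j y \<and> s j z = s j y" "s k x = s k y"
            and betw: "t x < t y \<and> t y < t z \<or> t z < t y \<and> t y < t x"
            and less: "\<sigma> k * int (s k y) < \<sigma> k * int (s k z)"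
          have xyzX: "x \<in> X" "y \<in> X" "z \<in> X" using xyz by (auto simp: Y_def)
          have ne: "x \<noteq> y" "z \<noteq> y" using betw by auto
          define a where "a = (t y - t x) / (t z - t x)"
          have a: "0 < a" "a \<le> 1" using betw by (auto simp: a_def divide_simps)
          have "a * (t z - t x) = t y - t x" using betw by (auto simp: a_def)
          then have ty: "t y = (1 - a) * t x + a * t z" by (simp add: algebra_simps)
          have y: "y = (1 - a) *\<^sub>R x + a *\<^sub>R z"
            using t[OF xyzX(1)] t[OF xyzX(2)] t[OF xyzX(3)] ty
            by (smt (verit, best) scaleR_add_left scaleR_add_right scaleR_collapse scaleR_scaleR add.assoc add.commute add.left_commute)
          have "1 / (real n + 1) \<le> a"
            by (rule grid_between_ratio[OF _ _ _ ne(1) y a(1)]) (use xyzX Xg in auto)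
          note \<rho>a = \<rho>E[OF this, unfolded E_def]
          have "sg y k \<noteq> 0" using \<sigma>[OF xyz(2) k(1)] k(2) by simp
          then consider "\<sigma> k = 1" "\<kappa> \<le> \<nu> y \<bullet> w k" | "\<sigma> k = -1" "\<nu> y \<bullet> w k \<le> - \<kappa>"
            unfolding \<sigma>[OF xyz(2) k(1)] by (auto simp: sg_def split: if_splits)
          then have sgn: "\<kappa> \<le> (real (s k z) - real (s k y)) * (\<nu> y \<bullet> w k)"
          proof cases
            case 1
            then have "1 * \<kappa> \<le> (real (s k z) - real (s k y)) * (\<nu> y \<bullet> w k)"
              using less \<kappa> by (intro mult_mono) auto
            then show ?thesis by simp
          next
            case 2
            then have "1 * \<kappa> \<le> (real (s k y) - real (s k z)) * (- (\<nu> y \<bullet> w k))"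
              using less \<kappa> by (intro mult_mono) auto
            then show ?thesis by (simp add: algebra_simps)
          qed
          show False
          proof (rule displaced_between_not_exposed[where r = n and s = s and w = w and D = D and x = x and y = y
                and z = z and k = k and \<nu> = "\<nu> y" and \<tau> = \<tau>, OF \<delta> \<rho> W0 W(2) sD _ \<rho>a a y _ agree _ _ _ sgn])
            show "norm (\<tau> u - (u + (\<Sum>j<n. (\<delta> * \<rho> ^ j * real (s j u)) *\<^sub>R w j))) \<le> \<delta> * \<rho> ^ n"
              if "u \<in> {x, y, z}" for u
              using \<tau>(2)[of u] that xyzX Xg unfolding base_def by fastforce
            show "k < n" using k by (simp add: r_def)
            show "norm (\<nu> y) = 1" "\<nu> y \<bullet> \<tau> x < \<nu> y \<bullet> \<tau> y" "\<nu> y \<bullet> \<tau> z < \<nu> y \<bullet> \<tau> y"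
              using \<nu> xyzX X(1) ne by auto
          qed
        qed
        also have "\<dots> \<le> D ^ (d - 1) * (1 + 2 * D * r)"
        proof (intro mult_right_mono power_increasing)
          \<comment> \<open>The group shares its signs, so genericity applied to the normal of the
            single point \<open>x0\<close> bounds the number of zeros.\<close>
          have "{k. k < r \<and> \<sigma> k = 0} \<subseteq> {k \<in> {..<n}. \<bar>\<nu> x0 \<bullet> w k\<bar> < \<kappa>}"
            using \<sigma>[OF x0] by (auto simp: r_def sg_def split: if_splits)
          then have "card {k. k < r \<and> \<sigma> k = 0} \<le> card {k \<in> {..<n}. \<bar>\<nu> x0 \<bullet> w k\<bar> < \<kappa>}"
            by (intro card_mono) auto
          also have "\<dots> < d" using w[OF \<nu>(1), of x0] x0 X(1) by (auto simp: Y_def d_def)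
          finally show "card {k. k < r \<and> \<sigma> k = 0} \<le> d - 1" by simp
        qed (use D in auto)
        finally show ?thesis .
      qed
      have "X = (\<Union>\<sigma>\<in>?P. Y \<sigma>)"
        by (auto simp: Y_def sg_def intro!: restrict_PiE_iff[THEN iffD2])
      then have "card X \<le> (\<Sum>\<sigma>\<in>?P. card (Y \<sigma>))"
        using card_UN_le[of ?P Y] by (simp add: finite_PiE)
      also have "\<dots> \<le> (\<Sum>\<sigma>\<in>?P. D ^ (d - 1) * (1 + 2 * D * r))"
        by (intro sum_mono cardY)
      also have "\<dots> = 3 ^ r * (D ^ (d - 1) * (1 + 2 * D * r))"
        by (simp add: card_PiE numeral_3_eq_3)
      also have "\<dots> \<le> 3 ^ q * (D ^ (d - 1) * (2 * D * 2 ^ q))"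
      proof (intro mult_mono power_increasing le_refl)
        show "r \<le> q" by (simp add: r_def)
        have "1 + 2 * D * r \<le> 2 * D * (1 + q)"
        proof -
          have "2 * D * r \<le> 2 * D * q" by (intro mult_le_mono2) (simp add: r_def)
          then have "1 + 2 * D * r \<le> 2 * D + 2 * D * q" using D by linarith
          then show ?thesis by (simp only: distrib_left mult_1_right)
        qed
        also have "\<dots> \<le> 2 * D * 2 ^ q"
          using less_exp[of q] by (intro mult_left_mono) (auto simp: Suc_le_eq)
        finally show "1 + 2 * D * r \<le> 2 * D * 2 ^ q" .
      qed (use D in auto)
      also have "\<dots> = 2 * D ^ d * 6 ^ q"
      proof -
        have "D ^ d = D ^ (d - 1) * D" using d by (metis Suc_diff_1 Suc_le_eq One_nat_def power_Suc2)
        moreover have "(6::nat) ^ q = 3 ^ q * 2 ^ q" by (simp flip: power_mult_distrib)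
        ultimately show ?thesis by simp
      qed
      finally have cX: "real (card X) \<le> 2 * real D ^ d * 6 ^ q"
        by (metis (mono_tags, lifting) of_nat_le_iff of_nat_mult of_nat_numeral of_nat_power)
      let ?\<beta> = "1 / (2 * real CARD('d) - 1)"
      have "(6::real) ^ (q - 1) = (real (b ^ (q - 1))) powr ?\<beta>"
      proof -
        have "real (b ^ (q - 1)) = (6 ^ (q - 1)) powr (2 * real d - 1)"
        proof -
          have "real (b ^ (q - 1)) = (6 ^ (q - 1)) ^ (2 * d - 1)"
            by (simp add: b_def power_mult[symmetric] mult.commute)
          also have "\<dots> = (6 ^ (q - 1)) powr real (2 * d - 1)"
            by (simp add: powr_realpow)
          finally show ?thesis using d by (simp add: of_nat_diff)
        qed
        moreover have "2 * real CARD('d) \<noteq> 1" using d unfolding d_def by linarith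
        ultimately show ?thesis by (simp add: powr_powr d_def)
      qed
      also have "\<dots> \<le> real m powr ?\<beta>"
      proof (rule powr_mono2)
        have "real CARD('d) \<ge> 1" using d unfolding d_def by linarith
        then have "0 \<le> 2 * real CARD('d) - 1" by linarith
        then show "0 \<le> ?\<beta>" by (rule divide_nonneg_nonneg[OF zero_le_one])
        show "real (b ^ (q - 1)) \<le> real m" using q1 by (rule of_nat_mono)
      qed simp
      finally have "(6::real) ^ (q - 1) \<le> real m powr ?\<beta>" .
      moreover have "(6::real) ^ q = 6 * 6 ^ (q - 1)"
        using \<open>q \<noteq> 0\<close> by (metis Suc_pred' neq0_conv power_Suc)
      ultimately have "2 * real D ^ d * 6 ^ q \<le> K * real m powr ?\<beta>"
        unfolding K_def by (simp add: mult_left_mono)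
      with cX show "real (card X) \<le> K * real m powr ?\<beta>" by linarith
    qed
    moreover have "general_position (\<tau> ` grid n)"
      by (rule general_positionI) (use gp in auto)
    ultimately show ?thesis using \<tau>(1) close by blast
  qed
  moreover have "K > 0" using D by (simp add: K_def)
  ultimately show ?thesis by blast
qed

subsection \<open>Area of a lattice polytope in a hyperplane\<close>

lemma sum_measure_le_of_multiplicity:
  fixes E :: "'b \<Rightarrow> 'a::euclidean_space set"
  assumes "finite L" "\<And>x. x \<in> L \<Longrightarrow> E x \<in> lmeasurable" "\<And>x. x \<in> L \<Longrightarrow> E x \<subseteq> K" "K \<in> lmeasurable"
    and mult: "\<And>y. real (card {x \<in> L. y \<in> E x}) \<le> q"
  shows "(\<Sum>x\<in>L. measure lebesgue (E x)) \<le> q * measure lebesgue K"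
proof -
  have int: "integrable lebesgue (indicat_real X)" if "X \<in> lmeasurable" for X :: "'a set"
    using that by (simp add: lmeasurable_iff_integrable)
  have "(\<Sum>x\<in>L. measure lebesgue (E x)) = (\<Sum>x\<in>L. integral\<^sup>L lebesgue (indicat_real (E x)))"
    using assms(2) by simp
  also have "\<dots> = integral\<^sup>L lebesgue (\<lambda>y. \<Sum>x\<in>L. indicat_real (E x) y)"
    by (rule Bochner_Integration.integral_sum[symmetric]) (intro int assms(2))
  also have "\<dots> \<le> integral\<^sup>L lebesgue (\<lambda>y. q * indicat_real K y)"
  proof (rule integral_mono)
    show "integrable lebesgue (\<lambda>y. \<Sum>x\<in>L. indicat_real (E x) y)"
      by (intro Bochner_Integration.integrable_sum int assms(2))
    show "integrable lebesgue (\<lambda>y. q * indicat_real K y)"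
      by (intro integrable_mult_right int assms(4))
    fix y
    have eq: "(\<Sum>x\<in>L. indicat_real (E x) y) = real (card {x \<in> L. y \<in> E x})"
      using assms(1) by (simp add: indicator_def Int_def flip: sum.inter_filter)
    show "(\<Sum>x\<in>L. indicat_real (E x) y) \<le> q * indicat_real K y"
    proof (cases "y \<in> K")
      case True then show ?thesis using mult[of y] eq by simp
    next
      case False
      then have "{x \<in> L. y \<in> E x} = {}" using assms(3) by auto
      then show ?thesis using False eq by simp
    qed
  qed
  also have "\<dots> = q * measure lebesgue K" using assms(4) by simp
  finally show ?thesis .
qed

text \<open>A prism encodes projected area as a volume: for \<open>F\<close> in a hyperplane its
  volume is the area of the projection of \<open>F\<close> along \<open>e\<close>, times the length
  of \<open>e\<close>. So no lower-dimensional measure is needed.\<close>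

definition prism :: "'a::real_vector set \<Rightarrow> 'a \<Rightarrow> 'a set" where
  "prism F e = {x + s *\<^sub>R e | x s. x \<in> F \<and> 0 \<le> s \<and> s \<le> 1}"

lemma compact_prism:
  fixes F :: "'a::real_normed_vector set"
  assumes "compact F"
  shows "compact (prism F e)"
proof -
  have "prism F e = (\<lambda>(x, s). x + s *\<^sub>R e) ` (F \<times> {0..1})"
    by (fastforce simp: prism_def)
  moreover have "compact \<dots>"
    by (intro compact_continuous_image compact_Times assms compact_Icc)
      (auto simp: case_prod_unfold intro!: continuous_intros)
  ultimately show ?thesis by simp
qed

lemma Ints_abs_less_1: "x \<in> \<int> \<Longrightarrow> \<bar>x::real\<bar> < 1 \<Longrightarrow> x = 0"
  using Ints_nonzero_abs_less1 by blast

text \<open>The number \<open>V\<close> counts the lattice layers parallel to the facet that are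
  crossed along \<open>e\<close>, and the multiples of \<open>z\<close> by 0, ...,
  \<open>V - 1\<close> reach one point in each of them.\<close>

locale lattice_facet =
  fixes S :: "(real ^ 'd) set" and u z e :: "real ^ 'd" and c :: real and V :: nat
  assumes finite_S: "finite S" and S_int: "S \<subseteq> integer_vectors" and S_plane: "\<And>x. x \<in> S \<Longrightarrow> u \<bullet> x = c"
    and aff_dim_S: "aff_dim S = int CARD('d) - 1"
    and u_int: "u \<in> integer_vectors" and z_int: "z \<in> integer_vectors" and uz: "u \<bullet> z = 1"
    and e_int: "e \<in> integer_vectors" and ue: "u \<bullet> e = real V" and V: "V \<ge> 1"
begin

text \<open>The affine basis contains \<open>a\<close> and \<open>b\<close>, so a long lattice
  segment becomes an edge of the parallelepiped and its lattice points count as incongruent points.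
  With coordinates at most \<open>1 / real CARD('d)\<close> the weights on the basis points other
  than \<open>a\<close> sum to at most 1, which leaves a nonnegative weight for
  \<open>a\<close>.\<close>

lemma lattice_frame:
  assumes ab: "a \<in> S" "b \<in> S" "a \<noteq> b"
  obtains f :: "real ^ 'd \<Rightarrow> real ^ 'd" and j1 where "linear f" "inj f" "f ` integer_vectors \<subseteq> integer_vectors"
    "f (axis j1 1) = b - a"
    "\<forall>q. (\<forall>i. 0 \<le> q $ i \<and> q $ i \<le> 1 / real CARD('d)) \<longrightarrow>
       (\<exists>p s. p \<in> convex hull S \<and> 0 \<le> s \<and> s \<le> 1 \<and> a + f q = p + s *\<^sub>R e)"
    "\<forall>q\<in>integer_vectors. \<exists>k\<in>\<int>. u \<bullet> f q = k * real V \<and> (k = 0 \<longrightarrow> (\<exists>i\<noteq>j1. q $ i = 0))"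
proof -
  obtain T where T: "\<not> affine_dependent T" "{a, b} \<subseteq> T" "T \<subseteq> S" "affine hull T = affine hull S"
    using extend_to_affine_basis[of "{a, b}" S] ab affine_independent_2[of a b] by blast
  have finT: "finite T" using T(1) aff_independent_finite by blast
  have cT: "card T = CARD('d)"
  proof -
    have "aff_dim T = aff_dim S" using T(4) by (metis aff_dim_affine_hull)
    then show ?thesis using T(1) aff_dim_S by (simp add: affine_independent_iff_card)
  qed
  have aT: "a \<in> T" and bT: "b \<in> T - {a}" using T(2) ab by auto
  obtain i0 :: 'd where True by simp
  have "card (UNIV - {i0}) = card (T - {a})" using cT aT finT by (simp add: card_Diff_singleton)
  then obtain \<gamma> where \<gamma>: "bij_betw \<gamma> (UNIV - {i0}) (T - {a})"
    using finite_same_card_bij[of "UNIV - {i0}" "T - {a}"] finT by auto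
  have \<gamma>T: "\<gamma> j \<in> T - {a}" if "j \<noteq> i0" for j using \<gamma> that by (auto simp: bij_betw_def)
  have "b \<in> \<gamma> ` (UNIV - {i0})" using \<gamma> bT by (simp add: bij_betw_def)
  then obtain j1 where j1: "j1 \<noteq> i0" "\<gamma> j1 = b" by blast
  define g where "g j = (if j = i0 then e else \<gamma> j - a)" for j
  define f where "f q = (\<Sum>j\<in>UNIV. q $ j *\<^sub>R g j)" for q
  have lin: "linear f"
    unfolding f_def by (rule linearI) (simp_all add: algebra_simps sum.distrib scaleR_sum_right)
  have fax: "f (axis j 1) = g j" for j
    unfolding f_def axis_def by (simp add: if_distrib[of "\<lambda>x. x *\<^sub>R _"] cong: if_cong)
  have aS: "a \<in> S" using ab by simp
  have ug: "u \<bullet> g j = (if j = i0 then real V else 0)" for j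
    using \<gamma>T[of j] T(3) S_plane[OF aS] S_plane[of "\<gamma> j"] ue by (auto simp: g_def inner_diff_right)
  let ?B = "(\<lambda>x. - a + x) ` (T - {a})"
  have indB: "independent ?B" using affine_dependent_iff_dependent2[OF aT] T(1) by blast
  have cB: "card ?B = CARD('d) - 1"
    using finT aT cT by (subst card_image) (auto simp: inj_on_def)
  have uB: "u \<bullet> v = 0" if "v \<in> ?B" for v
    using that T(3) S_plane[OF aS] S_plane by (auto simp: inner_diff_right)
  have "?B \<subseteq> {v. u \<bullet> v = 0}" using uB by blast
  then have "span ?B \<subseteq> {v. u \<bullet> v = 0}"
    by (rule span_minimal) (simp add: subspace_hyperplane)
  then have eB: "e \<notin> span ?B" using ue V by auto
  have "independent (insert e ?B)" by (rule independent_insertI[OF eB indB])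
  moreover have "card (insert e ?B) = CARD('d)"
  proof -
    have "e \<notin> ?B" by (rule contra_subsetD[OF span_superset eB])
    then have "card (insert e ?B) = Suc (card ?B)" using finT by (intro card_insert_disjoint) auto
    moreover have "CARD('d) > 0" by simp
    ultimately show ?thesis unfolding cB by linarith
  qed
  ultimately have "dim (insert e ?B) = DIM(real ^ 'd)"
    by (simp add: dim_eq_card_independent)
  then have "span (insert e ?B) = UNIV" by (simp only: dim_eq_full)
  moreover have "insert e ?B \<subseteq> range f"
  proof -
    have "e = f (axis i0 1)" by (simp add: fax g_def)
    moreover have "v \<in> range f" if v: "v \<in> ?B" for v
    proof -
      obtain t where t: "t \<in> T - {a}" "v = - a + t" using v by blast
      then have "t \<in> \<gamma> ` (UNIV - {i0})" using \<gamma> by (simp add: bij_betw_def)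
      then obtain j where "j \<noteq> i0" "\<gamma> j = t" by blast
      then have "f (axis j 1) = v" by (simp add: fax g_def t)
      then show ?thesis by (metis rangeI)
    qed
    ultimately show ?thesis by (metis insert_subset rangeI subsetI)
  qed
  ultimately have "surj f"
    using span_minimal[OF _ linear_subspace_image[OF lin subspace_UNIV]] by (metis top.extremum_uniqueI)
  then have inj: "inj f" using lin linear_surjective_imp_injective by blast
  have g_int: "g j \<in> integer_vectors" for j
    using e_int \<gamma>T[of j] T(3) S_int aS by (auto simp: g_def intro!: integer_vectors_closed)
  have f_int: "f ` integer_vectors \<subseteq> integer_vectors"
  proof clarify
    fix q :: "real ^ 'd" assume "q \<in> integer_vectors"
    then show "f q \<in> integer_vectors"
      using g_int unfolding f_def integer_vectors_def by (auto intro!: Ints_sum Ints_mult)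
  qed
  have hull: "\<exists>p s. p \<in> convex hull S \<and> 0 \<le> s \<and> s \<le> 1 \<and> a + f q = p + s *\<^sub>R e"
    if q: "\<And>i. 0 \<le> q $ i \<and> q $ i \<le> 1 / real CARD('d)" for q
  proof -
    define t where "t = (\<Sum>j\<in>UNIV - {i0}. q $ j)"
    define wt where "wt j = (if j = i0 then 1 - t else q $ j)" for j
    define y where "y j = (if j = i0 then a else \<gamma> j)" for j
    define p where "p = (\<Sum>j\<in>UNIV. wt j *\<^sub>R y j)"
    have "t \<le> (\<Sum>j\<in>UNIV - {i0}. 1 / real CARD('d))"
      unfolding t_def using q by (intro sum_mono) auto
    also have "\<dots> \<le> 1" by (simp add: field_simps)
    finally have t: "t \<le> 1" .
    have "p \<in> convex hull S"
      unfolding p_def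
    proof (rule convex_sum)
      show "(\<Sum>j\<in>UNIV. wt j) = 1"
        by (subst sum.remove[of _ i0]) (auto simp: wt_def t_def intro!: sum.cong)
      show "0 \<le> wt j" for j using q t by (simp add: wt_def)
      show "y j \<in> convex hull S" for j
        using \<gamma>T[of j] T(3) aS by (auto simp: y_def intro!: hull_inc)
    qed (auto simp: convex_convex_hull)
    moreover have "a + f q = p + (q $ i0) *\<^sub>R e"
    proof -
      have F: "f q = (q $ i0) *\<^sub>R e + (\<Sum>j\<in>UNIV - {i0}. q $ j *\<^sub>R (\<gamma> j - a))"
        unfolding f_def by (subst sum.remove[of _ i0]) (auto simp: g_def intro!: sum.cong)
      have P: "p = (1 - t) *\<^sub>R a + (\<Sum>j\<in>UNIV - {i0}. q $ j *\<^sub>R \<gamma> j)"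
        unfolding p_def by (subst sum.remove[of _ i0]) (auto simp: wt_def y_def intro!: sum.cong)
      have G: "(\<Sum>j\<in>UNIV - {i0}. q $ j *\<^sub>R (\<gamma> j - a)) = (\<Sum>j\<in>UNIV - {i0}. q $ j *\<^sub>R \<gamma> j) - t *\<^sub>R a"
        by (simp add: t_def scaleR_sum_left sum_subtractf scaleR_diff_right)
      show ?thesis unfolding F P G by (simp add: scaleR_diff_left)
    qed
    moreover have "q $ i0 \<le> 1"
    proof -
      have "1 / real CARD('d) \<le> 1" by simp
      then show ?thesis using q[of i0] by linarith
    qed
    ultimately show ?thesis using q[of i0] by blast
  qed
  have uf: "\<exists>k\<in>\<int>. u \<bullet> f q = k * real V \<and> (k = 0 \<longrightarrow> (\<exists>i\<noteq>j1. q $ i = 0))"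
    if "q \<in> integer_vectors" for q
  proof (intro bexI conjI)
    show "u \<bullet> f q = q $ i0 * real V"
      unfolding f_def inner_sum_right by (subst sum.remove[of _ i0]) (auto simp: ug)
    show "q $ i0 \<in> \<int>" using that by (simp add: integer_vectors_def)
    show "q $ i0 = 0 \<longrightarrow> (\<exists>i\<noteq>j1. q $ i = 0)" using j1(1) by metis
  qed
  have "f (axis j1 1) = b - a" using fax j1 by (simp add: g_def)
  show ?thesis
    by (rule that[of f j1, OF lin inj f_int \<open>f (axis j1 1) = b - a\<close>]) (use hull uf in blast)+
qed

text \<open>Scaled copies of a parallelepiped spanned by points of S and e, translated by the points of L,
  overlap only boundedly often: the points that contribute to an overlap, together with their shifts
  by multiples of w and z, are incongruent modulo the lattice of the parallelepiped.\<close>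

lemma card_lines_le_prism:
  assumes a: "a \<in> S" "a + real m *\<^sub>R w \<in> S" and w: "w \<in> integer_vectors" "w \<noteq> 0" and m: "m \<ge> 1"
    and L: "L \<subseteq> S" and lines: "\<And>x y t. x \<in> L \<Longrightarrow> y \<in> L \<Longrightarrow> x - y = t *\<^sub>R w \<Longrightarrow> x = y"
  shows "real (card L) * real m * real V \<le>
    (2 * real CARD('d)) ^ CARD('d) * measure lebesgue (prism (convex hull S) e)"
proof -
  let ?d = "real CARD('d)"
  have ne: "a \<noteq> a + real m *\<^sub>R w" using w m by simp
  obtain f :: "real ^ 'd \<Rightarrow> real ^ 'd" and j1 where f: "linear f" "inj f" "f ` integer_vectors \<subseteq> integer_vectors"
    and fj: "f (axis j1 1) = (a + real m *\<^sub>R w) - a"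
    and hull: "\<forall>q. (\<forall>i. 0 \<le> q $ i \<and> q $ i \<le> 1 / ?d) \<longrightarrow>
       (\<exists>p s. p \<in> convex hull S \<and> 0 \<le> s \<and> s \<le> 1 \<and> a + f q = p + s *\<^sub>R e)"
    and uf: "\<forall>q\<in>integer_vectors. \<exists>k\<in>\<int>. u \<bullet> f q = k * real V \<and> (k = 0 \<longrightarrow> (\<exists>i\<noteq>j1. q $ i = 0))"
    by (rule lattice_frame[OF a ne], rule that)
  have f0: "f 0 = 0" using f(1) by (rule linear_0)
  have d2: "?d \<ge> 2"
  proof -
    have "aff_dim {a, a + real m *\<^sub>R w} \<le> aff_dim S" using a by (intro aff_dim_subset) auto
    moreover have "aff_dim {a, a + real m *\<^sub>R w} = 1" using ne by simp
    ultimately show ?thesis using aff_dim_S by linarith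
  qed
  have uw: "u \<bullet> w = 0"
    using S_plane[OF a(1)] S_plane[OF a(2)] m by (simp add: inner_add_right)
  let ?\<mu> = "measure lebesgue (f ` cbox 0 1)"
  let ?K = "prism (convex hull S) e"
  \<comment> \<open>This is the midpoint of \<open>x\<close> with the corner at \<open>a\<close> of
    the parallelepiped, shrunk by \<open>1 / ?d\<close>. Since \<open>x\<close> and the base of the
    corner lie in \<open>convex hull S\<close>, the copy stays in the prism.\<close>
  define E where "E x = (\<lambda>y. (1 / (2 * ?d)) *\<^sub>R y + (1 / 2) *\<^sub>R (x + a)) ` (f ` cbox 0 1)" for x
  have finL: "finite L" using L finite_S finite_subset by blast
  have "compact (f ` cbox 0 1)"
    using f(1) by (intro compact_continuous_image linear_continuous_on compact_cbox) (simp add: linear_conv_bounded_linear)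
  then have cE: "compact (E x)" for x
    unfolding E_def by (intro compact_continuous_image[of "f ` cbox 0 1"] continuous_intros)
  have mult: "real (card {x \<in> L. y \<in> E x}) \<le> ?\<mu> / (real m * real V)" for y
  proof -
    let ?X = "{x \<in> L. y \<in> E x}"
    let ?I = "?X \<times> {..<m} \<times> {..<V}"
    define P where "P = (\<lambda>(x, j::nat, l::nat). x + real j *\<^sub>R w + real l *\<^sub>R z)"
    \<comment> \<open>The height over the facet gives \<open>l = l'\<close>, since a multiple of
      \<open>V\<close> smaller than \<open>V\<close> is 0. The coordinates of \<open>n\<close> other
      than \<open>j1\<close> are integers of absolute value at most \<open>1 / ?d\<close>, hence 0,
      so \<open>x - x'\<close> is parallel to \<open>w\<close> and \<open>x = x'\<close>. What
      remains in coordinate \<open>j1\<close> is \<open>(j - j') / m\<close>, an integer below 1 in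
      absolute value.\<close>
    have key: "t = t'" if t: "t \<in> ?I" "t' \<in> ?I" and cong: "P t - P t' \<in> f ` integer_vectors" for t t'
    proof -
      obtain x j l where tt: "t = (x, j, l)" by (metis surj_pair)
      obtain x' j' l' where tt': "t' = (x', j', l')" by (metis surj_pair)
      have mem: "x \<in> L" "y \<in> E x" "j < m" "l < V" "x' \<in> L" "y \<in> E x'" "j' < m" "l' < V"
        using t tt tt' by auto
      obtain q q' where q: "q \<in> cbox 0 1" "y = (1 / (2 * ?d)) *\<^sub>R f q + (1 / 2) *\<^sub>R (x + a)"
        and q': "q' \<in> cbox 0 1" "y = (1 / (2 * ?d)) *\<^sub>R f q' + (1 / 2) *\<^sub>R (x' + a)"
        using mem unfolding E_def by blast
      obtain n where n: "n \<in> integer_vectors" "P t - P t' = f n" using cong by blast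
      have diff: "P t - P t' = (x - x') + (real j - real j') *\<^sub>R w + (real l - real l') *\<^sub>R z"
        by (simp add: P_def tt tt' algebra_simps)
      have ux: "u \<bullet> x = u \<bullet> x'" using mem L S_plane by (metis subsetD)
      obtain k where k: "k \<in> \<int>" "u \<bullet> f n = k * real V" "k = 0 \<Longrightarrow> \<exists>i\<noteq>j1. n $ i = 0"
        using bspec[OF uf n(1)] by blast
      have ll: "real l - real l' = k * real V"
        using arg_cong[OF n(2), of "\<lambda>v. u \<bullet> v"] unfolding diff k(2)
        by (simp add: inner_add_right inner_diff_right ux uw uz)
      have "\<bar>k\<bar> * real V < 1 * real V"
      proof -
        have "\<bar>real l - real l'\<bar> < real V" using mem by linarith
        then show ?thesis unfolding ll by (simp add: abs_mult)
      qed
      then have "\<bar>k\<bar> < 1" using V by (simp only: mult_less_cancel_right)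
      then have "k = 0" using k(1) by (rule Ints_abs_less_1[rotated])
      then have l: "l = l'" using ll by simp
      have xx: "x - x' = f ((1 / ?d) *\<^sub>R (q' - q))"
      proof -
        have "(1 / 2) *\<^sub>R (x + a) - (1 / 2) *\<^sub>R (x' + a) = (1 / (2 * ?d)) *\<^sub>R f q' - (1 / (2 * ?d)) *\<^sub>R f q"
          using q(2) q'(2) by (simp add: algebra_simps)
        then have "2 *\<^sub>R ((1 / 2) *\<^sub>R (x + a) - (1 / 2) *\<^sub>R (x' + a)) = 2 *\<^sub>R ((1 / (2 * ?d)) *\<^sub>R f q' - (1 / (2 * ?d)) *\<^sub>R f q)"
          by simp
        then have "x - x' = (1 / ?d) *\<^sub>R f q' - (1 / ?d) *\<^sub>R f q"
          by (simp add: scaleR_diff_right scaleR_add_right)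
        also have "\<dots> = f ((1 / ?d) *\<^sub>R (q' - q))"
          using f(1) by (simp add: linear_cmul linear_diff scaleR_diff_right)
        finally show ?thesis .
      qed
      have fw: "real m *\<^sub>R w = f (axis j1 1)" using fj by simp
      define \<rho> where "\<rho> = (real j - real j') / real m"
      have "(real j - real j') *\<^sub>R w = f (\<rho> *\<^sub>R axis j1 1)"
        using f(1) m by (simp add: linear_cmul fw[symmetric] \<rho>_def)
      then have "f n = f ((1 / ?d) *\<^sub>R (q' - q) + \<rho> *\<^sub>R axis j1 1)"
        using n(2) f(1) unfolding diff xx l by (simp add: linear_add)
      then have neq: "n = (1 / ?d) *\<^sub>R (q' - q) + \<rho> *\<^sub>R axis j1 1"
        using f(2) by (simp add: inj_eq)
      have "(q' - q) $ i = 0" if "i \<noteq> j1" for i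
      proof -
        have ni: "n $ i = (q' $ i - q $ i) / ?d" unfolding neq using that by (simp add: axis_def)
        have "\<bar>q' $ i - q $ i\<bar> \<le> 1"
          using q(1) q'(1) unfolding mem_box_cart by (simp add: abs_le_iff) (smt (verit))
        then have "\<bar>n $ i\<bar> < 1" unfolding ni using d2 by (simp add: abs_divide divide_less_eq)
        moreover have "n $ i \<in> \<int>" using n(1) by (simp add: integer_vectors_def)
        ultimately have "n $ i = 0" by (rule Ints_abs_less_1[rotated])
        then show ?thesis using ni d2 by simp
      qed
      then have qq: "q' - q = (q' - q) $ j1 *\<^sub>R axis j1 1"
        by (simp add: vec_eq_iff axis_def)
      have "x - x' = ((1 / ?d) * (q' - q) $ j1 * real m) *\<^sub>R w"
      proof -
        have "x - x' = f (((1 / ?d) * (q' - q) $ j1) *\<^sub>R axis j1 1)" using xx qq by (metis scaleR_scaleR)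
        also have "\<dots> = ((1 / ?d) * (q' - q) $ j1) *\<^sub>R (real m *\<^sub>R w)" using f(1) by (simp add: linear_cmul fw)
        finally show ?thesis by simp
      qed
      then have x: "x = x'" using lines mem by blast
      then have "f ((1 / ?d) *\<^sub>R (q' - q)) = f 0" using xx f0 by simp
      then have "(1 / ?d) *\<^sub>R (q' - q) = 0" using f(2) by (simp add: inj_eq)
      then have "n $ j1 = \<rho>" unfolding neq by (simp add: axis_def)
      then have "\<rho> \<in> \<int>" using n(1) by (auto simp: integer_vectors_def)
      moreover have "\<bar>\<rho>\<bar> < 1"
      proof -
        have "\<bar>real j - real j'\<bar> < real m" using mem by linarith
        then show ?thesis using m by (simp add: \<rho>_def abs_divide)
      qed
      ultimately have "\<rho> = 0" by (rule Ints_abs_less_1)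
      then have "j = j'" using m by (simp add: \<rho>_def)
      with x l tt tt' show ?thesis by simp
    qed
    have finI: "finite ?I" using finL by simp
    have injP: "inj_on P ?I"
    proof (rule inj_onI)
      fix t t' assume t: "t \<in> ?I" "t' \<in> ?I" and "P t = P t'"
      then have "P t - P t' = f 0" using f0 by simp
      then have "P t - P t' \<in> f ` integer_vectors" using integer_vectors_closed(1) by blast
      with t show "t = t'" by (rule key)
    qed
    have "real (card (P ` ?I)) \<le> ?\<mu>"
    proof (rule card_incongruent_le_measure[OF f])
      show "finite (P ` ?I)" using finI by simp
      show "P ` ?I \<subseteq> integer_vectors"
        using L S_int w(1) z_int by (auto simp: P_def intro!: integer_vectors_closed)
      show "r = r'" if "r \<in> P ` ?I" "r' \<in> P ` ?I" "r - r' \<in> f ` integer_vectors" for r r'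
        using that key by blast
    qed
    moreover have "card (P ` ?I) = card ?X * m * V"
      using injP by (simp add: card_image card_cartesian_product)
    ultimately have "real (card ?X) * (real m * real V) \<le> ?\<mu>" by (simp add: mult.assoc)
    then show ?thesis using m V by (simp add: pos_le_divide_eq)
  qed
  have meas: "measure lebesgue (E x) = (1 / (2 * ?d)) ^ CARD('d) * ?\<mu>" for x
    unfolding E_def by (subst measure_lebesgue_affine) simp
  have EK: "E x \<subseteq> ?K" if x: "x \<in> L" for x
  proof
    fix y assume "y \<in> E x"
    then obtain q where q: "q \<in> cbox 0 1" "y = (1 / (2 * ?d)) *\<^sub>R f q + (1 / 2) *\<^sub>R (x + a)"
      unfolding E_def by blast
    have "0 \<le> ((1 / ?d) *\<^sub>R q) $ i \<and> ((1 / ?d) *\<^sub>R q) $ i \<le> 1 / ?d" for i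
      using q(1) by (auto simp: mem_box_cart divide_simps)
    then obtain p s where p: "p \<in> convex hull S" "0 \<le> s" "s \<le> 1" "a + f ((1 / ?d) *\<^sub>R q) = p + s *\<^sub>R e"
      using hull[rule_format, of "(1 / ?d) *\<^sub>R q"] by blast
    have "y = (1 / 2) *\<^sub>R x + (1 / 2) *\<^sub>R (a + f ((1 / ?d) *\<^sub>R q))"
      using f(1) unfolding q(2) by (simp add: linear_cmul algebra_simps)
    also have "\<dots> = ((1 / 2) *\<^sub>R x + (1 / 2) *\<^sub>R p) + (s / 2) *\<^sub>R e"
      unfolding p(4) by (simp add: algebra_simps)
    finally have "y = ((1 / 2) *\<^sub>R x + (1 / 2) *\<^sub>R p) + (s / 2) *\<^sub>R e" .
    moreover have "(1 / 2) *\<^sub>R x + (1 / 2) *\<^sub>R p \<in> convex hull S"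
      using x L p(1) by (intro convexD[OF convex_convex_hull]) (auto intro: hull_inc)
    ultimately show "y \<in> ?K" using p(2,3) unfolding prism_def by fastforce
  qed
  have "(\<Sum>x\<in>L. measure lebesgue (E x)) \<le> ?\<mu> / (real m * real V) * measure lebesgue ?K"
  proof (rule sum_measure_le_of_multiplicity[OF finL _ EK _ mult])
    show "E x \<in> lmeasurable" for x using cE by (rule lmeasurable_compact)
    show "?K \<in> lmeasurable"
      using finite_S by (intro lmeasurable_compact compact_prism compact_convex_hull finite_imp_compact)
  qed
  then have ineq: "real (card L) * ((1 / (2 * ?d)) ^ CARD('d) * ?\<mu>) \<le> ?\<mu> / (real m * real V) * measure lebesgue ?K"
    by (simp add: meas)
  \<comment> \<open>The volume of the parallelepiped occurs both in the multiplicity and in the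
    volume of each copy; it can be cancelled because packing a single point shows it to be
    positive.\<close>
  have "1 \<le> ?\<mu>"
    using card_incongruent_le_measure[OF f, of "{0}"] by (simp add: integer_vectors_closed)
  then have \<mu>: "?\<mu> > 0" by linarith
  have pos: "(2 * ?d) ^ CARD('d) > 0" "real m * real V > 0" using m V by auto
  have "real (card L) * (1 / (2 * ?d) ^ CARD('d)) * ?\<mu> \<le> (measure lebesgue ?K / (real m * real V)) * ?\<mu>"
    using ineq by (simp add: power_one_over mult_ac)
  then have "real (card L) * (1 / (2 * ?d) ^ CARD('d)) \<le> measure lebesgue ?K / (real m * real V)"
    using \<mu> by (rule mult_right_le_imp_le)
  then have "real (card L) / (2 * ?d) ^ CARD('d) * (real m * real V) \<le> measure lebesgue ?K"
    using pos by (simp add: pos_le_divide_eq)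
  then show ?thesis using pos by (simp add: field_simps)
qed

end

text \<open>Since \<open>u \<bullet> z = 1\<close>, some coordinate of \<open>u\<close> is odd and
  hence a unit modulo \<open>2 ^ s\<close>. The equation of the plane then determines that
  coordinate of a point modulo \<open>2 ^ s\<close> from the others, and the pigeonhole principle is
  needed for \<open>CARD('d) - 1\<close> coordinates only. For a general modulus no coordinate of
  \<open>u\<close> need be a unit.\<close>

lemma two_power_congruent_pair:
  fixes C :: "(real ^ 'd) set"
  assumes C: "C \<subseteq> integer_vectors" and plane: "\<And>x. x \<in> C \<Longrightarrow> u \<bullet> x = c"
    and u: "u \<in> integer_vectors" and z: "z \<in> integer_vectors" and uz: "u \<bullet> z = 1"
    and card: "(2 ^ s) ^ (CARD('d) - 1) < card C"
  obtains x y where "x \<in> C" "y \<in> C" "x \<noteq> y" "(x - y) /\<^sub>R 2 ^ s \<in> integer_vectors"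
proof -
  define I where "I x j = \<lfloor>x $ j\<rfloor>" for x :: "real ^ 'd" and j
  have I: "x $ j = of_int (I x j)" if "x \<in> integer_vectors" for x j
    using that by (auto simp: integer_vectors_def I_def elim!: Ints_cases dest!: spec[of _ j])
  have "\<exists>i. odd (I u i)"
  proof (rule ccontr)
    assume "\<not> ?thesis"
    then have "even (\<Sum>i\<in>UNIV. I u i * I z i)" by (intro dvd_sum) auto
    moreover have "real_of_int (\<Sum>i\<in>UNIV. I u i * I z i) = of_int 1"
      using uz I[OF u] I[OF z] by (simp add: inner_vec_def)
    then have "(\<Sum>i\<in>UNIV. I u i * I z i) = 1" by (simp only: of_int_eq_iff)
    ultimately show False by simp
  qed
  then obtain i where i: "odd (I u i)" by blast
  define h where "h x = restrict (\<lambda>j. I x j mod 2 ^ s) (UNIV - {i})" for x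
  let ?P = "PiE (UNIV - {i}) (\<lambda>_. {0..<2 ^ s :: int})"
  have "card (h ` C) \<le> card ?P"
  proof (rule card_mono)
    show "finite ?P" by (intro finite_PiE) auto
    show "h ` C \<subseteq> ?P" unfolding h_def by (intro image_subsetI restrict_PiE_iff[THEN iffD2]) simp
  qed
  also have "\<dots> = (2 ^ s) ^ (CARD('d) - 1)"
    by (simp add: card_PiE card_Diff_singleton nat_power_eq)
  finally have "card (h ` C) < card C" using card by linarith
  then have "\<not> inj_on h C" by (rule pigeonhole)
  then obtain x y where xy: "x \<in> C" "y \<in> C" "h x = h y" "x \<noteq> y" by (auto simp: inj_on_def)
  have xyi: "x \<in> integer_vectors" "y \<in> integer_vectors" using xy C by auto
  have j: "2 ^ s dvd I x j - I y j" if "j \<noteq> i" for j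
  proof -
    have "I x j mod 2 ^ s = I y j mod 2 ^ s"
      using fun_cong[OF xy(3), of j] that by (simp add: h_def)
    then show ?thesis by (simp add: mod_eq_dvd_iff)
  qed
  have "(\<Sum>j\<in>UNIV. I u j * (I x j - I y j)) = 0"
  proof -
    have "u \<bullet> (x - y) = 0" using plane xy by (simp add: inner_diff_right)
    then have "real_of_int (\<Sum>j\<in>UNIV. I u j * (I x j - I y j)) = of_int 0"
      using I[OF u] I[OF xyi(1)] I[OF xyi(2)] by (simp add: inner_vec_def)
    then show ?thesis by (simp only: of_int_eq_iff)
  qed
  then have "I u i * (I x i - I y i) = - (\<Sum>j\<in>UNIV - {i}. I u j * (I x j - I y j))"
    by (simp add: sum.remove[of _ i])
  moreover have "2 ^ s dvd (\<Sum>j\<in>UNIV - {i}. I u j * (I x j - I y j))"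
    using j by (intro dvd_sum) auto
  ultimately have "2 ^ s dvd I u i * (I x i - I y i)" by simp
  moreover have "coprime (2 ^ s) (I u i)" using i by simp
  ultimately have ji: "2 ^ s dvd I x i - I y i" by (simp add: coprime_dvd_mult_right_iff)
  have all: "2 ^ s dvd I x k - I y k" for k using j ji by (cases "k = i") auto
  have "(x - y) /\<^sub>R 2 ^ s \<in> integer_vectors"
    unfolding integer_vectors_def
  proof safe
    fix k
    obtain t where t: "I x k - I y k = 2 ^ s * t" using all[of k] by (auto elim: dvdE)
    have "x $ k - y $ k = of_int (I x k - I y k)" using I[OF xyi(1)] I[OF xyi(2)] by simp
    also have "\<dots> = 2 ^ s * of_int t" unfolding t by simp
    finally have "((x - y) /\<^sub>R 2 ^ s) $ k = of_int t" by (simp add: field_simps)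
    then show "((x - y) /\<^sub>R 2 ^ s) $ k \<in> \<int>" by simp
  qed
  with xy that show ?thesis by blast
qed

lemma collinear_parallel:
  assumes "\<And>x. x \<in> X \<Longrightarrow> \<exists>t. x - p = t *\<^sub>R w"
  shows "collinear X"
proof -
  have "\<exists>t. x = p + t *\<^sub>R w" if "x \<in> X" for x
    using assms[OF that] by (metis add_diff_cancel_left' diff_add_cancel add.commute)
  then show ?thesis unfolding collinear_alt by blast
qed

lemma integer_vectors_divisor_le:
  fixes x :: "real ^ 'd"
  assumes "x \<noteq> 0" "x /\<^sub>R real g \<in> integer_vectors"
  shows "real g \<le> norm x"
proof (cases "g = 0")
  case False
  obtain i where i: "x $ i \<noteq> 0" using assms(1) by (auto simp: vec_eq_iff)
  have "(x /\<^sub>R real g) $ i \<in> \<int>" using assms(2) by (simp add: integer_vectors_def)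
  moreover have "(x /\<^sub>R real g) $ i \<noteq> 0" using i False by simp
  ultimately have "1 \<le> \<bar>(x /\<^sub>R real g) $ i\<bar>" by (rule Ints_nonzero_abs_ge1)
  also have "\<dots> = \<bar>x $ i\<bar> / real g" by (simp add: abs_mult divide_inverse mult.commute)
  finally have "real g \<le> \<bar>x $ i\<bar>" using False by (simp add: field_simps)
  also have "\<dots> \<le> norm x" by (rule component_le_norm_cart)
  finally show ?thesis .
qed simp

context lattice_facet
begin

text \<open>Write N for \<open>card C\<close> and b for 1/(2d - 1). At least N / (K * m powr b)
  lines in direction \<open>w\<close> meet \<open>C\<close>, and each counts \<open>m\<close>-fold
  in the packing bound, which gives N * m powr (1 - b). The pigeonhole principle gives N \<le>
  (2m)^(d - 1), and (1 - b)/(d - 1) = 2/(2d - 1) is the gain in the exponent.\<close>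

lemma sparse_card_le_prism:
  assumes C: "C \<subseteq> S" and sparse: "line_sparse K C" and K: "K > 0" and N: "card C \<ge> 2"
  shows "real (card C) powr (1 + 2 / (2 * real CARD('d) - 1)) * real V \<le>
    2 * K * (2 * real CARD('d)) ^ CARD('d) * measure lebesgue (prism (convex hull S) e)"
proof -
  let ?d = "real CARD('d)"
  let ?\<beta> = "1 / (2 * ?d - 1)"
  let ?vol = "measure lebesgue (prism (convex hull S) e)"
  have finC: "finite C" using C finite_S finite_subset by blast
  have Cint: "C \<subseteq> integer_vectors" using C S_int by blast
  \<comment> \<open>The maximum \<open>m\<close> of these divisors is admissible in
    \<open>line_sparse\<close> for every line at once, and a pair attaining it supplies the
    direction \<open>w\<close>.\<close>
  define G where "G = {g::nat. \<exists>x\<in>C. \<exists>y\<in>C. x \<noteq> y \<and> (x - y) /\<^sub>R real g \<in> integer_vectors}"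
  \<comment> \<open>The largest power of 2 for which the pigeonhole principle still applies;
    stopping at powers of 2 loses at most a factor 2 in the modulus.\<close>
  have "\<exists>s. 2 ^ (s * (CARD('d) - 1)) < card C \<and> card C \<le> 2 ^ (Suc s * (CARD('d) - 1))"
  proof -
    obtain x y where "x \<in> C" "y \<in> C" "x \<noteq> y"
      using N by (metis card_le_Suc0_iff_eq finC not_less_eq_eq numeral_2_eq_2)
    then have "{x, y} \<subseteq> S" using C by blast
    then have "aff_dim {x, y} \<le> aff_dim S" by (rule aff_dim_subset)
    then have d2: "CARD('d) \<ge> 2" using aff_dim_S \<open>x \<noteq> y\<close> by simp
    define P where "P t \<longleftrightarrow> card C \<le> 2 ^ (t * (CARD('d) - 1))" for t
    have "card C < 2 ^ card C" by (rule less_exp)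
    also have "\<dots> \<le> 2 ^ (card C * (CARD('d) - 1))" using d2 by (intro power_increasing) auto
    finally have "P (card C)" by (simp add: P_def)
    then have L: "P (LEAST t. P t)" by (rule LeastI)
    moreover have "\<not> P 0" using N by (simp add: P_def)
    ultimately obtain s where s: "(LEAST t. P t) = Suc s" by (metis not0_implies_Suc)
    then have "\<not> P s" by (metis lessI not_less_Least)
    with L s show ?thesis unfolding P_def by (metis not_le)
  qed
  then obtain s where s: "2 ^ (s * (CARD('d) - 1)) < card C" "card C \<le> 2 ^ (Suc s * (CARD('d) - 1))" by blast
  obtain x y where "x \<in> C" "y \<in> C" "x \<noteq> y" "(x - y) /\<^sub>R 2 ^ s \<in> integer_vectors"
    by (rule two_power_congruent_pair[OF Cint _ u_int z_int uz, of c s])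
      (use S_plane C s(1) in \<open>auto simp: power_mult\<close>)
  then have sG: "2 ^ s \<in> G" unfolding G_def by auto
  have "G \<subseteq> {..nat \<lceil>\<Sum>x\<in>C. \<Sum>y\<in>C. norm (x - y)\<rceil>}"
  proof
    fix g assume "g \<in> G"
    then obtain x y where xy: "x \<in> C" "y \<in> C" "x \<noteq> y" "(x - y) /\<^sub>R real g \<in> integer_vectors"
      by (auto simp: G_def)
    have "real g \<le> norm (x - y)" using xy by (intro integer_vectors_divisor_le) auto
    also have "\<dots> \<le> (\<Sum>y\<in>C. norm (x - y))" using xy finC by (intro member_le_sum) auto
    also have "\<dots> \<le> (\<Sum>x\<in>C. \<Sum>y\<in>C. norm (x - y))"
      using xy finC by (intro member_le_sum[of x C "\<lambda>x. \<Sum>y\<in>C. norm (x - y)"]) (auto intro: sum_nonneg)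
    finally show "g \<in> {..nat \<lceil>\<Sum>x\<in>C. \<Sum>y\<in>C. norm (x - y)\<rceil>}" by (simp; linarith)
  qed
  then have finG: "finite G" by (rule finite_subset) simp
  define m where "m = Max G"
  have mG: "m \<in> G" unfolding m_def using finG sG by (intro Max_in) auto
  have Gm: "g \<le> m" if "g \<in> G" for g unfolding m_def using finG that by simp
  have ms: "2 ^ s \<le> m" using Gm[OF sG] by simp
  then have m: "m \<ge> 1" by (metis one_le_numeral one_le_power order_trans)
  obtain b a where ab: "b \<in> C" "a \<in> C" "b \<noteq> a" "(b - a) /\<^sub>R real m \<in> integer_vectors"
    using mG by (auto simp: G_def)
  define w where "w = (b - a) /\<^sub>R real m"
  have w: "w \<in> integer_vectors" "w \<noteq> 0" "a + real m *\<^sub>R w = b"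
    using ab m by (auto simp: w_def)
  define R where "R x y \<longleftrightarrow> (\<exists>t. x - y = t *\<^sub>R w)" for x y
  have R_refl: "R x x" for x unfolding R_def by (intro exI[of _ 0]) simp
  have R_sym: "R y x" if "R x y" for x y
    using that unfolding R_def by (metis minus_diff_eq scaleR_minus_left)
  have R_trans: "R x z" if "R x y" "R y z" for x y z
    using that unfolding R_def by (metis diff_add_cancel add_diff_eq scaleR_left.add)
  \<comment> \<open>The choice depends only on the line through \<open>x\<close> in direction
    \<open>w\<close>, so \<open>L\<close> contains one point of each such line that meets
    \<open>C\<close>.\<close>
  define \<pi> where "\<pi> x = (SOME y. y \<in> C \<and> R x y)" for x
  have \<pi>: "\<pi> x \<in> C" "R x (\<pi> x)" if "x \<in> C" for x
    using someI[of "\<lambda>y. y \<in> C \<and> R x y" x] that R_refl unfolding \<pi>_def by auto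
  have \<pi>_eq: "\<pi> x = \<pi> y" if "R x y" for x y
  proof -
    have "(\<lambda>v. v \<in> C \<and> R x v) = (\<lambda>v. v \<in> C \<and> R y v)"
      using that R_sym R_trans by blast
    then show ?thesis by (simp add: \<pi>_def)
  qed
  define L where "L = \<pi> ` C"
  have L: "L \<subseteq> S" using \<pi> C by (auto simp: L_def)
  have lines: "x = y" if xy: "x \<in> L" "y \<in> L" "x - y = t *\<^sub>R w" for x y t
  proof -
    obtain x' y' where x': "x' \<in> C" "x = \<pi> x'" "y' \<in> C" "y = \<pi> y'" using xy by (auto simp: L_def)
    have "R x y" using xy by (auto simp: R_def)
    then have "R x' y'" using \<pi>[of x'] \<pi>[of y'] x' R_sym R_trans by metis
    then show ?thesis using x' \<pi>_eq by simp
  qed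
  have cardL: "real (card L) * real m * real V \<le> (2 * ?d) ^ CARD('d) * ?vol"
    by (rule card_lines_le_prism[of a m w L]) (use ab w C m L lines in auto)
  have fiber: "real (card {x \<in> C. \<pi> x = y}) \<le> K * real m powr ?\<beta>" for y
  proof -
    let ?X = "{x \<in> C. \<pi> x = y}"
    have "collinear ?X"
      by (rule collinear_parallel[of _ y w]) (use \<pi>(2) in \<open>auto simp: R_def\<close>)
    moreover have "\<forall>x\<in>?X. \<forall>y\<in>?X. \<forall>g::nat. x \<noteq> y \<longrightarrow> (x - y) /\<^sub>R real g \<in> integer_vectors \<longrightarrow> g \<le> m"
      using Gm unfolding G_def by blast
    ultimately show ?thesis
      using sparse m unfolding line_sparse_def by (metis (no_types, lifting) mem_Collect_eq subsetI)
  qed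
  have "card C = card (\<Union>y\<in>L. {x \<in> C. \<pi> x = y})"
    by (rule arg_cong[where f = card]) (auto simp: L_def)
  also have "\<dots> \<le> (\<Sum>y\<in>L. card {x \<in> C. \<pi> x = y})"
    using finC by (intro card_UN_le) (simp add: L_def)
  finally have "real (card C) \<le> (\<Sum>y\<in>L. real (card {x \<in> C. \<pi> x = y}))"
    unfolding of_nat_sum[symmetric] of_nat_le_iff .
  also have "\<dots> \<le> (\<Sum>y\<in>L. K * real m powr ?\<beta>)" by (intro sum_mono fiber)
  finally have CL: "real (card C) \<le> real (card L) * (K * real m powr ?\<beta>)" by simp
  have d1: "2 * ?d - 1 > 0"
  proof -
    have "?d \<ge> 1" by (simp add: Suc_le_eq)
    then show ?thesis by linarith
  qed
  have "real (card C) powr (2 / (2 * ?d - 1)) \<le> 2 * real m powr (1 - ?\<beta>)"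
  proof -
    have "card C \<le> (2 * 2 ^ s) ^ (CARD('d) - 1)"
      using s(2) by (simp only: power_mult power_Suc)
    also have "\<dots> \<le> (2 * m) ^ (CARD('d) - 1)" using ms by (intro power_mono) auto
    finally have "real (card C) \<le> (2 * real m) ^ (CARD('d) - 1)"
      by (metis of_nat_le_iff of_nat_mult of_nat_numeral of_nat_power)
    also have "\<dots> = (2 * real m) powr (?d - 1)"
      using m by (simp add: powr_realpow[symmetric] of_nat_diff Suc_le_eq powr_mult)
    finally have "real (card C) powr (2 / (2 * ?d - 1)) \<le> ((2 * real m) powr (?d - 1)) powr (2 / (2 * ?d - 1))"
      using d1 by (intro powr_mono2) auto
    also have "\<dots> = (2 * real m) powr (1 - ?\<beta>)"
    proof -
      have "(?d - 1) * (2 / (2 * ?d - 1)) = 1 - ?\<beta>" using d1 by (simp add: field_simps)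
      then show ?thesis by (simp add: powr_powr)
    qed
    also have "\<dots> = 2 powr (1 - ?\<beta>) * real m powr (1 - ?\<beta>)" by (simp add: powr_mult)
    also have "\<dots> \<le> 2 powr 1 * real m powr (1 - ?\<beta>)"
      using d1 by (intro mult_right_mono powr_mono) auto
    finally show ?thesis by simp
  qed
  then have "real (card C) * real (card C) powr (2 / (2 * ?d - 1)) \<le>
      (real (card L) * (K * real m powr ?\<beta>)) * (2 * real m powr (1 - ?\<beta>))"
    using CL by (intro mult_mono) (auto intro!: mult_nonneg_nonneg simp: K[THEN less_imp_le])
  also have "\<dots> = 2 * K * (real (card L) * (real m powr ?\<beta> * real m powr (1 - ?\<beta>)))" by simp
  also have "real m powr ?\<beta> * real m powr (1 - ?\<beta>) = real m"
    using m by (simp flip: powr_add)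
  finally have "real (card C) powr (1 + 2 / (2 * ?d - 1)) \<le> 2 * K * (real (card L) * real m)"
    using N by (simp add: powr_add)
  then have "real (card C) powr (1 + 2 / (2 * ?d - 1)) * real V \<le> 2 * K * (real (card L) * real m) * real V"
    by (rule mult_right_mono) simp
  also have "\<dots> = 2 * K * (real (card L) * real m * real V)" by simp
  also have "\<dots> \<le> 2 * K * ((2 * ?d) ^ CARD('d) * ?vol)"
    using cardL K by (intro mult_left_mono) auto
  finally show ?thesis by (simp add: mult.assoc)
qed

end

subsection \<open>Summation over the facets\<close>

lemma sum_inverse_sqrt_le: "(\<Sum>k=1..n. 1 / sqrt (real k)) \<le> 2 * sqrt (real n)"
proof (induction n)
  case (Suc n)
  have *: "1 / b \<le> 2 * (b - a)" if "a \<le> b" "b > 0" "b * b = a * a + 1" for a b :: real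
  proof -
    have "1 = (b - a) * (b + a)" using that(3) by (simp add: algebra_simps)
    also have "\<dots> \<le> (b - a) * (2 * b)" using that by (intro mult_left_mono) auto
    also have "\<dots> = 2 * (b - a) * b" by simp
    finally show ?thesis using that(2) by (simp only: pos_divide_le_eq)
  qed
  have "1 / sqrt (real (Suc n)) \<le> 2 * (sqrt (real (Suc n)) - sqrt (real n))"
    by (rule *) auto
  then show ?case using Suc by simp
qed simp

text \<open>Split according to whether N is below or above the threshold (R / U) powr (d - 1/2): below it
  the counting bound for the values of U suffices, above it N is at most its weight divided by R.\<close>

lemma sum_le_of_weighted_sum:
  fixes N U :: "'b \<Rightarrow> nat" and A B R :: real
  assumes fin: "finite I" and U: "\<And>F. F \<in> I \<Longrightarrow> U F \<ge> 1" and d: "d \<ge> 1" and R: "R > 0" and A: "A \<ge> 0"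
    and count: "\<And>k. k \<ge> 1 \<Longrightarrow> real (card {F \<in> I. U F = k}) \<le> A * real k ^ (d - 1)"
    and weight: "(\<Sum>F\<in>I. real (N F) powr (1 + 2 / (2 * real d - 1)) * real (U F)) \<le> B * R ^ Suc d"
  shows "(\<Sum>F\<in>I. real (N F)) \<le> (2 * A + B) * R ^ d"
proof -
  let ?\<theta> = "real d - 1 / 2"
  have \<theta>: "?\<theta> > 0" using d by auto
  have inv: "2 / (2 * real d - 1) = 1 / ?\<theta>" using \<theta> by (simp add: field_simps)
  \<comment> \<open>For \<open>U F > R\<close> the threshold is below 1, so no positive
    \<open>N F\<close> is below it; hence the cut-off.\<close>
  define g where "g k = (if real k \<le> R then (R / real k) powr ?\<theta> else 0)" for k :: nat
  have pt: "real (N F) \<le> g (U F) + real (N F) powr (1 + 1 / ?\<theta>) * real (U F) / R" if F: "F \<in> I" for F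
  proof -
    have U1: "real (U F) \<ge> 1" using U[OF F] by simp
    have g0: "g (U F) \<ge> 0" by (simp add: g_def)
    have h0: "real (N F) powr (1 + 1 / ?\<theta>) * real (U F) / R \<ge> 0" using R by simp
    consider "N F = 0" | "N F \<ge> 1" "real (N F) \<le> (R / real (U F)) powr ?\<theta>"
      | "N F \<ge> 1" "real (N F) > (R / real (U F)) powr ?\<theta>" by linarith
    then show ?thesis
    proof cases
      case 1 then show ?thesis using g0 h0 by simp
    next
      case 2
      have "real (U F) \<le> R"
      proof (rule ccontr)
        assume "\<not> ?thesis"
        then have "(R / real (U F)) powr ?\<theta> < 1 powr ?\<theta>"
          using R U1 \<theta> by (intro powr_less_mono2) auto
        then show False using 2 by simp
      qed
      then have "real (N F) \<le> g (U F)" using 2 by (simp add: g_def)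
      then show ?thesis using h0 by linarith
    next
      case 3
      have "R / real (U F) = ((R / real (U F)) powr ?\<theta>) powr (1 / ?\<theta>)"
        using \<theta> R U1 by (simp add: powr_powr)
      also have "\<dots> \<le> real (N F) powr (1 / ?\<theta>)"
        using 3 \<theta> by (intro powr_mono2) auto
      finally have "R \<le> real (N F) powr (1 / ?\<theta>) * real (U F)"
        using U1 by (simp add: divide_le_eq)
      then have "real (N F) * R \<le> real (N F) * (real (N F) powr (1 / ?\<theta>) * real (U F))"
        by (intro mult_left_mono) auto
      also have "\<dots> = real (N F) powr (1 + 1 / ?\<theta>) * real (U F)"
        using 3 by (simp add: powr_add)
      finally have "real (N F) \<le> real (N F) powr (1 + 1 / ?\<theta>) * real (U F) / R"
        using R by (simp add: le_divide_eq)
      then show ?thesis using g0 by linarith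
    qed
  qed
  have "(\<Sum>F\<in>I. g (U F)) \<le> 2 * A * R ^ d"
  proof -
    let ?J = "{1..nat \<lfloor>R\<rfloor>}"
    have "(\<Sum>F\<in>I. g (U F)) = (\<Sum>F\<in>{F\<in>I. U F \<in> ?J}. g (U F))"
    proof (rule sum.mono_neutral_right[OF fin])
      show "\<forall>F\<in>I - {F \<in> I. U F \<in> ?J}. g (U F) = 0"
      proof
        fix F assume F: "F \<in> I - {F \<in> I. U F \<in> ?J}"
        then have "\<not> U F \<le> nat \<lfloor>R\<rfloor>" using U[of F] by simp
        then have "\<not> real (U F) \<le> R" using le_nat_floor by blast
        then show "g (U F) = 0" by (simp add: g_def)
      qed
    qed blast
    also have "\<dots> = (\<Sum>k\<in>?J. \<Sum>F\<in>{F\<in>{F\<in>I. U F \<in> ?J}. U F = k}. g (U F))"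
      using fin by (intro sum.group[symmetric]) auto
    also have "\<dots> = (\<Sum>k\<in>?J. \<Sum>F\<in>{F\<in>I. U F = k}. g k)"
      by (intro sum.cong) auto
    also have "\<dots> = (\<Sum>k\<in>?J. real (card {F\<in>I. U F = k}) * g k)" by simp
    \<comment> \<open>The count k^(d - 1) and the threshold (R/k) powr (d - 1/2) leave k powr
      (-1/2), whose sum up to \<open>R\<close> is at most \<open>2 * sqrt R\<close>, and no
      logarithm arises. The threshold exponent d would leave 1/k and produce one.\<close>
    also have "\<dots> \<le> (\<Sum>k\<in>?J. A * R powr ?\<theta> * (1 / sqrt (real k)))"
    proof (rule sum_mono)
      fix k assume k: "k \<in> ?J"
      have "real k \<le> real (nat \<lfloor>R\<rfloor>)" using k by simp
      also have "\<dots> \<le> R" using R by simp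
      finally have k1: "real k \<ge> 1" "real k \<le> R" using k by simp_all
      have "real (card {F\<in>I. U F = k}) * g k \<le> A * real k ^ (d - 1) * g k"
        using k by (intro mult_right_mono count) (auto simp: g_def)
      also have "\<dots> = A * R powr ?\<theta> * (real k powr (real d - 1) / real k powr ?\<theta>)"
      proof -
        have "real k powr real (d - 1) = real k ^ (d - 1)" by (rule powr_realpow) (use k1 in simp)
        moreover have "real (d - 1) = real d - 1" using d by simp
        ultimately have pk: "real k ^ (d - 1) = real k powr (real d - 1)" by metis
        have "g k = (R / real k) powr ?\<theta>" using k1 by (simp only: g_def if_True)
        also have "\<dots> = R powr ?\<theta> / real k powr ?\<theta>" by (rule powr_divide)
        finally have gk: "g k = R powr ?\<theta> / real k powr ?\<theta>" .
        have comm: "A * x * (r / y) = A * r * (x / y)" for x r y :: real by simp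
        show ?thesis unfolding pk gk by (rule comm)
      qed
      also have "real k powr (real d - 1) / real k powr ?\<theta> = real k powr (- (1 / 2))"
      proof -
        have "real k powr (real d - 1) / real k powr ?\<theta> = real k powr ((real d - 1) - ?\<theta>)"
          by (rule powr_diff[symmetric])
        also have "(real d - 1) - ?\<theta> = - (1 / 2)" by simp
        finally show ?thesis .
      qed
      also have "\<dots> = 1 / sqrt (real k)"
      proof -
        have "real k powr (1 / 2) = sqrt (real k)" using k1 by (intro powr_half_sqrt) simp
        then show ?thesis by (simp only: powr_minus divide_inverse mult_1)
      qed
      finally show "real (card {F\<in>I. U F = k}) * g k \<le> A * R powr ?\<theta> * (1 / sqrt (real k))" .
    qed
    also have "\<dots> = A * R powr ?\<theta> * (\<Sum>k\<in>?J. 1 / sqrt (real k))" by (simp add: sum_distrib_left)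
    also have "\<dots> \<le> A * R powr ?\<theta> * (2 * sqrt R)"
    proof (intro mult_left_mono)
      have "(\<Sum>k\<in>?J. 1 / sqrt (real k)) \<le> 2 * sqrt (real (nat \<lfloor>R\<rfloor>))" by (rule sum_inverse_sqrt_le)
      also have "\<dots> \<le> 2 * sqrt R" using R by simp
      finally show "(\<Sum>k\<in>?J. 1 / sqrt (real k)) \<le> 2 * sqrt R" .
    qed (use A in auto)
    also have "\<dots> = 2 * A * (R powr ?\<theta> * R powr (1 / 2))" 
    proof -
      have "R powr (1 / 2) = sqrt R" using R by (intro powr_half_sqrt) simp
      then show ?thesis by (simp only: mult_ac)
    qed
    also have "R powr ?\<theta> * R powr (1 / 2) = R ^ d"
    proof -
      have "R powr ?\<theta> * R powr (1 / 2) = R powr (?\<theta> + 1 / 2)" by (rule powr_add[symmetric])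
      also have "?\<theta> + 1 / 2 = real d" by simp
      also have "R powr real d = R ^ d" using R by (rule powr_realpow)
      finally show ?thesis .
    qed
    finally show ?thesis .
  qed
  moreover have "(\<Sum>F\<in>I. real (N F) powr (1 + 1 / ?\<theta>) * real (U F) / R) \<le> B * R ^ d"
    using weight R unfolding inv by (simp add: divide_le_eq mult_ac flip: sum_divide_distrib)
  moreover have "(\<Sum>F\<in>I. real (N F)) \<le> (\<Sum>F\<in>I. g (U F)) + (\<Sum>F\<in>I. real (N F) powr (1 + 1 / ?\<theta>) * real (U F) / R)"
    unfolding sum.distrib[symmetric] by (rule sum_mono) (rule pt)
  ultimately show ?thesis unfolding distrib_right by linarith
qed

section \<open>Facets, their primitive normals and their prisms\<close>

definition directions :: "(real ^ 'd) set" where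
  "directions = (\<lambda>(i, \<sigma>). axis i \<sigma>) ` (UNIV \<times> {1, -1})"

lemma directions_finite: "finite directions" and directions_card: "card (directions :: (real ^ 'd) set) \<le> 2 * CARD('d)"
proof -
  show "finite directions" by (simp add: directions_def)
  have "card (directions :: (real ^ 'd) set) \<le> card ((UNIV :: 'd set) \<times> {1, -1 :: real})"
    unfolding directions_def by (rule card_image_le) simp
  then show "card (directions :: (real ^ 'd) set) \<le> 2 * CARD('d)"
    by (simp add: card_cartesian_product mult.commute)
qed

lemma directions_integer: "e \<in> directions \<Longrightarrow> e \<in> integer_vectors"
  by (auto simp: directions_def integer_vectors_def axis_def)

text \<open>The number \<open>k\<close> plays two roles: it is the number of layers per unit step
  along \<open>e\<close>, which enlarges the prism, and it bounds the other coordinates, which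
  limits the number of normals with this \<open>k\<close>.\<close>

lemma dominant_direction:
  fixes u :: "real ^ 'd"
  assumes "u \<in> integer_vectors" "u \<noteq> 0"
  obtains e k where "e \<in> directions" "u \<bullet> e = real k" "k \<ge> 1" "\<And>j. \<bar>u $ j\<bar> \<le> real k"
proof -
  have "finite (range (\<lambda>i. \<bar>u $ i\<bar>))" "range (\<lambda>i. \<bar>u $ i\<bar>) \<noteq> {}" by auto
  then have "Max (range (\<lambda>i. \<bar>u $ i\<bar>)) \<in> range (\<lambda>i. \<bar>u $ i\<bar>)" by (rule Max_in)
  then obtain i where "Max (range (\<lambda>i. \<bar>u $ i\<bar>)) = \<bar>u $ i\<bar>" by (rule rangeE)
  moreover have "\<bar>u $ j\<bar> \<le> Max (range (\<lambda>i. \<bar>u $ i\<bar>))" for j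
    by (rule Max_ge) auto
  ultimately have i: "\<bar>u $ j\<bar> \<le> \<bar>u $ i\<bar>" for j by simp
  obtain t :: int where t: "u $ i = of_int t" using assms(1) by (auto simp: integer_vectors_def Ints_def)
  obtain j where "u $ j \<noteq> 0" using assms(2) by (auto simp: vec_eq_iff)
  then have ui: "u $ i \<noteq> 0" using i[of j] by auto
  define e where "e = axis i (if u $ i > 0 then 1 else (-1::real))"
  have "u \<bullet> e = \<bar>u $ i\<bar>" by (simp add: e_def inner_axis)
  then have "u \<bullet> e = real (nat \<bar>t\<bar>)" by (simp add: t)
  moreover have "e \<in> directions" by (auto simp: e_def directions_def)
  moreover have "nat \<bar>t\<bar> \<ge> 1" using ui t by auto
  moreover have "\<bar>u $ j\<bar> \<le> real (nat \<bar>t\<bar>)" for j using i[of j] t by simp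
  ultimately show ?thesis using that by blast
qed

text \<open>The coordinate along \<open>e\<close> is pinned by \<open>k\<close>, so only
  \<open>CARD('d) - 1\<close> coordinates are free, each with \<open>2 * k + 1 \<le> 3 * k\<close>
  values.\<close>

lemma card_normals_le:
  fixes e :: "real ^ 'd"
  assumes e: "e \<in> directions" and k: "k \<ge> 1"
  shows "finite {u \<in> integer_vectors. u \<bullet> e = real k \<and> (\<forall>j. \<bar>u $ j\<bar> \<le> real k)}" (is "finite ?A")
    and "real (card {u \<in> integer_vectors. u \<bullet> e = real k \<and> (\<forall>j. \<bar>u $ j\<bar> \<le> real k)})
      \<le> 3 ^ (CARD('d) - 1) * real k ^ (CARD('d) - 1)"
proof -
  obtain i \<sigma> where \<sigma>: "e = axis i \<sigma>" "\<sigma> \<in> {1, -1 :: real}" using e by (auto simp: directions_def)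
  define h where "h u = restrict (\<lambda>j. \<lfloor>u $ j\<rfloor>) (UNIV - {i})" for u :: "real ^ 'd"
  let ?P = "PiE (UNIV - {i}) (\<lambda>_. {- int k..int k})"
  have inj: "inj_on h ?A"
  proof (rule inj_onI)
    fix u v assume u: "u \<in> ?A" and v: "v \<in> ?A" and eq: "h u = h v"
    have "u $ j = v $ j" for j
    proof (cases "j = i")
      case True
      have "u $ i * \<sigma> = v $ i * \<sigma>" using u v \<sigma> by (simp add: inner_axis)
      then show ?thesis using \<sigma> True by auto
    next
      case False
      have "\<lfloor>u $ j\<rfloor> = \<lfloor>v $ j\<rfloor>" using fun_cong[OF eq, of j] False by (simp add: h_def)
      moreover have "u $ j \<in> \<int>" "v $ j \<in> \<int>" using u v by (auto simp: integer_vectors_def)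
      ultimately show ?thesis by (metis of_int_floor)
    qed
    then show "u = v" by (simp add: vec_eq_iff)
  qed
  have sub: "h ` ?A \<subseteq> ?P"
    unfolding h_def
  proof (intro image_subsetI restrict_PiE_iff[THEN iffD2] ballI)
    fix u j assume u: "u \<in> ?A"
    then have "\<bar>u $ j\<bar> \<le> real k" by blast
    then show "\<lfloor>u $ j\<rfloor> \<in> {- int k..int k}" by (auto simp: abs_le_iff le_floor_iff floor_le_iff)
  qed
  have finP: "finite ?P" by (intro finite_PiE) auto
  show "finite ?A" using inj_on_finite[OF inj sub finP] .
  have "card ?A \<le> card ?P" by (rule card_inj_on_le[OF inj sub finP])
  also have "\<dots> = (2 * k + 1) ^ (CARD('d) - 1)"
  proof -
    have "card {- int k..int k} = 2 * k + 1" by simp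
    then show ?thesis by (simp add: card_PiE card_Diff_singleton)
  qed
  also have "\<dots> \<le> (3 * k) ^ (CARD('d) - 1)" using k by (intro power_mono) auto
  finally have "card ?A \<le> 3 ^ (CARD('d) - 1) * k ^ (CARD('d) - 1)" by (simp only: power_mult_distrib)
  then have "real (card ?A) \<le> real (3 ^ (CARD('d) - 1) * k ^ (CARD('d) - 1))" by (rule of_nat_mono)
  then show "real (card ?A) \<le> 3 ^ (CARD('d) - 1) * real k ^ (CARD('d) - 1)" by simp
qed

lemma facet_primitive_normal:
  fixes C :: "(real ^ 'd) set"
  assumes C: "finite C" "C \<subseteq> integer_vectors" and full: "aff_dim C = int CARD('d)"
    and F: "F facet_of (convex hull C)"
  obtains u z c where "u \<in> integer_vectors" "z \<in> integer_vectors" "u \<bullet> z = 1"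
    "convex hull C \<subseteq> {x. u \<bullet> x \<le> c}" "F = convex hull C \<inter> {x. u \<bullet> x = c}"
    "F = convex hull (C \<inter> F)" "aff_dim (C \<inter> F) = int CARD('d) - 1"
proof -
  let ?P = "convex hull C"
  have face: "F face_of ?P" and dimF: "aff_dim F = int CARD('d) - 1"
    using F full by (auto simp: facet_of_def aff_dim_convex_hull)
  obtain S where S: "S \<subseteq> C" "F = convex hull S"
    using face_of_convex_hull_subset[OF finite_imp_compact[OF C(1)] face] by blast
  have hullF: "F = convex hull (C \<inter> F)"
  proof
    have "S \<subseteq> F" unfolding S(2) by (rule hull_subset)
    then have "S \<subseteq> C \<inter> F" using S(1) by blast
    then have "convex hull S \<subseteq> convex hull (C \<inter> F)" by (rule hull_mono)
    then show "F \<subseteq> convex hull (C \<inter> F)" using S(2) by simp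
    show "convex hull (C \<inter> F) \<subseteq> F"
      using face face_of_imp_convex by (intro hull_minimal) auto
  qed
  have dimCF: "aff_dim (C \<inter> F) = int CARD('d) - 1"
    using dimF hullF aff_dim_convex_hull by metis
  obtain T where T: "T \<subseteq> C \<inter> F" "\<not> affine_dependent T" "affine hull (C \<inter> F) = affine hull T"
    using affine_basis_exists by metis
  have dimT: "aff_dim T = int CARD('d) - 1" using T(3) dimCF by (metis aff_dim_affine_hull)
  then have "card T = CARD('d)" using T(2) by (simp add: affine_independent_iff_card)
  then obtain u z c where u: "u \<in> integer_vectors" "z \<in> integer_vectors" "u \<bullet> z = 1" "\<And>v. v \<in> T \<Longrightarrow> u \<bullet> v = c"
    using primitive_normal[of T] T C(2) by blast
  have u0: "u \<noteq> 0" using u(3) by auto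
  have "affine hull T = {x. u \<bullet> x = c}"
  proof (rule affine_dim_equal)
    show "affine hull T \<noteq> {}"
    proof -
      have "T \<noteq> {}" using \<open>card T = CARD('d)\<close> by (metis card.empty zero_less_card_finite less_irrefl)
      then show ?thesis by simp
    qed
    show "affine hull T \<subseteq> {x. u \<bullet> x = c}"
      using u(4) by (intro hull_minimal) (auto simp: affine_hyperplane)
    show "aff_dim (affine hull T) = aff_dim {x. u \<bullet> x = c}"
      using dimT u0 by (simp add: aff_dim_hyperplane Suc_le_eq of_nat_diff)
  qed (auto simp: affine_hyperplane)
  moreover have "affine hull F = affine hull T"
    using hullF T(3) by (metis affine_hull_convex_hull)
  ultimately have FH: "F = ?P \<inter> {x. u \<bullet> x = c}"
    using face_of_imp_eq_affine_Int[OF convex_convex_hull face] by auto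
  \<comment> \<open>A segment between points strictly on both sides would meet \<open>F\<close> in
    its interior, and the face property would place its ends in \<open>F\<close>.\<close>
  have side: "?P \<subseteq> {x. u \<bullet> x \<le> c} \<or> ?P \<subseteq> {x. c \<le> u \<bullet> x}"
  proof (rule ccontr)
    assume "\<not> ?thesis"
    then obtain p q where "p \<in> ?P" "\<not> u \<bullet> p \<le> c" "q \<in> ?P" "\<not> c \<le> u \<bullet> q" by blast
    then have pq: "p \<in> ?P" "u \<bullet> p > c" "q \<in> ?P" "u \<bullet> q < c" by auto
    define t where "t = (u \<bullet> p - c) / (u \<bullet> p - u \<bullet> q)"
    have t: "0 < t" "t < 1" using pq by (auto simp: t_def divide_simps)
    define x where "x = (1 - t) *\<^sub>R p + t *\<^sub>R q"
    have "x \<in> ?P" unfolding x_def using pq t by (intro convexD_alt[OF convex_convex_hull]) auto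
    moreover have "u \<bullet> x = c"
    proof -
      have "t * (u \<bullet> p - u \<bullet> q) = u \<bullet> p - c" using pq by (simp add: t_def)
      then show ?thesis by (simp add: x_def inner_add_right algebra_simps)
    qed
    ultimately have "x \<in> F" using FH by blast
    moreover have "x \<in> open_segment p q" using t pq by (auto simp: in_segment x_def)
    ultimately have "p \<in> F" using face_ofD[OF face] pq by blast
    then show False using FH pq by auto
  qed
  then show ?thesis
  proof
    assume "?P \<subseteq> {x. u \<bullet> x \<le> c}"
    then show ?thesis using that[of u z c] u FH hullF dimCF by blast
  next
    assume "?P \<subseteq> {x. c \<le> u \<bullet> x}"
    then have "?P \<subseteq> {x. - u \<bullet> x \<le> - c}" by auto
    moreover have "F = ?P \<inter> {x. - u \<bullet> x = - c}" using FH by auto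
    ultimately show ?thesis
      using that[of "- u" "- z" "- c"] u hullF dimCF by (simp add: integer_vectors_closed)
  qed
qed

text \<open>Prisms over two facets in the same direction overlap in a null set, as both facets lie on the
  boundary facing that direction.\<close>

lemma negligible_prism_Int:
  fixes u u' e :: "real ^ 'd"
  assumes P: "P \<subseteq> {x. u \<bullet> x \<le> c}" "P \<subseteq> {x. u' \<bullet> x \<le> c'}"
    and F: "F = P \<inter> {x. u \<bullet> x = c}" "F' = P \<inter> {x. u' \<bullet> x = c'}"
    and e: "u \<bullet> e > 0" "u' \<bullet> e > 0" and np: "(u' \<bullet> e) *\<^sub>R u \<noteq> (u \<bullet> e) *\<^sub>R u'"
  shows "negligible (prism F e \<inter> prism F' e)"
proof -
  let ?v = "(u' \<bullet> e) *\<^sub>R u - (u \<bullet> e) *\<^sub>R u'"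
  have "prism F e \<inter> prism F' e \<subseteq> {y. ?v \<bullet> y = (u' \<bullet> e) * c - (u \<bullet> e) * c'}"
  proof
    fix y assume "y \<in> prism F e \<inter> prism F' e"
    then have "y \<in> prism F e" "y \<in> prism F' e" by auto
    then obtain x s x' s' where y: "y = x + s *\<^sub>R e" "x \<in> F" "y = x' + s' *\<^sub>R e" "x' \<in> F'"
      unfolding prism_def by blast
    have "u \<bullet> x = c" "u \<bullet> x' \<le> c" "u' \<bullet> x' = c'" "u' \<bullet> x \<le> c'" using y F P by auto
    moreover have "u \<bullet> x + s * (u \<bullet> e) = u \<bullet> x' + s' * (u \<bullet> e)"
      using arg_cong[OF trans[OF y(1)[symmetric] y(3)], of "\<lambda>v. u \<bullet> v"] by (simp add: inner_add_right)
    moreover have "u' \<bullet> x + s * (u' \<bullet> e) = u' \<bullet> x' + s' * (u' \<bullet> e)"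
      using arg_cong[OF trans[OF y(1)[symmetric] y(3)], of "\<lambda>v. u' \<bullet> v"] by (simp add: inner_add_right)
    ultimately have "s * (u \<bullet> e) \<le> s' * (u \<bullet> e)" "s' * (u' \<bullet> e) \<le> s * (u' \<bullet> e)" by linarith+
    then have "s = s'" using e by simp
    then have "x = x'" using y by simp
    have "u \<bullet> y = c + s * (u \<bullet> e)" "u' \<bullet> y = c' + s * (u' \<bullet> e)"
      using \<open>u \<bullet> x = c\<close> \<open>u' \<bullet> x' = c'\<close> \<open>x = x'\<close> y(1) by (simp_all add: inner_add_right)
    then show "y \<in> {y. ?v \<bullet> y = (u' \<bullet> e) * c - (u \<bullet> e) * c'}"
      by (simp add: inner_diff_left algebra_simps)
  qed
  moreover have "negligible {y. ?v \<bullet> y = (u' \<bullet> e) * c - (u \<bullet> e) * c'}"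
    using np by (intro negligible_hyperplane) simp
  ultimately show ?thesis using negligible_subset by blast
qed

text \<open>The edge has length \<open>n\<close> so that prisms with null overlaps share a box of
  volume O(n^d); dividing by \<open>n\<close> turns this into the bound O(n^(d - 1)) for the sum of
  the projected areas.\<close>

lemma prism_grid_subset:
  fixes e :: "real ^ 'd"
  assumes C: "C \<subseteq> grid n" and e: "e \<in> directions"
  shows "prism (convex hull C) (real n *\<^sub>R e) \<subseteq> cbox (- real n *\<^sub>R 1) (2 * real n *\<^sub>R 1)"
proof
  fix y assume "y \<in> prism (convex hull C) (real n *\<^sub>R e)"
  then obtain x s where x: "x \<in> convex hull C" and s: "0 \<le> s" "s \<le> 1" and y: "y = x + s *\<^sub>R (real n *\<^sub>R e)"
    by (auto simp: prism_def)
  have "C \<subseteq> cbox 0 (real n *\<^sub>R 1)"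
  proof
    fix x assume "x \<in> C"
    then have x: "x \<in> grid n" using C by blast
    have "0 \<le> x $ i \<and> x $ i \<le> real n" for i
      using grid_coord(1)[OF x, of i] grid_coord(3)[OF x, of i] by linarith
    then show "x \<in> cbox 0 (real n *\<^sub>R 1)" by (simp add: mem_box_cart)
  qed
  then have "convex hull C \<subseteq> cbox 0 (real n *\<^sub>R 1)" by (intro hull_minimal convex_box) auto
  then have x': "0 \<le> x $ i" "x $ i \<le> real n" for i using x by (auto simp: mem_box_cart)
  have "\<bar>e $ i\<bar> \<le> 1" for i using e by (auto simp: directions_def axis_def)
  then have ab: "\<bar>s * (real n * e $ i)\<bar> \<le> 1 * (real n * 1)" for i
    unfolding abs_mult using s by (intro mult_mono) auto
  have es: "- real n \<le> s * (real n * e $ i)" "s * (real n * e $ i) \<le> real n" for i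
    using ab[of i] by linarith+
  have "- real n \<le> y $ i \<and> y $ i \<le> 2 * real n" for i
    using x'[of i] es[of i] by (simp add: y)
  then show "y \<in> cbox (- real n *\<^sub>R 1) (2 * real n *\<^sub>R 1)"
    unfolding mem_box_cart by (simp add: mult.commute)
qed

lemma measure_grid_box: "measure lebesgue (cbox (- real n *\<^sub>R 1) (2 * real n *\<^sub>R 1) :: (real ^ 'd) set) = 3 ^ CARD('d) * real n ^ CARD('d)"
proof -
  have "cbox (- real n *\<^sub>R 1) (2 * real n *\<^sub>R 1) \<noteq> ({} :: (real ^ 'd) set)" by (simp add: interval_ne_empty_cart)
  then have "measure lebesgue (cbox (- real n *\<^sub>R 1) (2 * real n *\<^sub>R 1) :: (real ^ 'd) set) = (3 * real n) ^ CARD('d)"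
    by (simp add: measure_completion content_cbox_cart)
  then show ?thesis by (simp add: power_mult_distrib)
qed

text \<open>Pairing the equation with each Bezout witness shows that \<open>k\<close> and
  \<open>k'\<close> divide each other.\<close>

lemma primitive_parallel_eq:
  fixes u u' :: "real ^ 'd" and k k' :: nat
  assumes u: "u \<in> integer_vectors" "z \<in> integer_vectors" "u \<bullet> z = 1"
    and u': "u' \<in> integer_vectors" "z' \<in> integer_vectors" "u' \<bullet> z' = 1"
    and par: "real k' *\<^sub>R u = real k *\<^sub>R u'" and pos: "k' \<ge> 1" "k \<ge> 1"
  shows "u = u'"
proof -
  have le: "j \<le> i" if "real i = real j * t" "t \<in> \<int>" "i \<ge> 1" for i j :: nat and t :: real
  proof -
    have "t > 0"
    proof (rule ccontr)
      assume "\<not> ?thesis"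
      then have "real j * t \<le> 0" by (intro mult_nonneg_nonpos) auto
      then show False using that by simp
    qed
    then have "1 \<le> t" using that(2) Ints_nonzero_abs_ge1[of t] by simp
    then have "real j * 1 \<le> real j * t" by (intro mult_left_mono) auto
    then show ?thesis using that(1) by simp
  qed
  have "real k' = real k * (u' \<bullet> z)"
    using arg_cong[OF par, of "\<lambda>v. v \<bullet> z"] u(3) by simp
  then have "k \<le> k'" using le inner_integer_vectors[OF u'(1) u(2)] pos by blast
  moreover have "real k = real k' * (u \<bullet> z')"
    using arg_cong[OF par, of "\<lambda>v. v \<bullet> z'"] u'(3) by simp
  then have "k' \<le> k" using le inner_integer_vectors[OF u(1) u'(2)] pos by blast
  ultimately show ?thesis using par pos by simp
qed

subsection \<open>Convex independent sets\<close>

lemma strictly_exposedI_convex_independent: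
  fixes \<tau> :: "'b \<Rightarrow> real ^ 'd"
  assumes inj: "inj_on \<tau> C" and fin: "finite C" and ci: "convex_independent (\<tau> ` C)"
  shows "strictly_exposed \<tau> C"
  unfolding strictly_exposed_def
proof
  fix x assume x: "x \<in> C"
  obtain P where P: "polytope P" "\<tau> ` C = {v. v extreme_point_of P}"
    using ci unfolding convex_independent_def by blast
  have "\<tau> x extreme_point_of P" using P x by blast
  then have "convex (P - {\<tau> x})"
    using extreme_point_of_stillconvex[OF polytope_imp_convex[OF P(1)]] by blast
  moreover have "\<tau> ` (C - {x}) \<subseteq> P - {\<tau> x}"
    using P(2) inj x by (auto simp: extreme_point_of_def inj_on_def)
  ultimately have "convex hull (\<tau> ` (C - {x})) \<subseteq> P - {\<tau> x}" by (intro hull_minimal)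
  then have notin: "\<tau> x \<notin> convex hull (\<tau> ` (C - {x}))" by blast
  show "\<exists>\<nu>. norm \<nu> = 1 \<and> (\<forall>y\<in>C. y \<noteq> x \<longrightarrow> \<nu> \<bullet> \<tau> y < \<nu> \<bullet> \<tau> x)"
  proof (cases "C - {x} = {}")
    \<comment> \<open>With nothing to separate from, any unit vector will do.\<close>
    case True
    show ?thesis
    proof (intro exI[of _ "axis undefined 1"] conjI ballI impI)
      show "norm (axis undefined 1 :: real ^ 'd) = 1" by (rule norm_axis_1)
    qed (use True in blast)
  next
    case False
    then obtain y0 where y0: "y0 \<in> C - {x}" by blast
    have "compact (convex hull (\<tau> ` (C - {x})))"
      using fin by (intro compact_convex_hull finite_imp_compact) auto
    then obtain a b where ab: "a \<bullet> \<tau> x < b" "\<And>v. v \<in> convex hull (\<tau> ` (C - {x})) \<Longrightarrow> a \<bullet> v > b"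
      using separating_hyperplane_closed_point[OF convex_convex_hull compact_imp_closed notin] by blast
    have lt: "a \<bullet> \<tau> x < a \<bullet> \<tau> y" if "y \<in> C - {x}" for y
    proof -
      have "\<tau> y \<in> convex hull (\<tau> ` (C - {x}))" using that by (intro hull_inc) auto
      then show ?thesis using ab by force
    qed
    have "a \<noteq> 0" using lt[OF y0] by auto
    then have n: "norm a > 0" by simp
    show ?thesis
    proof (intro exI[of _ "- a /\<^sub>R norm a"] conjI ballI impI)
      show "norm (- a /\<^sub>R norm a) = 1" using n by simp
      fix y assume "y \<in> C" "y \<noteq> x"
      then have "a \<bullet> \<tau> x < a \<bullet> \<tau> y" using lt by blast
      then have "inverse (norm a) * (a \<bullet> \<tau> x) < inverse (norm a) * (a \<bullet> \<tau> y)"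
        using n by (intro mult_strict_left_mono) auto
      then show "(- a /\<^sub>R norm a) \<bullet> \<tau> y < (- a /\<^sub>R norm a) \<bullet> \<tau> x" by simp
    qed
  qed
qed

text \<open>An interior point of the hull has uniformly much room around it, so a smaller perturbation
  cannot make it exposed.\<close>

lemma exposed_avoids_interior:
  fixes G :: "(real ^ 'd) set"
  assumes "finite G"
  obtains \<rho> where "\<rho> > 0"
    "\<And>C \<tau>. C \<subseteq> G \<Longrightarrow> (\<And>x. x \<in> G \<Longrightarrow> norm (\<tau> x - x) \<le> \<rho>) \<Longrightarrow> strictly_exposed \<tau> C \<Longrightarrow>
       C \<inter> interior (convex hull C) = {}"
proof -
  define Q where "Q = {(C, x). C \<subseteq> G \<and> x \<in> C \<and> x \<in> interior (convex hull C)}"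
  have "Q \<subseteq> Pow G \<times> G" by (auto simp: Q_def)
  then have finQ: "finite Q" using assms finite_subset by blast
  have "\<exists>r>0. ball (snd q) r \<subseteq> convex hull (fst q)" if "q \<in> Q" for q
    using that unfolding Q_def mem_interior by auto
  then obtain r where r: "\<And>q. q \<in> Q \<Longrightarrow> r q > 0 \<and> ball (snd q) (r q) \<subseteq> convex hull (fst q)"
    by metis
  \<comment> \<open>There are finitely many pairs of a subset and an interior point of it, so one
    radius serves them all; the 1 covers the case that there are none.\<close>
  define r0 where "r0 = Min (insert 1 (r ` Q))"
  have r0: "r0 > 0" "\<And>q. q \<in> Q \<Longrightarrow> r0 \<le> r q"
    unfolding r0_def using finQ r by (auto intro: Min_le)
  have False if C: "C \<subseteq> G" and \<tau>: "\<And>x. x \<in> G \<Longrightarrow> norm (\<tau> x - x) \<le> r0 / 4"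
    and ex: "strictly_exposed \<tau> C" and x: "x \<in> C" "x \<in> interior (convex hull C)" for C \<tau> x
  proof -
    have Cx: "(C, x) \<in> Q" using C x by (simp add: Q_def)
    have "ball x r0 \<subseteq> ball x (r (C, x))" using r0(2)[OF Cx] by (rule subset_ball)
    also have "\<dots> \<subseteq> convex hull C" using r[OF Cx] by simp
    finally have "ball x r0 \<subseteq> convex hull C" .
    obtain \<nu> where \<nu>: "norm \<nu> = 1" "\<And>y. y \<in> C \<Longrightarrow> y \<noteq> x \<Longrightarrow> \<nu> \<bullet> \<tau> y < \<nu> \<bullet> \<tau> x"
      using ex x unfolding strictly_exposed_def by blast
    have \<nu>\<nu>: "\<nu> \<bullet> \<nu> = 1" using \<nu>(1) by (simp add: norm_eq_1)
    \<comment> \<open>As \<open>?p\<close> is in the hull, some \<open>y\<close> of \<open>C\<close>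
      is ahead of \<open>x\<close> by at least \<open>r0 / 2\<close> in direction
      \<open>\<nu>\<close>, and the displacements of \<open>x\<close> and \<open>y\<close>, at most
      \<open>r0 / 4\<close> each, cannot reverse this.\<close>
    let ?p = "x + (r0 / 2) *\<^sub>R \<nu>"
    have "?p \<in> ball x r0" using r0(1) \<nu>(1) by (simp add: dist_norm)
    then have p: "?p \<in> convex hull C" using \<open>ball x r0 \<subseteq> convex hull C\<close> by blast
    have "\<exists>y\<in>C. \<nu> \<bullet> y \<ge> \<nu> \<bullet> x + r0 / 2"
    proof (rule ccontr)
      assume "\<not> ?thesis"
      then have "C \<subseteq> {v. \<nu> \<bullet> v < \<nu> \<bullet> x + r0 / 2}" by (auto simp: not_le)
      then have "convex hull C \<subseteq> {v. \<nu> \<bullet> v < \<nu> \<bullet> x + r0 / 2}"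
        by (intro hull_minimal) (simp_all add: convex_halfspace_lt)
      then have "\<nu> \<bullet> ?p < \<nu> \<bullet> x + r0 / 2" using p by blast
      then show False by (simp add: inner_add_right \<nu>\<nu>)
    qed
    then obtain y where y: "y \<in> C" "\<nu> \<bullet> y \<ge> \<nu> \<bullet> x + r0 / 2" by blast
    then have "y \<noteq> x" using r0(1) by auto
    have "\<bar>\<nu> \<bullet> (\<tau> y - y)\<bar> \<le> r0 / 4" "\<bar>\<nu> \<bullet> (\<tau> x - x)\<bar> \<le> r0 / 4"
      using Cauchy_Schwarz_ineq2[of \<nu> "\<tau> y - y"] Cauchy_Schwarz_ineq2[of \<nu> "\<tau> x - x"]
        \<tau>[of y] \<tau>[of x] x y C \<nu>(1) by auto
    then have "\<nu> \<bullet> \<tau> x \<le> \<nu> \<bullet> \<tau> y" using y(2) unfolding inner_diff_right by linarith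
    then show False using \<nu>(2)[OF y(1) \<open>y \<noteq> x\<close>] by linarith
  qed
  note no_interior = this
  show ?thesis
  proof (rule that[of "r0 / 4"])
    show "C \<inter> interior (convex hull C) = {}"
      if "C \<subseteq> G" "\<And>x. x \<in> G \<Longrightarrow> norm (\<tau> x - x) \<le> r0 / 4" "strictly_exposed \<tau> C" for C \<tau>
      using no_interior[OF that] by blast
  qed (use r0(1) in simp)
qed

section \<open>Degenerate and full-dimensional sets\<close>

lemma affine_hull_grid:
  assumes "n \<ge> 2"
  shows "affine hull (grid n :: (real ^ 'd) set) = UNIV"
proof (rule ccontr)
  assume "affine hull (grid n :: (real ^ 'd) set) \<noteq> UNIV"
  then have "aff_dim (grid n :: (real ^ 'd) set) < DIM(real ^ 'd)"
    using aff_dim_eq_full[of "grid n :: (real ^ 'd) set"] aff_dim_le_DIM[of "grid n :: (real ^ 'd) set"] by linarith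
  then obtain a b where ab: "a \<noteq> 0" "(grid n :: (real ^ 'd) set) \<subseteq> {x. a \<bullet> x = b}"
    using aff_lowdim_subset_hyperplane by blast
  have one: "1 \<in> real ` {1..n}" using assms by (intro image_eqI[of _ _ 1]) auto
  have two: "2 \<in> real ` {1..n}" using assms by (intro image_eqI[of _ _ 2]) auto
  have "a $ i = 0" for i
  proof -
    have "1 \<in> (grid n :: (real ^ 'd) set)" using one by (simp add: grid_def)
    moreover have "1 + axis i 1 \<in> (grid n :: (real ^ 'd) set)"
      unfolding grid_def
    proof safe
      fix j show "(1 + axis i 1 :: real ^ 'd) $ j \<in> real ` {1..n}"
        using one two by (cases "j = i") (simp_all add: axis_def)
    qed
    ultimately have "a \<bullet> 1 = b" "a \<bullet> (1 + axis i 1) = b" using ab(2) by blast+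
    then show ?thesis by (simp add: inner_add_right inner_axis)
  qed
  then show False using ab(1) by (simp add: vec_eq_iff)
qed

text \<open>The sets \<open>S\<close> and \<open>C\<close> are kept apart because a degenerate
  \<open>C\<close> need not span the hyperplane over which the prism stands.\<close>

lemma planar_weight_le:
  fixes C S :: "(real ^ 'd) set"
  assumes S: "S \<subseteq> grid n" "aff_dim S = int CARD('d) - 1" "\<And>x. x \<in> S \<Longrightarrow> u \<bullet> x = c"
    and u: "u \<in> integer_vectors" "z \<in> integer_vectors" "u \<bullet> z = 1"
    and e: "e \<in> directions" "u \<bullet> e = real k" "k \<ge> 1" and n: "n \<ge> 1"
    and C: "C \<subseteq> S" "line_sparse K C" "K > 0" "card C \<ge> 2"
  shows "real (card C) powr (1 + 2 / (2 * real CARD('d) - 1)) * (real k * real n) \<le>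
    2 * K * (2 * real CARD('d)) ^ CARD('d) * measure lebesgue (prism (convex hull S) (real n *\<^sub>R e))"
proof -
  interpret lattice_facet S u z "real n *\<^sub>R e" c "k * n"
  proof
    show "finite S" using S(1) finite_grid finite_subset by blast
    show "S \<subseteq> integer_vectors" using S(1) grid_subset_integer_vectors by blast
    show "real n *\<^sub>R e \<in> integer_vectors" using e(1) directions_integer by (intro integer_vectors_closed) auto
    show "u \<bullet> (real n *\<^sub>R e) = real (k * n)" using e(2) by simp
    show "1 \<le> k * n" using e(3) n by simp
  qed (use S u in auto)
  show ?thesis using sparse_card_le_prism[OF C] by simp
qed

text \<open>A set inside a hyperplane is treated as one facet, enlarged by grid points until it
  spans a hyperplane. A single prism in the box gives the exponent (d - 1)(2d - 1)/(2d + 1), which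
  is at most d(d - 1)/(d + 1).\<close>

lemma card_degenerate_le:
  fixes C :: "(real ^ 'd) set"
  assumes n: "n \<ge> 2" and C: "C \<subseteq> grid n" "aff_dim C < int CARD('d)" "line_sparse K C" and K: "K > 0"
    and B: "B \<ge> 1" "2 * K * (2 * real CARD('d)) ^ CARD('d) * 3 ^ CARD('d) \<le> B"
  shows "real (card C) \<le> B * real n powr (real CARD('d) * (real CARD('d) - 1) / (real CARD('d) + 1))"
proof -
  let ?d = "real CARD('d)"
  let ?p = "1 + 2 / (2 * ?d - 1)"
  have d1: "?d \<ge> 1" by (simp add: Suc_le_eq)
  define X where "X = B * real n ^ (CARD('d) - 1)"
  have X1: "X \<ge> 1"
  proof -
    have "1 * 1 \<le> X" unfolding X_def using B n by (intro mult_mono one_le_power) auto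
    then show ?thesis by simp
  qed
  have "real (card C) powr ?p \<le> X"
  proof (cases "card C \<ge> 2")
    case False
    then have "card C = 0 \<or> card C = 1" by linarith
    then show ?thesis using X1 d1 by auto
  next
    case True
    obtain T where T: "\<not> affine_dependent T" "T \<subseteq> C" "affine hull C = affine hull T"
      using affine_basis_exists by metis
    obtain T' where T': "\<not> affine_dependent T'" "T \<subseteq> T'" "T' \<subseteq> grid n" "affine hull T' = affine hull grid n"
      using extend_to_affine_basis[of T "grid n"] T C(1) by blast
    have finT': "finite T'" using T'(1) aff_independent_finite by blast
    have "aff_dim T' = int CARD('d)"
      using T'(4) affine_hull_grid[OF n, where 'd = 'd] aff_dim_affine_hull[of T'] by simp
    then have cT': "card T' = CARD('d) + 1" using T'(1) by (simp add: affine_independent_iff_card)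
    have "T \<noteq> T'"
    proof
      assume "T = T'"
      then have "aff_dim C = aff_dim T'" using T(3) by (metis aff_dim_affine_hull)
      then show False using C(2) \<open>aff_dim T' = int CARD('d)\<close> by simp
    qed
    \<comment> \<open>Removing from an affine basis of the whole space one point outside the basis
      \<open>T\<close> of \<open>C\<close> leaves grid points that span a hyperplane containing
      \<open>C\<close>.\<close>
    then obtain v where v: "v \<in> T'" "v \<notin> T" using T'(2) by blast
    define S0 where "S0 = T' - {v}"
    have S0: "\<not> affine_dependent S0" "card S0 = CARD('d)" "T \<subseteq> S0" "S0 \<subseteq> grid n"
      using T' v cT' finT' affine_independent_subset[of T' S0] by (auto simp: S0_def)
    define S where "S = S0 \<union> C"
    have CS0: "S \<subseteq> affine hull S0"
    proof -
      have "C \<subseteq> affine hull T" using T(3) hull_subset by metis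
      also have "\<dots> \<subseteq> affine hull S0" using S0(3) by (rule hull_mono)
      finally show ?thesis unfolding S_def using hull_subset[of S0 affine] by blast
    qed
    have "aff_dim S = int CARD('d) - 1"
    proof -
      have "aff_dim S0 = int CARD('d) - 1" using S0 by (simp add: affine_independent_iff_card)
      moreover have "aff_dim S0 \<le> aff_dim S" by (rule aff_dim_subset) (simp add: S_def)
      moreover have "aff_dim S \<le> aff_dim S0" using aff_dim_subset[OF CS0] by simp
      ultimately show ?thesis by linarith
    qed
    moreover have "S0 \<subseteq> integer_vectors" using S0(4) grid_subset_integer_vectors by blast
    then obtain u z c where u: "u \<in> integer_vectors" "z \<in> integer_vectors" "u \<bullet> z = 1" "\<And>v. v \<in> S0 \<Longrightarrow> u \<bullet> v = c"
      using primitive_normal[OF _ S0(1,2)] by metis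
    have "affine hull S0 \<subseteq> {x. u \<bullet> x = c}"
      using u(4) by (intro hull_minimal) (auto simp: affine_hyperplane)
    then have "u \<bullet> x = c" if "x \<in> S" for x using CS0 that by blast
    moreover have "u \<noteq> 0" using u(3) by auto
    then obtain e k where e: "e \<in> directions" "u \<bullet> e = real k" "k \<ge> 1"
      using dominant_direction[OF u(1)] by metis
    moreover have Sg: "S \<subseteq> grid n" using S0(4) C(1) by (simp add: S_def)
    ultimately have "real (card C) powr ?p * (real k * real n) \<le>
        2 * K * (2 * ?d) ^ CARD('d) * measure lebesgue (prism (convex hull S) (real n *\<^sub>R e))"
      using u True n C(3) K by (intro planar_weight_le[of S n u c z]) (auto simp: S_def)
    also have "\<dots> \<le> 2 * K * (2 * ?d) ^ CARD('d) * (3 ^ CARD('d) * real n ^ CARD('d))"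
    proof (intro mult_left_mono)
      have "finite S" using Sg finite_grid finite_subset by blast
      then show "measure lebesgue (prism (convex hull S) (real n *\<^sub>R e)) \<le> 3 ^ CARD('d) * real n ^ CARD('d)"
        unfolding measure_grid_box[symmetric]
      proof (intro measure_mono_fmeasurable prism_grid_subset[OF Sg e(1)] fmeasurableD)
        show "prism (convex hull S) (real n *\<^sub>R e) \<in> lmeasurable"
          using \<open>finite S\<close> by (intro lmeasurable_compact compact_prism compact_convex_hull finite_imp_compact)
      qed simp
    qed (use K in auto)
    also have "\<dots> = (2 * K * (2 * ?d) ^ CARD('d) * 3 ^ CARD('d)) * real n ^ CARD('d)" by simp
    also have "\<dots> \<le> B * real n ^ CARD('d)" using B by (intro mult_right_mono) auto
    also have "\<dots> = X * real n" using power_minus_mult[of "CARD('d)" "real n"] by (simp add: X_def)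
    finally have "(real (card C) powr ?p * real k) * real n \<le> X * real n" by (simp add: mult.assoc)
    then have "real (card C) powr ?p * real k \<le> X" using n by simp
    moreover have "real (card C) powr ?p * 1 \<le> real (card C) powr ?p * real k" using e(3) by (intro mult_left_mono) auto
    ultimately show ?thesis by simp
  qed
  have exponent: "1 + 2 / (2 * x - 1) > 0" "1 / (1 + 2 / (2 * x - 1)) \<le> x / (x + 1)" if "x \<ge> 1" for x :: real
  proof -
    have eq: "1 + 2 / (2 * x - 1) = (2 * x + 1) / (2 * x - 1)" using that by (simp add: field_simps)
    show "1 + 2 / (2 * x - 1) > 0" unfolding eq using that by simp
    have "(2 * x - 1) * (x + 1) \<le> x * (2 * x + 1)" by (simp add: algebra_simps)
    then show "1 / (1 + 2 / (2 * x - 1)) \<le> x / (x + 1)" unfolding eq using that by (simp add: frac_le_eq divide_simps)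
  qed
  note p = exponent[OF d1]
  have "real (card C) = (real (card C) powr ?p) powr (1 / ?p)"
    using p(1) by (simp add: powr_powr)
  also have "\<dots> \<le> X powr (1 / ?p)"
    using \<open>real (card C) powr ?p \<le> X\<close> p(1) by (intro powr_mono2) auto
  also have "\<dots> \<le> X powr (?d / (?d + 1))"
  proof (rule powr_mono)
    show "1 / ?p \<le> ?d / (?d + 1)" by (rule p(2))
  qed (rule X1)
  also have "\<dots> = B powr (?d / (?d + 1)) * (real n powr (?d - 1)) powr (?d / (?d + 1))"
  proof -
    have "real n ^ (CARD('d) - 1) = real n powr (?d - 1)"
    proof -
      have "real n powr real (CARD('d) - 1) = real n ^ (CARD('d) - 1)" using n by (intro powr_realpow) auto
      then show ?thesis by (simp add: of_nat_diff Suc_le_eq)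
    qed
    then show ?thesis unfolding X_def by (simp only: powr_mult)
  qed
  also have "\<dots> \<le> B powr 1 * (real n powr (?d - 1)) powr (?d / (?d + 1))"
    using B d1 by (intro mult_right_mono powr_mono) auto
  also have "(real n powr (?d - 1)) powr (?d / (?d + 1)) = real n powr (?d * (?d - 1) / (?d + 1))"
    by (simp add: powr_powr mult.commute)
  finally show ?thesis using B by simp
qed

text \<open>The facets are grouped by the dominant direction of their normals, since only prisms
  with a common edge have null overlaps; this accounts for the factor
  \<open>2 * real CARD('d)\<close>.\<close>

lemma card_full_le:
  fixes C :: "(real ^ 'd) set"
  assumes d: "CARD('d) \<ge> 2" and n: "n \<ge> 1" and C: "C \<subseteq> grid n" "aff_dim C = int CARD('d)"
    and boundary: "C \<inter> interior (convex hull C) = {}"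
    and sparse: "\<And>X. X \<subseteq> C \<Longrightarrow> line_sparse K X" and K: "K > 0"
    and B: "2 * K * (2 * real CARD('d)) ^ CARD('d) * 3 ^ CARD('d) \<le> B"
  shows "real (card C) \<le> 2 * real CARD('d) * (2 * 3 ^ (CARD('d) - 1) + B) *
    real n powr (real CARD('d) * (real CARD('d) - 1) / (real CARD('d) + 1))"
proof -
  let ?d = "real CARD('d)"
  let ?P = "convex hull C"
  let ?\<F> = "{F. F facet_of ?P}"
  have finC: "finite C" using C(1) finite_grid finite_subset by blast
  have Cint: "C \<subseteq> integer_vectors" using C(1) grid_subset_integer_vectors by blast
  have poly: "polytope ?P" using finC by (simp add: polytope_convex_hull)
  have fin\<F>: "finite ?\<F>" using poly by (rule finite_polytope_facets)
  have "C \<subseteq> \<Union> ?\<F>"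
  proof -
    have "affine hull ?P = UNIV"
      using C(2) aff_dim_eq_full[of C] by (simp add: affine_hull_convex_hull)
    then have "rel_interior ?P = interior ?P" by (rule rel_interior_interior)
    then have "C \<inter> rel_interior ?P = {}" using boundary by simp
    moreover have "C \<subseteq> closure ?P" using hull_subset[of C convex] closure_subset by blast
    ultimately have "C \<subseteq> rel_frontier ?P" by (auto simp: rel_frontier_def)
    then show ?thesis using rel_frontier_of_polyhedron[OF polytope_imp_polyhedron[OF poly]] by simp
  qed
  define Q where "Q F q \<longleftrightarrow> (case q of (u, z, c, e, k) \<Rightarrow> u \<in> integer_vectors \<and> z \<in> integer_vectors \<and> u \<bullet> z = 1 \<and>
      ?P \<subseteq> {x. u \<bullet> x \<le> c} \<and> F = ?P \<inter> {x. u \<bullet> x = c} \<and> F = convex hull (C \<inter> F) \<and>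
      aff_dim (C \<inter> F) = int CARD('d) - 1 \<and> e \<in> directions \<and> u \<bullet> e = real k \<and> k \<ge> (1::nat) \<and> (\<forall>j. \<bar>u $ j\<bar> \<le> real k))"
    for F q
  have "\<exists>q. Q F q" if F: "F \<in> ?\<F>" for F
  proof -
    have "F facet_of ?P" using F by simp
    then obtain u z c where u: "u \<in> integer_vectors" "z \<in> integer_vectors" "u \<bullet> z = 1"
      "?P \<subseteq> {x. u \<bullet> x \<le> c}" "F = ?P \<inter> {x. u \<bullet> x = c}" "F = convex hull (C \<inter> F)"
      "aff_dim (C \<inter> F) = int CARD('d) - 1"
      by (rule facet_primitive_normal[OF finC Cint C(2)])
    have "u \<noteq> 0" using u(3) by auto
    then obtain e k where "e \<in> directions" "u \<bullet> e = real k" "k \<ge> 1" "\<And>j. \<bar>u $ j\<bar> \<le> real k"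
      using dominant_direction[OF u(1)] by metis
    then have "Q F (u, z, c, e, k)" unfolding Q_def prod.case by (intro conjI allI u)
    then show ?thesis by blast
  qed
  then obtain q where q: "\<And>F. F \<in> ?\<F> \<Longrightarrow> Q F (q F)" by metis
  define u where "u F = fst (q F)" for F
  define z where "z F = fst (snd (q F))" for F
  define c where "c F = fst (snd (snd (q F)))" for F
  define e where "e F = fst (snd (snd (snd (q F))))" for F
  define k where "k F = snd (snd (snd (snd (q F))))" for F
  have fct: "u F \<in> integer_vectors" "z F \<in> integer_vectors" "u F \<bullet> z F = 1"
      "?P \<subseteq> {x. u F \<bullet> x \<le> c F}" "F = ?P \<inter> {x. u F \<bullet> x = c F}" "F = convex hull (C \<inter> F)"
      "aff_dim (C \<inter> F) = int CARD('d) - 1" "e F \<in> directions" "u F \<bullet> e F = real (k F)" "k F \<ge> 1"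
      "\<And>j. \<bar>u F $ j\<bar> \<le> real (k F)" if "F \<in> ?\<F>" for F
    using q[OF that] unfolding Q_def u_def z_def c_def e_def k_def case_prod_unfold by blast+
  \<comment> \<open>Outer normals are essential: two facets with the same outer normal lie in the
    same supporting hyperplane, while opposite facets may share an unoriented one.\<close>
  have inj_u: "inj_on u ?\<F>"
  proof (rule inj_onI)
    fix F F' assume F: "F \<in> ?\<F>" "F' \<in> ?\<F>" and eq: "u F = u F'"
    have "F \<noteq> {}" "F' \<noteq> {}" using F by (auto simp: facet_of_def)
    then obtain x x' where x: "x \<in> F" "x' \<in> F'" by blast
    have "u F \<bullet> x = c F" "u F \<bullet> x' \<le> c F" "u F' \<bullet> x' = c F'" "u F' \<bullet> x \<le> c F'"
      using x fct(4,5)[OF F(1)] fct(4,5)[OF F(2)] by blast+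
    then have "c F = c F'" unfolding eq by linarith
    then show "F = F'" using fct(5)[OF F(1)] fct(5)[OF F(2)] eq by simp
  qed
  \<comment> \<open>Chosen so that \<open>?R ^ Suc CARD('d)\<close> is
    \<open>n ^ (CARD('d) - 1)\<close>, the order of the total projected area; then
    \<open>?R ^ CARD('d)\<close> is the bound of the theorem.\<close>
  let ?R = "real n powr ((?d - 1) / (?d + 1))"
  have R: "?R > 0" using n by simp
  have Rd: "?R ^ CARD('d) = real n powr (?d * (?d - 1) / (?d + 1))"
    using n by (simp add: powr_realpow[symmetric] powr_powr mult.commute)
  have RSd: "?R ^ Suc CARD('d) = real n ^ (CARD('d) - 1)"
  proof -
    have "?R ^ Suc CARD('d) = ?R powr real (Suc CARD('d))" using R by (rule powr_realpow[symmetric])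
    also have "\<dots> = real n powr ((?d - 1) / (?d + 1) * (?d + 1))" by (simp add: powr_powr add.commute)
    also have "(?d - 1) / (?d + 1) * (?d + 1) = real (CARD('d) - 1)" using d by (simp add: of_nat_diff)
    also have "real n powr real (CARD('d) - 1) = real n ^ (CARD('d) - 1)" using n by (intro powr_realpow) simp
    finally show ?thesis .
  qed
  have dir: "(\<Sum>F\<in>{F\<in>?\<F>. e F = e0}. real (card (C \<inter> F))) \<le> (2 * 3 ^ (CARD('d) - 1) + B) * ?R ^ CARD('d)"
    if e0: "e0 \<in> directions" for e0
  proof (rule sum_le_of_weighted_sum[where U = k])
    let ?I = "{F\<in>?\<F>. e F = e0}"
    show finI: "finite ?I" using fin\<F> by simp
    show "1 \<le> k F" if "F \<in> ?I" for F using fct(10) that by blast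
    show "1 \<le> CARD('d)" using d by simp
    show "?R > 0" by (rule R)
    show "real (card {F \<in> ?I. k F = m}) \<le> 3 ^ (CARD('d) - 1) * real m ^ (CARD('d) - 1)" if m: "m \<ge> 1" for m
    proof -
      have "card {F \<in> ?I. k F = m} \<le> card {v \<in> integer_vectors. v \<bullet> e0 = real m \<and> (\<forall>j. \<bar>v $ j\<bar> \<le> real m)}"
      proof (rule card_inj_on_le)
        show "inj_on u {F \<in> ?I. k F = m}" using inj_u by (rule inj_on_subset) auto
        show "u ` {F \<in> ?I. k F = m} \<subseteq> {v \<in> integer_vectors. v \<bullet> e0 = real m \<and> (\<forall>j. \<bar>v $ j\<bar> \<le> real m)}"
          using fct by fastforce
      qed (rule card_normals_le(1)[OF e0 m])
      then show ?thesis using card_normals_le(2)[OF e0 m] by linarith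
    qed
    show "(\<Sum>F\<in>?I. real (card (C \<inter> F)) powr (1 + 2 / (2 * real CARD('d) - 1)) * real (k F)) \<le> B * ?R ^ Suc CARD('d)"
    proof -
      let ?M = "2 * K * (2 * ?d) ^ CARD('d)"
      let ?pr = "\<lambda>F. prism F (real n *\<^sub>R e0)"
      have M: "?M \<ge> 0" using K by simp
      have compF: "compact F" if F: "F \<in> ?I" for F
      proof -
        have "compact (convex hull (C \<inter> F))" using finC by (intro compact_convex_hull finite_imp_compact) simp
        then show ?thesis using fct(6)[of F] F by simp
      qed
      have pr: "real (card (C \<inter> F)) powr (1 + 2 / (2 * ?d - 1)) * (real (k F) * real n) \<le> ?M * measure lebesgue (?pr F)"
        if F: "F \<in> ?I" for F
      proof -
        have F': "F \<in> ?\<F>" "e F = e0" using F by auto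
        have "card (C \<inter> F) \<ge> 2"
        proof (rule ccontr)
          assume "\<not> ?thesis"
          then have "int (card (C \<inter> F)) \<le> 1" by simp
          moreover have "aff_dim (C \<inter> F) \<le> int (card (C \<inter> F)) - 1" using finC by (intro aff_dim_le_card) simp
          ultimately show False using fct(7)[OF F'(1)] d by linarith
        qed
        then have "real (card (C \<inter> F)) powr (1 + 2 / (2 * ?d - 1)) * (real (k F) * real n) \<le>
            ?M * measure lebesgue (prism (convex hull (C \<inter> F)) (real n *\<^sub>R e0))"
          using fct[OF F'(1)] F'(2) C(1) n K sparse[of "C \<inter> F"] e0
          by (intro planar_weight_le[where S = "C \<inter> F" and u = "u F" and c = "c F" and z = "z F"]) auto
        then show ?thesis using fct(6)[OF F'(1)] by simp
      qed
      have "(\<Sum>F\<in>?I. measure lebesgue (?pr F)) = measure lebesgue (\<Union> (?pr ` ?I))"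
      proof (rule measure_negligible_finite_Union_image[symmetric, OF finI])
        show "?pr F \<in> lmeasurable" if "F \<in> ?I" for F
          using compF[OF that] by (intro lmeasurable_compact compact_prism)
        show "pairwise (\<lambda>F F'. negligible (?pr F \<inter> ?pr F')) ?I"
        proof (rule pairwiseI)
          fix F F' assume F: "F \<in> ?I" "F' \<in> ?I" "F \<noteq> F'"
          have FF: "F \<in> ?\<F>" "F' \<in> ?\<F>" "e F = e0" "e F' = e0" using F by auto
          have ue: "u F \<bullet> (real n *\<^sub>R e0) = real (k F) * real n" "u F' \<bullet> (real n *\<^sub>R e0) = real (k F') * real n"
            using fct(9)[OF FF(1)] fct(9)[OF FF(2)] FF by simp_all
          have kpos: "k F \<ge> 1" "k F' \<ge> 1" using fct(10) FF by auto
          show "negligible (?pr F \<inter> ?pr F')"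
          proof (rule negligible_prism_Int[OF fct(4)[OF FF(1)] fct(4)[OF FF(2)] fct(5)[OF FF(1)] fct(5)[OF FF(2)]])
            show "u F \<bullet> (real n *\<^sub>R e0) > 0" "u F' \<bullet> (real n *\<^sub>R e0) > 0" unfolding ue using kpos n by simp_all
            show "(u F' \<bullet> (real n *\<^sub>R e0)) *\<^sub>R u F \<noteq> (u F \<bullet> (real n *\<^sub>R e0)) *\<^sub>R u F'"
            proof
              assume "(u F' \<bullet> (real n *\<^sub>R e0)) *\<^sub>R u F = (u F \<bullet> (real n *\<^sub>R e0)) *\<^sub>R u F'"
              then have "real n *\<^sub>R (real (k F') *\<^sub>R u F) = real n *\<^sub>R (real (k F) *\<^sub>R u F')"
                unfolding ue by (simp add: mult.commute)
              then have "real n = 0 \<or> real (k F') *\<^sub>R u F = real (k F) *\<^sub>R u F'" unfolding scaleR_cancel_left by blast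
              then have par: "real (k F') *\<^sub>R u F = real (k F) *\<^sub>R u F'" using n by auto
              have "u F = u F'" by (rule primitive_parallel_eq[OF fct(1,2,3)[OF FF(1)] fct(1,2,3)[OF FF(2)] par kpos(2,1)])
              then show False using inj_u FF(1,2) F(3) by (auto simp: inj_on_def)
            qed
          qed
        qed
      qed
      also have "\<dots> \<le> measure lebesgue (cbox (- real n *\<^sub>R 1) (2 * real n *\<^sub>R 1) :: (real ^ 'd) set)"
      proof (rule measure_mono_fmeasurable)
        show "\<Union> (?pr ` ?I) \<subseteq> cbox (- real n *\<^sub>R 1) (2 * real n *\<^sub>R 1)"
        proof (rule UN_least)
          fix F assume "F \<in> ?I"
          then have "F \<subseteq> ?P" using facet_of_imp_subset by blast
          then have "?pr F \<subseteq> prism ?P (real n *\<^sub>R e0)" unfolding prism_def by blast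
          also have "\<dots> \<subseteq> cbox (- real n *\<^sub>R 1) (2 * real n *\<^sub>R 1)" by (rule prism_grid_subset[OF C(1) e0])
          finally show "?pr F \<subseteq> cbox (- real n *\<^sub>R 1) (2 * real n *\<^sub>R 1)" .
        qed
        show "\<Union> (?pr ` ?I) \<in> sets lebesgue"
          using compF by (intro sets.finite_UN finI fmeasurableD lmeasurable_compact compact_prism)
      qed simp
      also have "\<dots> = 3 ^ CARD('d) * real n ^ CARD('d)" by (rule measure_grid_box)
      finally have vol: "(\<Sum>F\<in>?I. measure lebesgue (?pr F)) \<le> 3 ^ CARD('d) * real n ^ CARD('d)" .
      let ?W = "\<Sum>F\<in>?I. real (card (C \<inter> F)) powr (1 + 2 / (2 * ?d - 1)) * real (k F)"
      have "?W * real n = (\<Sum>F\<in>?I. real (card (C \<inter> F)) powr (1 + 2 / (2 * ?d - 1)) * (real (k F) * real n))"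
        by (simp add: sum_distrib_right mult.assoc)
      also have "\<dots> \<le> (\<Sum>F\<in>?I. ?M * measure lebesgue (?pr F))" by (rule sum_mono) (rule pr)
      also have "\<dots> = ?M * (\<Sum>F\<in>?I. measure lebesgue (?pr F))" by (rule sum_distrib_left[symmetric])
      also have "\<dots> \<le> ?M * (3 ^ CARD('d) * real n ^ CARD('d))" using vol M by (rule mult_left_mono)
      also have "\<dots> = (?M * 3 ^ CARD('d)) * real n ^ CARD('d)" by simp
      also have "\<dots> \<le> B * real n ^ CARD('d)" using B by (intro mult_right_mono) auto
      also have "\<dots> = (B * real n ^ (CARD('d) - 1)) * real n"
        using power_minus_mult[of "CARD('d)" "real n"] by simp
      finally have "?W \<le> B * real n ^ (CARD('d) - 1)"
        by (rule mult_right_le_imp_le) (use n in simp)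
      then show ?thesis unfolding RSd .
    qed
  qed simp
  have "C = (\<Union>F\<in>?\<F>. C \<inter> F)" using \<open>C \<subseteq> \<Union> ?\<F>\<close> by blast
  then have "card C = card (\<Union>F\<in>?\<F>. C \<inter> F)" by (rule arg_cong)
  also have "\<dots> \<le> (\<Sum>F\<in>?\<F>. card (C \<inter> F))" by (rule card_UN_le[OF fin\<F>])
  finally have "real (card C) \<le> real (\<Sum>F\<in>?\<F>. card (C \<inter> F))" by (rule of_nat_mono)
  also have "\<dots> = (\<Sum>F\<in>?\<F>. real (card (C \<inter> F)))" by simp
  also have "\<dots> = (\<Sum>e0\<in>directions. \<Sum>F\<in>{F\<in>?\<F>. e F = e0}. real (card (C \<inter> F)))"
    using fct(8) by (intro sum.group[symmetric] fin\<F> directions_finite) blast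
  also have "\<dots> \<le> (\<Sum>e0\<in>(directions :: (real ^ 'd) set). (2 * 3 ^ (CARD('d) - 1) + B) * ?R ^ CARD('d))"
    by (intro sum_mono dir)
  also have "\<dots> = real (card (directions :: (real ^ 'd) set)) * ((2 * 3 ^ (CARD('d) - 1) + B) * ?R ^ CARD('d))" by simp
  also have "\<dots> \<le> (2 * ?d) * ((2 * 3 ^ (CARD('d) - 1) + B) * ?R ^ CARD('d))"
  proof (rule mult_right_mono)
    have "real (card (directions :: (real ^ 'd) set)) \<le> real (2 * CARD('d))" by (rule of_nat_mono[OF directions_card])
    then show "real (card (directions :: (real ^ 'd) set)) \<le> 2 * ?d" by simp
    have "0 \<le> 2 * K * (2 * ?d) ^ CARD('d) * 3 ^ CARD('d)" using K by simp
    then have "0 \<le> B" using B by linarith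
    then show "0 \<le> (2 * 3 ^ (CARD('d) - 1) + B) * ?R ^ CARD('d)" by simp
  qed
  finally show ?thesis unfolding Rd by (simp only: mult.assoc)
qed

theorem theorem15:
  assumes "CARD('d::finite) \<ge> 2"
  shows "\<exists>K::real. K > 0 \<and>
    (\<forall>n::nat. \<forall>\<epsilon>::real. n \<ge> 1 \<longrightarrow> \<epsilon> > 0 \<longrightarrow>
      (\<exists>(G' :: (real ^ 'd) set) \<tau>.
        perturbation \<epsilon> (grid n) G' \<tau> \<and> general_position G' \<and>
        (\<forall>C. C \<subseteq> G' \<longrightarrow> convex_independent C \<longrightarrow>
          real (card C) \<le>
            K * real n powr (real CARD('d) * (real CARD('d) - 1) / (real CARD('d) + 1)))))"
proof -
  let ?d = "real CARD('d)"
  obtain K where K: "K > 0" and pert: "\<And>n \<epsilon>. \<epsilon> > 0 \<Longrightarrow> \<exists>\<tau> :: real ^ 'd \<Rightarrow> real ^ 'd.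
     inj_on \<tau> (grid n) \<and> (\<forall>x\<in>grid n. norm (\<tau> x - x) \<le> \<epsilon>) \<and> general_position (\<tau> ` grid n) \<and>
     (\<forall>C\<subseteq>grid n. strictly_exposed \<tau> C \<longrightarrow> line_sparse K C)"
    using sparse_perturbation_exists[where 'd = 'd] by blast
  define B where "B = max 1 (2 * K * (2 * ?d) ^ CARD('d) * 3 ^ CARD('d))"
  have B: "B \<ge> 1" "2 * K * (2 * ?d) ^ CARD('d) * 3 ^ CARD('d) \<le> B" by (simp_all add: B_def)
  \<comment> \<open>The first entry serves the degenerate sets and, as \<open>B \<ge> 1\<close>, the
    case \<open>n = 1\<close>; the second serves the full-dimensional sets.\<close>
  define M where "M = max B (2 * ?d * (2 * 3 ^ (CARD('d) - 1) + B))"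
  have M: "M \<ge> B" "M \<ge> 2 * ?d * (2 * 3 ^ (CARD('d) - 1) + B)" by (simp_all add: M_def)
  let ?t = "\<lambda>n. real n powr (?d * (?d - 1) / (?d + 1))"
  have "\<exists>(G' :: (real ^ 'd) set) \<tau>. perturbation \<epsilon> (grid n) G' \<tau> \<and> general_position G' \<and>
      (\<forall>C. C \<subseteq> G' \<longrightarrow> convex_independent C \<longrightarrow> real (card C) \<le> M * ?t n)"
    if n: "n \<ge> 1" and \<epsilon>: "\<epsilon> > 0" for n :: nat and \<epsilon> :: real
  proof -
    \<comment> \<open>The radius depends on the grid only, so it can be fixed before the
      perturbation is chosen with bound \<open>min \<epsilon> \<rho>\<close>.\<close>
    obtain \<rho> where \<rho>: "\<rho> > 0" and interior: "\<And>C (\<tau> :: real ^ 'd \<Rightarrow> real ^ 'd). C \<subseteq> grid n \<Longrightarrow>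
        (\<And>x. x \<in> grid n \<Longrightarrow> norm (\<tau> x - x) \<le> \<rho>) \<Longrightarrow> strictly_exposed \<tau> C \<Longrightarrow> C \<inter> interior (convex hull C) = {}"
      using exposed_avoids_interior[OF finite_grid] by metis
    have "min \<epsilon> \<rho> > 0" using \<epsilon> \<rho> by simp
    from pert[OF this, of n] obtain \<tau> :: "real ^ 'd \<Rightarrow> real ^ 'd" where \<tau>: "inj_on \<tau> (grid n)"
      "\<And>x. x \<in> grid n \<Longrightarrow> norm (\<tau> x - x) \<le> min \<epsilon> \<rho>" "general_position (\<tau> ` grid n)"
      "\<And>C. C \<subseteq> grid n \<Longrightarrow> strictly_exposed \<tau> C \<Longrightarrow> line_sparse K C"
      by blast
    have "real (card C') \<le> M * ?t n" if C': "C' \<subseteq> \<tau> ` grid n" "convex_independent C'" for C'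
    proof -
      obtain C where C: "C \<subseteq> grid n" "C' = \<tau> ` C" using C'(1) by (auto simp: subset_image_iff)
      have finC: "finite C" using C(1) finite_grid finite_subset by blast
      have injC: "inj_on \<tau> C" using \<tau>(1) C(1) inj_on_subset by blast
      have cC: "card C' = card C" unfolding C(2) using injC by (rule card_image)
      have ex: "strictly_exposed \<tau> C"
        using strictly_exposedI_convex_independent[OF injC finC] C'(2) C(2) by simp
      have t0: "?t n \<ge> 0" by simp
      have "real (card C) \<le> M * ?t n"
      \<comment> \<open>For \<open>n = 1\<close> the grid is a single point and does not span the
        space, so the degenerate case does not cover it.\<close>
      proof (cases "n \<ge> 2")
        case False
        then have "n = 1" using n by simp
        have "card C \<le> card (grid n :: (real ^ 'd) set)" by (rule card_mono[OF finite_grid C(1)])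
        then have "real (card C) \<le> 1" using \<open>n = 1\<close> by (simp add: card_grid)
        then show ?thesis using B(1) M(1) \<open>n = 1\<close> by simp
      next
        case n2: True
        show ?thesis
        proof (cases "aff_dim C = int CARD('d)")
          case True
          have "C \<inter> interior (convex hull C) = {}"
            by (rule interior[OF C(1) _ ex]) (use \<tau>(2) in fastforce)
          moreover have "line_sparse K X" if X: "X \<subseteq> C" for X
          proof (rule \<tau>(4))
            show "strictly_exposed \<tau> X" using ex X unfolding strictly_exposed_def by (meson subsetD)
          qed (use X C(1) in blast)
          ultimately have "real (card C) \<le> 2 * ?d * (2 * 3 ^ (CARD('d) - 1) + B) * ?t n"
            by (intro card_full_le[OF assms n C(1) True _ _ K B(2)])
          also have "\<dots> \<le> M * ?t n" using M(2) t0 by (rule mult_right_mono)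
          finally show ?thesis .
        next
          case False
          then have "aff_dim C < int CARD('d)" using aff_dim_le_DIM[of C] by simp
          then have "real (card C) \<le> B * ?t n"
            by (rule card_degenerate_le[OF n2 C(1) _ \<tau>(4)[OF C(1) ex] K B])
          also have "\<dots> \<le> M * ?t n" using M(1) t0 by (rule mult_right_mono)
          finally show ?thesis .
        qed
      qed
      then show ?thesis by (simp only: cC)
    qed
    moreover have "perturbation \<epsilon> (grid n) (\<tau> ` grid n) \<tau>"
      unfolding perturbation_def bij_betw_def using \<tau>(1,2) by fastforce
    ultimately show ?thesis using \<tau>(3) by blast
  qed
  moreover have "M > 0" using M(1) B(1) by linarith
  ultimately show ?thesis by blast
qed

end
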